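(* Let $d,p,s\in\mathbb{N}$, $m\in\mathbb{N}_0$, $\Theta\subset\mathbb{R}^p$, $\theta_0\in\Theta$ and $k=2p+1$. Let the noise sequences, the mappings $G_u^{(i,r)}$, $u\in[0,1]$, and the random Fourier features $\varphi=(\varphi_1,\dots,\varphi_k)$ with random parameters $(\vartheta_1,\dots,\vartheta_k)$ be as in the context. Suppose the following hold. (B1) For each $n\in\mathbb{N}$, the observed and simulated time series of length $n$ are $X_t^{\mathrm{obs}}=G_{t/n}^{(n,0)}(\boldsymbol{\varepsilon}_t^{(0)},\theta_0)$ and $X_t^{(r)}(\theta)=G_{t/n}^{(n,r)}(\boldsymbol{\varepsilon}_t^{(r)},\theta)$, $t=1,\dots,n$, for all $r=1,\dots,s$ and $\theta\in\Theta$. (B2) For each $u\in[0,1]$ there is a measurable mapping $G_u:\mathbb{R}^\infty\times\Theta\to\mathbb{R}^d$ such that $(G_u(\boldsymbol{\varepsilon}_j,\theta))_{j\in\mathbb{Z}}$ is a stationary ergodic process, and for some $q>2$, as $i\to\infty$, $$\sup_{\theta\in\Theta}\sup_{u\in[0,1]}\max_{0\le r\le s}\big\|G_u^{(i,r)}(\boldsymbol{\varepsilon}_0,\theta)-G_u(\boldsymbol{\varepsilon}_0,\theta)\big\|_{\mathcal{L}^q(\theta)}\to0 .$$ (B3) There is $\tilde p\in\mathbb{N}$ such that for each $u\in[0,1]$ there exists a Lipschitz, semialgebraic mapping $g_u:\Theta\to\mathbb{R}^{\tilde p}$, written $g_u(\theta)=\tilde\theta_u$, with image $\tilde\Theta_u=\{g_u(\theta):\theta\in\Theta\}\subset\mathbb{R}^{\tilde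 p}$, and a measurable mapping $\tilde G_u:\mathbb{R}^\infty\times\tilde\Theta_u\to\mathbb{R}^d$ such that $\tilde G_u(\boldsymbol{\varepsilon}_0,\tilde\theta_u)=G_u(\boldsymbol{\varepsilon}_0,\theta)$ whenever $\tilde\theta_u=g_u(\theta)$, where $(\tilde G_u(\boldsymbol{\varepsilon}_j,\tilde\theta_u))_{j\in\mathbb{Z}}$ is a stationary ergodic process for each fixed $u$. Furthermore, $(u,\theta)\mapsto g_u(\theta)$ is jointly Borel measurable. Let $\tilde P_{\tilde\theta_u,u}$ denote the distribution of $[\tilde G_u(\boldsymbol{\varepsilon}_{-m},\tilde\theta_u),\dots,\tilde G_u(\boldsymbol{\varepsilon}_0,\tilde\theta_u)]^\top$ and $\tilde\psi_{\tilde\theta_u,u}$ its characteristic function. (B4) For all $u\in[0,1]$: (i) $\tilde\Theta_u\subset\mathbb{R}^{\tilde p}$ is compact, and $\Theta\subset\mathbb{R}^p$ is compact and semialgebraic with non-empty interior; (ii) the map $\tilde\theta_u\mapsto\tilde P_{\tilde\theta_u,u}$ is injective on $\tilde\Theta_u$; (iii) the map $(\tilde\theta_u,\omega)\mapsto\tilde\psi_{\tilde\theta_u,u}(\omega)$ admits a jointly real analytic extension to $\tilde O_u\times\mathbb{R}^{(m+1)\times d}$, where $\tilde O_u\subset\mathbb{R}^{\tilde p}$ is an open neighborhood of $\tilde\Theta_u$. (B5) (i) The set-valued map $u\mapsto\tilde\Theta_u$ is weakly Borel measurable. (ii) There exists a jointly Borel measurable function $\bar\psi:[0,1]\times\mathbb{R}^{\tilde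 p}\times\mathbb{R}^{(m+1)\times d}\to\mathbb{C}$ such that $\bar\psi(u,\tilde\theta_u,\omega)=\tilde\psi_{\tilde\theta_u,u}(\omega)$ for all $u\in[0,1]$, $\tilde\theta_u\in\tilde\Theta_u$, $\omega\in\mathbb{R}^{(m+1)\times d}$, and $\bar\psi$ is continuous in its second argument for each fixed $(u,\omega)$. For $u\in[0,1]$ define $\tilde\Phi_u:\tilde\Theta_u\to\mathbb{R}^k$ by $\tilde\Phi_u(\tilde\theta_u)=\int_{\mathbb{R}^{(m+1)\times d}}\varphi(x)\,d\tilde P_{\tilde\theta_u,u}(x)$ (the limiting local expectations of the random Fourier features). Then, with probability one over the draw of the random parameters $(\vartheta_1,\dots,\vartheta_k)$ for the $k=2p+1$ random Fourier features, the mapping $\tilde\theta_u\mapsto\tilde\Phi_u(\tilde\theta_u)$ is one-to-one on $\tilde\Theta_u$ for (Lebesgue-)almost every $u\in[0,1]$.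
   Context: Noise. $(\varepsilon_i)_{i\in\mathbb{Z}}$ is an iid sequence of (real) random variables, and $(\varepsilon_i^{(r)})_{i\in\mathbb{Z}}$, $r=0,1,\dots,s$, are iid copies of this sequence. Put $\boldsymbol{\varepsilon}_t=(\varepsilon_t,\varepsilon_{t-1},\dots)$ and $\boldsymbol{\varepsilon}_t^{(r)}=(\varepsilon_t^{(r)},\varepsilon_{t-1}^{(r)},\dots)$. $\mathbb{R}^\infty$ carries the $\sigma$-algebra generated by all finite projections. Mappings. For each $u\in[0,1]$, $i\in\mathbb{N}$, $r=0,1,\dots,s$, $G_u^{(i,r)}:\mathbb{R}^\infty\times\Theta\to\mathbb{R}^d$ is measurable and $(G_u^{(i,r)}(\boldsymbol{\varepsilon}_j,\theta))_{j\in\mathbb{Z}}$ is a stationary ergodic process for each $\theta$. Norms. $\|\cdot\|$ is the Euclidean norm; for a random vector $X$ whose law depends on $\theta$, $\|X\|_{\mathcal{L}^q(\theta)}=(\mathbb{E}_\theta\|X\|^q)^{1/q}$, where $\mathbb{E}_\theta$ is expectation under that $\theta$-dependent law. Random Fourier features. For $x=(x_1,\dots,x_{m+1})^\top\in\mathbb{R}^{(m+1)\times d}$ with $x_j\in\mathbb{R}^d$, $$\varphi_i(x)=\cos\Big(\sum_{j=1}^{m+1}\Omega_{i,j}\cdot x_j+\alpha_i\Big),\quad i=1,\dots,k,$$ with $\Omega_{i,j}\sim N(0,I_d)$ iid and $\alpha_i\sim U(-\pi,\pi)$ iid, all drawn independently of each other and of the data (noise). Put $\vartheta_i=(\Omega_{i,1}^\top,\dots,\Omega_{i,m+1}^\top,\alpha_i)^\top$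 and $\varphi=(\varphi_1,\dots,\varphi_k):\mathbb{R}^{(m+1)\times d}\to\mathbb{R}^k$. Semialgebraic sets and maps. A subset of $\mathbb{R}^a$ is semialgebraic if it is a finite union of finite intersections of sets $\{x: f(x)*0\}$ with $f$ a real polynomial and $*$ either $<$ or $=$. A map between semialgebraic subsets of Euclidean spaces is semialgebraic if its graph is semialgebraic. Weakly Borel measurable set-valued map: $\{u\in[0,1]:\tilde\Theta_u\cap U\ne\emptyset\}$ is Borel for every open $U\subset\mathbb{R}^{\tilde p}$. A complex-valued function is real analytic if its real and imaginary parts are. *)

theory Defs
  imports "HOL-Probability.Probability"
begin

section \<open>Semialgebraic sets and real analytic functions\<close>

text \<open>On a finite-dimensional space \<^const>\<open>real_polynomial_function\<close> holds exactly of the real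
  polynomials in the coordinates.\<close>

definition basic_semialgebraic :: "'a::euclidean_space set \<Rightarrow> bool" where
  "basic_semialgebraic B \<longleftrightarrow>
     (\<exists>f. real_polynomial_function f \<and> (B = {x. f x < 0} \<or> B = {x. f x = 0}))"

definition semialgebraic :: "'a::euclidean_space set \<Rightarrow> bool" where
  "semialgebraic S \<longleftrightarrow>
     (\<exists>\<F>. finite \<F> \<and> (\<forall>\<C>\<in>\<F>. finite \<C> \<and> (\<forall>B\<in>\<C>. basic_semialgebraic B)) \<and>
          S = (\<Union>\<C>\<in>\<F>. \<Inter>\<C>))"

definition semialgebraic_map ::
  "'a::euclidean_space set \<Rightarrow> 'b::euclidean_space set \<Rightarrow> ('a \<Rightarrow> 'b) \<Rightarrow> bool" where
  "semialgebraic_map S T f \<longleftrightarrow>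
     semialgebraic S \<and> semialgebraic T \<and> f ` S \<subseteq> T \<and> semialgebraic ((\<lambda>x. (x, f x)) ` S)"

text \<open>Multi-indices are functions on \<^const>\<open>Basis\<close>; \<^const>\<open>has_sum\<close> is unconditional
  convergence of the multivariate power series. The definition is meant for open \<open>S\<close>.\<close>

definition real_analytic_on :: "('a::euclidean_space \<Rightarrow> real) \<Rightarrow> 'a set \<Rightarrow> bool" where
  "real_analytic_on f S \<longleftrightarrow>
     (\<forall>x\<in>S. \<exists>r>0. \<exists>c :: ('a \<Rightarrow> nat) \<Rightarrow> real. \<forall>y\<in>ball x r.
        ((\<lambda>\<nu>. c \<nu> * (\<Prod>b\<in>Basis. ((y - x) \<bullet> b) ^ \<nu> b)) has_sum f y)
          (PiE Basis (\<lambda>_. UNIV)))"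

definition real_analytic_complex_on :: "('a::euclidean_space \<Rightarrow> complex) \<Rightarrow> 'a set \<Rightarrow> bool" where
  "real_analytic_complex_on f S \<longleftrightarrow>
     real_analytic_on (\<lambda>x. Re (f x)) S \<and> real_analytic_on (\<lambda>x. Im (f x)) S"


section \<open>Random sequences\<close>

text \<open>The space \<open>\<real>\<^sup>\<infinity>\<close> of one-sided sequences with the \<open>\<sigma>\<close>-algebra of the finite projections.\<close>

abbreviation seq_space :: "(nat \<Rightarrow> real) measure" where
  "seq_space \<equiv> PiM UNIV (\<lambda>_. borel)"

abbreviation biseq_space :: "(int \<Rightarrow> 'b::topological_space) measure" where
  "biseq_space \<equiv> PiM UNIV (\<lambda>_. borel)"

definition past :: "(int \<Rightarrow> 'w \<Rightarrow> real) \<Rightarrow> int \<Rightarrow> 'w \<Rightarrow> nat \<Rightarrow> real" where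
  "past e t w = (\<lambda>l. e (t - int l) w)"

definition iid_sequence :: "'w measure \<Rightarrow> (int \<Rightarrow> 'w \<Rightarrow> real) \<Rightarrow> bool" where
  "iid_sequence M e \<longleftrightarrow>
     prob_space.indep_vars M (\<lambda>_. borel) e UNIV \<and>
     (\<forall>i j. distr M borel (e i) = distr M borel (e j))"

definition iid_copies ::
  "'w measure \<Rightarrow> (int \<Rightarrow> 'w \<Rightarrow> real) \<Rightarrow> (nat \<Rightarrow> int \<Rightarrow> 'w \<Rightarrow> real) \<Rightarrow> nat \<Rightarrow> bool" where
  "iid_copies M e e' s \<longleftrightarrow>
     prob_space.indep_vars M (\<lambda>_. biseq_space) (\<lambda>r w i. e' r i w) {0..s} \<and>
     (\<forall>r\<in>{0..s}. distr M biseq_space (\<lambda>w i. e' r i w) = distr M biseq_space (\<lambda>w i. e i w))"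

definition stationary_ergodic ::
  "'w measure \<Rightarrow> (int \<Rightarrow> 'w \<Rightarrow> 'b::topological_space) \<Rightarrow> bool" where
  "stationary_ergodic M X \<longleftrightarrow>
     (\<forall>j. X j \<in> borel_measurable M) \<and>
     (\<forall>h. distr M biseq_space (\<lambda>w j. X (j + h) w) = distr M biseq_space (\<lambda>w j. X j w)) \<and>
     (\<forall>A\<in>sets biseq_space. (\<lambda>x j. x (j + 1)) -` A = A \<longrightarrow>
        measure (distr M biseq_space (\<lambda>w j. X j w)) A \<in> {0, 1})"

text \<open>Extended-valued, so that a convergence statement about it includes finiteness of the moment.\<close>

definition Lq_norm :: "'w measure \<Rightarrow> real \<Rightarrow> ('w \<Rightarrow> 'b::real_normed_vector) \<Rightarrow> ennreal" where
  "Lq_norm M q X =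
     (let I = \<integral>\<^sup>+w. ennreal (norm (X w) powr q) \<partial>M
      in if I = \<infinity> then \<infinity> else ennreal (enn2real I powr (1 / q)))"

definition char_fun :: "'a::euclidean_space measure \<Rightarrow> 'a \<Rightarrow> complex" where
  "char_fun P \<omega> = (CLINT x|P. iexp (\<omega> \<bullet> x))"


section \<open>Random Fourier features\<close>

text \<open>The space of real \<open>(m+1) \<times> d\<close> matrices is \<^typ>\<open>real ^ 'd ^ 'lag\<close>, where the row index type
  comes with a bijection \<open>pos\<close> from \<^typ>\<open>'lag\<close> onto \<open>{1..m+1}\<close> giving the row numbers.\<close>

definition std_gaussian :: "'a::euclidean_space measure" where
  "std_gaussian = density lborel (\<lambda>x. ennreal (\<Prod>b\<in>Basis. std_normal_density (x \<bullet> b)))"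

definition rff ::
  "('k \<Rightarrow> 'lag \<Rightarrow> real ^ 'd) \<Rightarrow> ('k \<Rightarrow> real) \<Rightarrow> real ^ 'd ^ 'lag \<Rightarrow> real ^ 'k" where
  "rff Om al x = (\<chi> i. cos ((\<Sum>j\<in>UNIV. Om i j \<bullet> x $ j) + al i))"

datatype ('k, 'lag) source = Noise | Frequency 'k 'lag | Phase 'k

text \<open>All frequencies, all phases and the whole noise (base sequence together with its
  \<open>s + 1\<close> copies, as one block) are mutually independent.\<close>

definition rff_parameters ::
  "'w measure \<Rightarrow> (int \<Rightarrow> 'w \<Rightarrow> real) \<Rightarrow> (nat \<Rightarrow> int \<Rightarrow> 'w \<Rightarrow> real) \<Rightarrow> nat \<Rightarrow>
   ('k \<Rightarrow> 'lag \<Rightarrow> 'w \<Rightarrow> real ^ 'd) \<Rightarrow> ('k \<Rightarrow> 'w \<Rightarrow> real) \<Rightarrow> bool" where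
  "rff_parameters M e e' s Om al \<longleftrightarrow>
     (\<forall>i j. Om i j \<in> borel_measurable M \<and> distr M borel (Om i j) = std_gaussian) \<and>
     (\<forall>i. al i \<in> borel_measurable M \<and>
          distr M borel (al i) = uniform_measure lborel {-pi<..<pi}) \<and>
     prob_space.indep_sets M
       (\<lambda>src. case src of
          Noise \<Rightarrow> sets (vimage_algebra (space M)
              (\<lambda>w. (\<lambda>i. e i w, \<lambda>r\<in>{0..s}. \<lambda>i. e' r i w))
              (biseq_space \<Otimes>\<^sub>M PiM {0..s} (\<lambda>_. biseq_space)))
        | Frequency i j \<Rightarrow> sets (vimage_algebra (space M) (Om i j) borel)
        | Phase i \<Rightarrow> sets (vimage_algebra (space M) (al i) borel))
       UNIV"


section \<open>Limiting local laws\<close>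

text \<open>Row \<open>j\<close> of the random matrix is the process at time \<open>j - 1 - m\<close>, so rows
  \<open>1, \<dots>, m+1\<close> are the times \<open>-m, \<dots>, 0\<close>.\<close>

definition local_law ::
  "'w measure \<Rightarrow> (int \<Rightarrow> 'w \<Rightarrow> real) \<Rightarrow> ('lag::finite \<Rightarrow> nat) \<Rightarrow> nat \<Rightarrow>
   (real \<Rightarrow> (nat \<Rightarrow> real) \<Rightarrow> 'q \<Rightarrow> real ^ 'd) \<Rightarrow> real \<Rightarrow> 'q \<Rightarrow> (real ^ 'd ^ 'lag) measure" where
  "local_law M e pos m Gt u \<theta> =
     distr M borel (\<lambda>w. \<chi> j. Gt u (past e (int (pos j) - 1 - int m) w) \<theta>)"

definition local_moment ::
  "'w measure \<Rightarrow> (int \<Rightarrow> 'w \<Rightarrow> real) \<Rightarrow> ('lag::finite \<Rightarrow> nat) \<Rightarrow> nat \<Rightarrow>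
   (real \<Rightarrow> (nat \<Rightarrow> real) \<Rightarrow> 'q \<Rightarrow> real ^ 'd) \<Rightarrow> (real ^ 'd ^ 'lag \<Rightarrow> real ^ 'k) \<Rightarrow>
   real \<Rightarrow> 'q \<Rightarrow> real ^ 'k" where
  "local_moment M e pos m Gt \<phi> u \<theta> = (LINT x|local_law M e pos m Gt u \<theta>. \<phi> x)"

end

theory Submission
  imports Defs
begin

text \<open>By Fubini it suffices to treat one \<open>u\<close> and phases \<open>\<alpha>\<^sub>i\<close> with \<open>sin \<alpha>\<^sub>i \<noteq> 0 \<noteq> cos \<alpha>\<^sub>i\<close>. The \<open>i\<close>-th
  moment is then \<open>f\<^sub>i(z, \<omega>) = Re (exp (\<i> \<alpha>\<^sub>i) \<psi>\<^sub>z(\<omega>))\<close> at \<open>\<omega> = \<Omega>\<^sub>i\<close>, and since characteristic functions determine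
  laws, \<open>f\<^sub>i(z\<^sub>1, \<cdot>) - f\<^sub>i(z\<^sub>2, \<cdot>)\<close> is a nonzero analytic function for \<open>z\<^sub>1 \<noteq> z\<^sub>2\<close>. At each of its zeros some
  iterated partial derivative vanishes while a further partial derivative of it does not; there are
  countably many such patterns. On each pattern one coordinate of \<open>\<Omega>\<^sub>i\<close> is locally a Lipschitz function of its
  other coordinates and of the parameters \<open>x\<^sub>1, x\<^sub>2 \<in> \<Theta>\<close> with \<open>z\<^sub>j = g\<^sub>u(x\<^sub>j)\<close>. So the frequencies \<open>\<Omega>\<close> admitting a
  collision are a Lipschitz image of a set with \<open>2p + 1\<close> coordinates removed and only \<open>2p\<close> added, which is
  Lebesgue null.\<close>

section \<open>Real analytic functions\<close>

text \<open>The local parameters z live in a space whose dimension bears no relation to p, so a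
  dimension count there proves nothing. Pairs are counted in \<Theta> \<times> \<Theta> instead and
  pushed forward by \<open>g u\<close>. A Lipschitz \<open>g u\<close> may have kinks, so the
  moments need not be differentiable in x: derivatives are taken in \<omega> only, and x enters
  through Lipschitz estimates. Each moment sees just its own block of \<Omega>, so every one of the
  k equations removes a coordinate from a different block and the removals do not interfere. A zero
  in \<omega> may be degenerate to any finite order; it is still a transversal zero of a suitable
  derivative, whence the patterns. A phase with vanishing sine or cosine would reveal only one of
  the real and imaginary parts of the characteristic function. Fubini needs a collision set that is
  Borel jointly in u, phases and frequencies. The analytic extension \<Psi> comes separately for
  each u and carries no measurability in u; the measurable extension \<psi> carries no analyticity.
  They are known to agree only for z in the image of \<Theta>, so each serves its own half of the
  proof.\<close>

text \<open>A multivariate series is grouped by the exponent \<open>k\<close> of one variable, with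
  \<open>q\<close> standing for the remaining exponents; the one-variable theorem then yields the
  derivative. Unconditional convergence of the differentiated double series is a separate claim,
  needed to remain within \<open>real_analytic_on\<close>.\<close>

lemma has_sum_power_series_termdiff:
  fixes e :: "nat \<Rightarrow> 'q \<Rightarrow> real"
  assumes F: "\<And>t. \<bar>t\<bar> < d \<Longrightarrow> ((\<lambda>(k, q). e k q * t ^ k) has_sum F t) (UNIV \<times> Q)"
    and s: "\<bar>s\<bar> < d"
  obtains D where "(F has_real_derivative D) (at s)"
    and "((\<lambda>(k, q). real (Suc k) * e (Suc k) q * s ^ k) has_sum D) (UNIV \<times> Q)"
proof -
  \<comment> \<open>A radius strictly between |s| and d: absolute convergence at r dominates the
    differentiated series at s, because powers of |s| / r < 1 absorb the factor k + 1.\<close>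
  define r where "r = (\<bar>s\<bar> + d) / 2"
  have r: "\<bar>s\<bar> < r" "r < d" "0 < r" "\<bar>r\<bar> < d" using s by (auto simp: r_def)
  have abs_r: "(\<lambda>x. norm (case x of (k, q) \<Rightarrow> e k q * r ^ k)) summable_on (UNIV \<times> Q)"
    using F[OF r(4)] by (auto simp only: summable_on_iff_abs_summable_on_real[symmetric] summable_on_def)
  define A where "A k = infsum (e k) Q" for k
  have eA: "(e k has_sum A k) Q" for k
  proof -
    have "(\<lambda>(k, q). e k q * r ^ k) summable_on ((\<lambda>q. (k, q)) ` Q)"
      by (rule summable_on_subset_banach[where A="UNIV \<times> Q"])
        (use F[OF r(4)] in \<open>auto simp: summable_on_def\<close>)
    then have "(\<lambda>q. e k q * r ^ k) summable_on Q"
      by (subst (asm) summable_on_reindex) (auto simp: inj_on_def o_def)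
    then have "e k summable_on Q"
      using r(3) by (simp add: summable_on_cmult_left')
    then show ?thesis by (simp add: A_def)
  qed
  have FA: "(\<lambda>k. A k * t ^ k) sums F t" if "\<bar>t\<bar> < d" for t
  proof (rule has_sum_imp_sums, rule has_sum_Sigma'[OF F[OF that]])
    fix k show "((\<lambda>y. case (k, y) of (k, q) \<Rightarrow> e k q * t ^ k) has_sum A k * t ^ k) Q"
      using has_sum_cmult_left[OF eA] by simp
  qed
  have der: "((\<lambda>z. \<Sum>n. A n * z ^ n) has_real_derivative (\<Sum>n. diffs A n * s ^ n)) (at s)"
    by (rule termdiffs_strong'[where K=d]) (use FA s in \<open>auto simp: sums_iff\<close>)
  have derF: "(F has_real_derivative (\<Sum>n. diffs A n * s ^ n)) (at s)"
    by (rule has_field_derivative_transform_within_open[OF der, of "{-d<..<d}"])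
      (use FA s in \<open>auto simp: sums_iff abs_less_iff\<close>)
  obtain C where C: "\<And>k. real (Suc k) * \<bar>s\<bar> ^ k \<le> C * r ^ Suc k"
  proof -
    have "(\<lambda>n. of_nat n * (\<bar>s\<bar> / r) ^ n) \<longlonglongrightarrow> 0"
      by (rule powser_times_n_limit_0) (use r in auto)
    moreover have "(\<lambda>n. (\<bar>s\<bar> / r) ^ n) \<longlonglongrightarrow> 0"
      by (rule LIMSEQ_power_zero) (use r in auto)
    ultimately have "(\<lambda>n. of_nat n * (\<bar>s\<bar> / r) ^ n + (\<bar>s\<bar> / r) ^ n) \<longlonglongrightarrow> 0 + 0"
      by (rule tendsto_add)
    then have "Bseq (\<lambda>n. of_nat n * (\<bar>s\<bar> / r) ^ n + (\<bar>s\<bar> / r) ^ n)"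
      by (intro convergent_imp_Bseq) (auto simp: convergent_def)
    then obtain B where B: "\<And>n. norm (of_nat n * (\<bar>s\<bar> / r) ^ n + (\<bar>s\<bar> / r) ^ n) \<le> B"
      by (auto simp: Bseq_def)
    show thesis
    proof (rule that[of "B / r"])
      fix k
      have "(real k + 1) * (\<bar>s\<bar> / r) ^ k \<le> B" using B[of k] by (simp add: algebra_simps)
      then have "(real k + 1) * (\<bar>s\<bar> / r) ^ k * r ^ k \<le> B * r ^ k"
        by (rule mult_right_mono) (use r in auto)
      moreover have "(\<bar>s\<bar> / r) ^ k * r ^ k = \<bar>s\<bar> ^ k"
        using r by (simp add: power_divide)
      ultimately show "real (Suc k) * \<bar>s\<bar> ^ k \<le> B / r * r ^ Suc k"
        using r by (simp add: mult.assoc algebra_simps)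
    qed
  qed
  let ?g = "\<lambda>(k, q). real (Suc k) * e (Suc k) q * s ^ k"
  have "(\<lambda>x. norm (?g x)) summable_on (UNIV \<times> Q)"
  proof (rule Infinite_Sum.abs_summable_on_comparison_test)
    have "(\<lambda>x. norm (case x of (k, q) \<Rightarrow> e k q * r ^ k)) summable_on ((\<lambda>(k, q). (Suc k, q)) ` (UNIV \<times> Q))"
      by (rule summable_on_subset_banach[OF abs_r]) auto
    then have "(\<lambda>x. norm (case x of (k, q) \<Rightarrow> e (Suc k) q * r ^ Suc k)) summable_on (UNIV \<times> Q)"
      by (subst (asm) summable_on_reindex) (auto simp: inj_on_def o_def case_prod_unfold)
    then have "(\<lambda>x. C * norm (case x of (k, q) \<Rightarrow> e (Suc k) q * r ^ Suc k)) summable_on (UNIV \<times> Q)"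
      by (rule summable_on_cmult_right)
    then show "(\<lambda>x. norm (C * norm (case x of (k, q) \<Rightarrow> e (Suc k) q * r ^ Suc k))) summable_on (UNIV \<times> Q)"
      by (rule summable_on_iff_abs_summable_on_real[THEN iffD1])
  next
    fix x :: "nat \<times> 'q" assume "x \<in> UNIV \<times> Q"
    obtain k q where x: "x = (k, q)" by force
    have "\<bar>e (Suc k) q\<bar> * (real (Suc k) * \<bar>s\<bar> ^ k) \<le> \<bar>e (Suc k) q\<bar> * (C * r ^ Suc k)"
      by (rule mult_left_mono[OF C]) auto
    also have "\<dots> = C * norm (case x of (k, q) \<Rightarrow> e (Suc k) q * r ^ Suc k)"
      using r by (simp add: x abs_mult power_abs)
    also have "\<dots> \<le> norm (C * norm (case x of (k, q) \<Rightarrow> e (Suc k) q * r ^ Suc k))"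
      unfolding real_norm_def[of "C * _"] by (rule abs_ge_self)
    finally show "norm (?g x) \<le> norm (C * norm (case x of (k, q) \<Rightarrow> e (Suc k) q * r ^ Suc k))"
      by (simp add: x abs_mult power_abs mult_ac)
  qed
  then have "?g summable_on (UNIV \<times> Q)"
    by (rule summable_on_iff_abs_summable_on_real[THEN iffD2])
  then obtain D where D: "(?g has_sum D) (UNIV \<times> Q)" by (auto simp: summable_on_def)
  have "(\<lambda>k. real (Suc k) * A (Suc k) * s ^ k) sums D"
  proof (rule has_sum_imp_sums, rule has_sum_Sigma'[OF D])
    fix k show "((\<lambda>y. ?g (k, y)) has_sum real (Suc k) * A (Suc k) * s ^ k) Q"
      using has_sum_cmult_right[OF has_sum_cmult_left[OF eA[of "Suc k"], of "s^k"], of "real (Suc k)"]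
      by (simp add: mult.assoc)
  qed
  then have "(\<Sum>n. diffs A n * s ^ n) = D" by (simp add: sums_iff diffs_def)
  with derF D show thesis using that by blast
qed

definition partial_deriv :: "'a::euclidean_space \<Rightarrow> ('a \<Rightarrow> real) \<Rightarrow> 'a \<Rightarrow> real" where
  "partial_deriv b f x = deriv (\<lambda>t. f (x + t *\<^sub>R b)) 0"

text \<open>The radius is halved so that, for y within r/2 of x, replacing one offset of y by any t
  with |t| < r/2 stays inside the original ball; the one-variable lemma applies on that
  line.\<close>

lemma power_series_partial_derivative:
  fixes f :: "'a::euclidean_space \<Rightarrow> real"
  assumes f: "\<And>y. y \<in> ball x r \<Longrightarrow>
      ((\<lambda>\<nu>. c \<nu> * (\<Prod>b\<in>Basis. ((y - x) \<bullet> b) ^ \<nu> b)) has_sum f y) (PiE Basis (\<lambda>_. UNIV))"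
    and b: "b \<in> Basis" and y: "y \<in> ball x (r / 2)"
  obtains D where "((\<lambda>t. f (y + t *\<^sub>R b)) has_real_derivative D) (at 0)"
    and "((\<lambda>\<nu>. (real (Suc (\<nu> b)) * c (\<nu>(b := Suc (\<nu> b)))) * (\<Prod>b\<in>Basis. ((y - x) \<bullet> b) ^ \<nu> b))
      has_sum D) (PiE Basis (\<lambda>_. UNIV))"
proof -
  \<comment> \<open>A pair \<open>(k, \<nu>)\<close> with \<open>\<nu>\<close> in \<open>Q\<close>
    encodes the multi-index \<open>\<nu>(b := k)\<close>. The other variables are frozen in
    \<open>w\<close>, and \<open>F t\<close> is f at y with the b-offset set to t, so
    \<open>F s\<close> is \<open>f y\<close>.\<close>
  define Q :: "('a \<Rightarrow> nat) set" where "Q = {\<nu> \<in> PiE Basis (\<lambda>_. UNIV). \<nu> b = 0}"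
  define s where "s = (y - x) \<bullet> b"
  define w where "w \<nu> = (\<Prod>b'\<in>Basis-{b}. ((y - x) \<bullet> b') ^ \<nu> b')" for \<nu> :: "'a \<Rightarrow> nat"
  define e where "e k \<nu> = c (\<nu>(b := k)) * w \<nu>" for k \<nu>
  define F where "F t = f (y + (t - s) *\<^sub>R b)" for t
  have ny: "norm (y - x) < r / 2" using y by (simp add: dist_norm norm_minus_commute)
  have s: "\<bar>s\<bar> < r / 2"
    using Basis_le_norm[OF b, of "y - x"] ny by (simp add: s_def)
  have w_upd: "w (\<nu>(b := k)) = w \<nu>" for \<nu> k
    unfolding w_def by (rule prod.cong) auto
  have prodQ: "(\<Prod>b'\<in>Basis. (((y + (t - s) *\<^sub>R b) - x) \<bullet> b') ^ \<nu> b') = t ^ \<nu> b * w \<nu>" for t \<nu>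
  proof -
    have "(\<Prod>b'\<in>Basis. (((y + (t - s) *\<^sub>R b) - x) \<bullet> b') ^ \<nu> b') =
      (((y + (t - s) *\<^sub>R b) - x) \<bullet> b) ^ \<nu> b * (\<Prod>b'\<in>Basis - {b}. (((y + (t - s) *\<^sub>R b) - x) \<bullet> b') ^ \<nu> b')"
      using b by (subst prod.remove[of _ b]) auto
    also have "((y + (t - s) *\<^sub>R b) - x) \<bullet> b = t"
      using b by (simp add: s_def inner_diff_left inner_add_left)
    also have "(\<Prod>b'\<in>Basis - {b}. (((y + (t - s) *\<^sub>R b) - x) \<bullet> b') ^ \<nu> b') = w \<nu>"
      unfolding w_def using b
      by (intro prod.cong) (auto simp: inner_diff_left inner_add_left inner_Basis)
    finally show ?thesis .
  qed
  have upd: "bij_betw (\<lambda>(k, \<nu>). \<nu>(b := k)) (UNIV \<times> Q) (PiE Basis (\<lambda>_. UNIV))"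
    by (rule bij_betw_byWitness[where f' = "\<lambda>\<nu>. (\<nu> b, \<nu>(b := 0))"])
      (use b in \<open>auto simp: Q_def PiE_def extensional_def fun_eq_iff\<close>)
  have FF: "((\<lambda>(k, \<nu>). e k \<nu> * t ^ k) has_sum F t) (UNIV \<times> Q)" if t: "\<bar>t\<bar> < r / 2" for t
  proof -
    have "y + (t - s) *\<^sub>R b - x = (y - x - s *\<^sub>R b) + t *\<^sub>R b"
      by (simp add: algebra_simps)
    then have "norm (y + (t - s) *\<^sub>R b - x) \<le> norm (y - x - s *\<^sub>R b) + norm (t *\<^sub>R b)"
      by (metis norm_triangle_ineq)
    also have "norm (y - x - s *\<^sub>R b) \<le> norm (y - x)"
    proof (rule norm_le_componentwise)
      fix i :: 'a assume "i \<in> Basis"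
      then show "\<bar>(y - x - s *\<^sub>R b) \<bullet> i\<bar> \<le> \<bar>(y - x) \<bullet> i\<bar>"
        using b by (cases "i = b") (auto simp: s_def inner_diff_left inner_Basis)
    qed
    finally have "y + (t - s) *\<^sub>R b \<in> ball x r"
      using ny t norm_Basis[OF b] by (simp add: dist_norm norm_minus_commute)
    from f[OF this]
    have "((\<lambda>\<nu>. c \<nu> * (t ^ \<nu> b * w \<nu>)) has_sum F t) (PiE Basis (\<lambda>_. UNIV))"
      unfolding prodQ F_def .
    then show ?thesis
      unfolding has_sum_reindex_bij_betw[OF upd, symmetric]
      by (simp add: case_prod_unfold w_upd e_def mult_ac)
  qed
  obtain D where D: "(F has_real_derivative D) (at s)"
    and D': "((\<lambda>(k, q). real (Suc k) * e (Suc k) q * s ^ k) has_sum D) (UNIV \<times> Q)"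
    using has_sum_power_series_termdiff[OF FF s] by blast
  show thesis
  proof (rule that)
    have "((\<lambda>t. F (t + s)) has_real_derivative D) (at 0)"
      using D DERIV_shift[of F D 0 s] by simp
    then show "((\<lambda>t. f (y + t *\<^sub>R b)) has_real_derivative D) (at 0)"
      by (simp add: F_def)
    show "((\<lambda>\<nu>. (real (Suc (\<nu> b)) * c (\<nu>(b := Suc (\<nu> b)))) * (\<Prod>b\<in>Basis. ((y - x) \<bullet> b) ^ \<nu> b))
      has_sum D) (PiE Basis (\<lambda>_. UNIV))"
      unfolding has_sum_reindex_bij_betw[OF upd, symmetric] prodQ[of s, simplified]
      using D' by (simp add: case_prod_unfold w_upd e_def mult_ac)
  qed
qed

lemma real_analytic_on_partial_deriv:
  fixes f :: "'a::euclidean_space \<Rightarrow> real"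
  assumes "real_analytic_on f S" "b \<in> Basis"
  shows "real_analytic_on (partial_deriv b f) S"
  unfolding real_analytic_on_def
proof
  fix x assume "x \<in> S"
  then obtain r c where r: "r > 0" and f: "\<And>y. y \<in> ball x r \<Longrightarrow>
      ((\<lambda>\<nu>. c \<nu> * (\<Prod>b\<in>Basis. ((y - x) \<bullet> b) ^ \<nu> b)) has_sum f y) (PiE Basis (\<lambda>_. UNIV))"
    using assms(1) unfolding real_analytic_on_def by blast
  have "((\<lambda>\<nu>. (real (Suc (\<nu> b)) * c (\<nu>(b := Suc (\<nu> b)))) * (\<Prod>b\<in>Basis. ((y - x) \<bullet> b) ^ \<nu> b))
      has_sum partial_deriv b f y) (PiE Basis (\<lambda>_. UNIV))" if "y \<in> ball x (r / 2)" for y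
    by (rule power_series_partial_derivative[OF f assms(2) that])
      (simp_all add: partial_deriv_def DERIV_imp_deriv)
  then show "\<exists>r>0. \<exists>c. \<forall>y\<in>ball x r. ((\<lambda>\<nu>. c \<nu> * (\<Prod>b\<in>Basis. ((y - x) \<bullet> b) ^ \<nu> b)) has_sum partial_deriv b f y)
          (PiE Basis (\<lambda>_. UNIV))"
    using r by (intro exI[of _ "r / 2"] conjI exI[of _ "\<lambda>\<nu>. real (Suc (\<nu> b)) * c (\<nu>(b := Suc (\<nu> b)))"]) auto
qed

lemma real_analytic_on_has_partial_deriv:
  fixes f :: "'a::euclidean_space \<Rightarrow> real"
  assumes "real_analytic_on f S" "b \<in> Basis" "x + t *\<^sub>R b \<in> S"
  shows "((\<lambda>t. f (x + t *\<^sub>R b)) has_real_derivative partial_deriv b f (x + t *\<^sub>R b)) (at t)"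
proof -
  let ?x = "x + t *\<^sub>R b"
  obtain r c where r: "r > 0" and f: "\<And>y. y \<in> ball ?x r \<Longrightarrow>
      ((\<lambda>\<nu>. c \<nu> * (\<Prod>b\<in>Basis. ((y - ?x) \<bullet> b) ^ \<nu> b)) has_sum f y) (PiE Basis (\<lambda>_. UNIV))"
    using assms unfolding real_analytic_on_def by blast
  from r have "?x \<in> ball ?x (r / 2)" by simp
  have "((\<lambda>t. f (?x + t *\<^sub>R b)) has_real_derivative partial_deriv b f ?x) (at 0)"
    by (rule power_series_partial_derivative[OF f assms(2) \<open>?x \<in> ball ?x (r / 2)\<close>])
      (simp_all add: partial_deriv_def DERIV_imp_deriv)
  then show ?thesis
    using DERIV_shift[of "\<lambda>t. f (x + t *\<^sub>R b)" "partial_deriv b f ?x" 0 t]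
    by (simp add: algebra_simps)
qed

section \<open>Local bounds and local Lipschitz continuity\<close>

text \<open>The series converges absolutely at the corner \<open>y0\<close>, all of whose offsets
  equal d; term by term this dominates the series at every point with offsets at most d.\<close>

lemma real_analytic_on_locally_bounded:
  fixes f :: "'a::euclidean_space \<Rightarrow> real"
  assumes "real_analytic_on f S" "x \<in> S"
  obtains r B where "r > 0" "\<And>y. y \<in> ball x r \<Longrightarrow> \<bar>f y\<bar> \<le> B"
proof -
  obtain r c where r: "r > 0" and f: "\<And>y. y \<in> ball x r \<Longrightarrow>
      ((\<lambda>\<nu>. c \<nu> * (\<Prod>b\<in>Basis. ((y - x) \<bullet> b) ^ \<nu> b)) has_sum f y) (PiE Basis (\<lambda>_. UNIV))"
    using assms unfolding real_analytic_on_def by blast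
  have n: "real DIM('a) \<ge> 1" using DIM_positive[where 'a='a] by linarith
  \<comment> \<open>The corner \<open>y0\<close> is then within \<open>DIM('a) * d\<close>, that is
    r/2, of x.\<close>
  define d where "d = r / (2 * real DIM('a))"
  have "r * 1 < r * (2 * real DIM('a))" using r n by (intro mult_strict_left_mono) linarith+
  moreover have "0 < 2 * real DIM('a)" using n by linarith
  ultimately have d: "0 < d" "d < r"
    using r unfolding d_def by (simp_all only: divide_pos_pos pos_divide_less_eq mult_1_right)

  define y0 where "y0 = x + (\<Sum>b\<in>Basis. d *\<^sub>R b)"
  have y0b: "(y0 - x) \<bullet> b = d" if "b \<in> Basis" for b
    using that by (simp add: y0_def inner_sum_left_Basis)
  have "norm (y0 - x) \<le> (\<Sum>b\<in>Basis. \<bar>(y0 - x) \<bullet> b\<bar>)" by (rule norm_le_l1)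
  also have "\<dots> = real DIM('a) * d" using d y0b by simp
  also have "\<dots> < r" using r by (simp add: d_def)
  finally have "y0 \<in> ball x r" by (simp add: dist_norm norm_minus_commute)
  from f[OF this]
  have "(\<lambda>\<nu>. norm (c \<nu> * (\<Prod>b\<in>Basis. ((y0 - x) \<bullet> b) ^ \<nu> b))) summable_on (PiE Basis (\<lambda>_. UNIV))"
    by (auto simp only: summable_on_iff_abs_summable_on_real[symmetric] summable_on_def)
  then obtain B where B: "((\<lambda>\<nu>. norm (c \<nu> * (\<Prod>b\<in>Basis. ((y0 - x) \<bullet> b) ^ \<nu> b))) has_sum B) (PiE Basis (\<lambda>_. UNIV))"
    by (auto simp only: summable_on_def)
  show thesis
  proof (rule that[OF d(1)])
    fix y assume "y \<in> ball x d"
    then have yd: "norm (y - x) < d" by (simp add: dist_norm norm_minus_commute)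
    then have "y \<in> ball x r" using d by (simp add: dist_norm norm_minus_commute)
    from f[OF this] B have "norm (f y) \<le> B"
    proof (rule norm_infsum_le)
      fix \<nu> :: "'a \<Rightarrow> nat"
      have "(\<Prod>b\<in>Basis. \<bar>((y - x) \<bullet> b) ^ \<nu> b\<bar>) \<le> (\<Prod>b\<in>Basis. \<bar>((y0 - x) \<bullet> b) ^ \<nu> b\<bar>)"
      proof (rule prod_mono, intro conjI)
        fix b :: 'a assume b: "b \<in> Basis"
        have "\<bar>(y - x) \<bullet> b\<bar> \<le> d" using Basis_le_norm[OF b, of "y - x"] yd by simp
        then show "\<bar>((y - x) \<bullet> b) ^ \<nu> b\<bar> \<le> \<bar>((y0 - x) \<bullet> b) ^ \<nu> b\<bar>"
          using y0b[OF b] d by (simp add: power_abs power_mono)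
      qed auto
      then show "norm (c \<nu> * (\<Prod>b\<in>Basis. ((y - x) \<bullet> b) ^ \<nu> b)) \<le> norm (c \<nu> * (\<Prod>b\<in>Basis. ((y0 - x) \<bullet> b) ^ \<nu> b))"
        by (simp add: abs_mult abs_prod mult_left_mono)
    qed
    then show "\<bar>f y\<bar> \<le> B" by simp
  qed
qed

text \<open>Partial derivatives are analytic, hence locally bounded by some M. Going from z to y one
  coordinate at a time, the mean value inequality on each of the n segments gives the constant n *
  M.\<close>

lemma real_analytic_on_locally_lipschitz:
  fixes f :: "'a::euclidean_space \<Rightarrow> real"
  assumes f: "real_analytic_on f S" and S: "open S" and x: "x \<in> S"
  obtains r L where "r > 0" "L \<ge> 0" "ball x r \<subseteq> S"
    "\<And>y z. y \<in> ball x r \<Longrightarrow> z \<in> ball x r \<Longrightarrow> \<bar>f y - f z\<bar> \<le> L * norm (y - z)"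
proof -
  have "\<exists>r B. r > 0 \<and> (\<forall>y\<in>ball x r. \<bar>partial_deriv b f y\<bar> \<le> B)" if "b \<in> Basis" for b
    using real_analytic_on_locally_bounded[OF real_analytic_on_partial_deriv[OF f that] x] by metis
  then obtain R B where R: "\<And>b. b \<in> Basis \<Longrightarrow> R b > 0"
    and B: "\<And>b y. b \<in> Basis \<Longrightarrow> y \<in> ball x (R b) \<Longrightarrow> \<bar>partial_deriv b f y\<bar> \<le> B b" by metis
  obtain r0 where r0: "r0 > 0" "ball x r0 \<subseteq> S" using S x open_contains_ball by blast
  define r1 where "r1 = Min (insert r0 (R ` Basis))"
  have r1: "r1 > 0" using R r0 by (auto simp: r1_def)
  have r1': "r1 \<le> r0" "\<And>b. b \<in> Basis \<Longrightarrow> r1 \<le> R b" unfolding r1_def by (auto intro!: Min_le simp del: Min_insert)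
  define M where "M = (\<Sum>b\<in>Basis. \<bar>B b\<bar>)"
  have M: "\<bar>partial_deriv b f y\<bar> \<le> M" if "b \<in> Basis" "y \<in> ball x r1" for b y
  proof -
    have "\<bar>partial_deriv b f y\<bar> \<le> B b" using that r1'(2)[OF that(1)] by (intro B) auto
    also have "\<dots> \<le> \<bar>B b\<bar>" by simp
    also have "\<dots> \<le> M" unfolding M_def by (rule member_le_sum) (use that in auto)
    finally show ?thesis .
  qed
  have M0: "M \<ge> 0" unfolding M_def by (simp add: sum_nonneg)
  define n where "n = real DIM('a)"
  have n: "n \<ge> 1" unfolding n_def using DIM_positive[where 'a='a] by linarith
  \<comment> \<open>Intermediate points lie within |z - x| + n |y - z| < r + 2 n r of x, and this
    must not exceed \<open>r1\<close>.\<close>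
  define r where "r = r1 / (1 + 2 * n)"
  have "r * (1 + 2 * n) = r1" "r > 0" using n r1 by (simp_all add: r_def)
  then have r: "r > 0" "r + 2 * n * r = r1" by (simp_all only: ring_distribs mult_1_right mult_ac)
  show thesis
  proof (rule that[of r "n * M"])
    show "r > 0" "n * M \<ge> 0" using r n M0 by auto
    have "r \<le> r1" using r n by (simp add: r_def field_simps) 
    then show "ball x r \<subseteq> S" using r0 r1' by (meson order_trans subset_ball)
    fix y z assume y: "y \<in> ball x r" and z: "z \<in> ball x r"
    define P where "P F = z + (\<Sum>b\<in>F. ((y - z) \<bullet> b) *\<^sub>R b)" for F :: "'a set"
    have yz: "norm (y - z) < 2 * r"
      using dist_triangle_half_r[of x y "2*r" z] y z by (simp add: dist_norm)
    have step: "\<bar>f (P F + ((y - z) \<bullet> b) *\<^sub>R b) - f (P F)\<bar> \<le> M * norm (y - z)"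
      if b: "b \<in> Basis" and F: "F \<subseteq> Basis" "b \<notin> F" for b F
    proof -
      let ?s = "(y - z) \<bullet> b"
      have fin: "finite F" using F(1) finite_Basis by (rule finite_subset)
      have sb: "\<bar>?s\<bar> \<le> norm (y - z)" by (rule Basis_le_norm[OF b])
      have inball: "P F + t *\<^sub>R b \<in> ball x r1" if t: "\<bar>t\<bar> \<le> \<bar>?s\<bar>" for t
      proof -
        have "norm (\<Sum>b\<in>F. ((y - z) \<bullet> b) *\<^sub>R b) \<le> (\<Sum>b\<in>F. norm (((y - z) \<bullet> b) *\<^sub>R b))" by (rule norm_sum)
        also have "\<dots> \<le> (\<Sum>b\<in>F. norm (y - z))"
          using F Basis_le_norm[of _ "y - z"] by (intro sum_mono) (auto simp: norm_Basis subset_iff)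
        finally have 1: "norm (\<Sum>b\<in>F. ((y - z) \<bullet> b) *\<^sub>R b) \<le> card F * norm (y - z)" by simp
        have "insert b F \<subseteq> Basis" using b F by auto
        then have "card (insert b F) \<le> DIM('a)" by (rule card_mono[rotated]) simp
        then have cF: "real (card F) + 1 \<le> n" using fin F by (simp add: n_def)
        have "norm (P F + t *\<^sub>R b - x) = norm ((z - x) + (\<Sum>b\<in>F. ((y - z) \<bullet> b) *\<^sub>R b) + t *\<^sub>R b)"
          by (simp add: P_def algebra_simps)
        also have "\<dots> \<le> norm (z - x) + norm (\<Sum>b\<in>F. ((y - z) \<bullet> b) *\<^sub>R b) + norm (t *\<^sub>R b)"
          by (meson add_mono norm_triangle_ineq norm_triangle_mono order_refl)
        also have "\<dots> \<le> norm (z - x) + card F * norm (y - z) + norm (y - z)"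
          using 1 t sb b by (simp add: norm_Basis)
        also have "\<dots> = norm (z - x) + (real (card F) + 1) * norm (y - z)" by (simp add: algebra_simps)
        also have "\<dots> \<le> norm (z - x) + n * norm (y - z)" by (intro add_left_mono mult_right_mono[OF cF]) simp
        also have "\<dots> < r + n * (2 * r)"
          using z yz n by (intro add_strict_mono mult_strict_left_mono) (auto simp: dist_norm norm_minus_commute)
        also have "\<dots> = r1" using r by (simp add: algebra_simps)
        finally show ?thesis by (simp add: dist_norm norm_minus_commute)
      qed
      have "norm (f (P F + ?s *\<^sub>R b) - f (P F + 0 *\<^sub>R b)) \<le> M * norm (?s - 0)"
      proof (rule field_differentiable_bound[where S="closed_segment 0 ?s" and f="\<lambda>t. f (P F + t *\<^sub>R b)" and f'="\<lambda>t. partial_deriv b f (P F + t *\<^sub>R b)"])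
        fix t assume "t \<in> closed_segment 0 ?s"
        then have t: "\<bar>t\<bar> \<le> \<bar>?s\<bar>" by (auto simp: closed_segment_eq_real_ivl split: if_splits)
        then have "P F + t *\<^sub>R b \<in> ball x r1" by (rule inball)
        moreover then have "P F + t *\<^sub>R b \<in> S" using r1' r0 by auto
        ultimately show "((\<lambda>t. f (P F + t *\<^sub>R b)) has_field_derivative partial_deriv b f (P F + t *\<^sub>R b)) (at t within closed_segment 0 ?s)"
          "norm (partial_deriv b f (P F + t *\<^sub>R b)) \<le> M"
          using real_analytic_on_has_partial_deriv[OF f b] M[OF b] has_field_derivative_at_within by (blast, simp)
      qed (rule convex_closed_segment ends_in_segment)+
      also have "\<dots> \<le> M * norm (y - z)" using sb M0 by (simp add: mult_left_mono)
      finally show ?thesis by simp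
    qed
    have "\<bar>f (P F) - f z\<bar> \<le> card F * (M * norm (y - z))" if "F \<subseteq> Basis" for F
    proof -
      have "finite F" using that finite_Basis by (rule finite_subset)
      then show ?thesis using that
      proof (induction F)
        case empty then show ?case by (simp add: P_def)
      next
        case (insert b F)
        have "P (insert b F) = P F + ((y - z) \<bullet> b) *\<^sub>R b"
          using insert by (simp add: P_def algebra_simps)
        then have "\<bar>f (P (insert b F)) - f (P F)\<bar> \<le> M * norm (y - z)" using step[of b F] insert by auto
        moreover have "\<bar>f (P F) - f z\<bar> \<le> card F * (M * norm (y - z))" using insert by simp
        moreover have "card (insert b F) * (M * norm (y - z)) = card F * (M * norm (y - z)) + M * norm (y - z)"
          using insert(1,2) by (simp add: algebra_simps)
        ultimately show ?case by linarith
      qed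
    qed
    from this[OF order_refl] have "\<bar>f (P Basis) - f z\<bar> \<le> n * M * norm (y - z)"
      by (simp only: n_def mult.assoc)
    moreover have "P Basis = y" by (simp only: P_def euclidean_representation) simp
    ultimately show "\<bar>f y - f z\<bar> \<le> n * M * norm (y - z)" by simp
  qed
qed

lemma real_analytic_on_continuous:
  assumes "real_analytic_on f S" "open S"
  shows "continuous_on S f"
proof (rule continuous_at_imp_continuous_on, rule ballI)
  fix x assume "x \<in> S"
  obtain r L where r: "r > 0" "L \<ge> 0"
    and L: "\<And>y z. y \<in> ball x r \<Longrightarrow> z \<in> ball x r \<Longrightarrow> \<bar>f y - f z\<bar> \<le> L * norm (y - z)"
    by (rule real_analytic_on_locally_lipschitz[OF assms \<open>x \<in> S\<close>]) (blast intro: that)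
  have "L-lipschitz_on (ball x r) f"
    by (rule lipschitz_onI) (use r L in \<open>auto simp: dist_norm\<close>)
  then have "continuous_on (ball x r) f" by (rule lipschitz_on_continuous_on)
  then show "isCont f x" using r by (simp add: continuous_on_eq_continuous_at)
qed

section \<open>Identity theorem along coordinate lines\<close>

text \<open>The set where all \<open>\<phi> k\<close> vanish is closed by continuity. It is open
  because a local power series around such a point has zero coefficients only. The real line is
  connected.\<close>

lemma power_series_eq_zero:
  fixes \<phi> :: "nat \<Rightarrow> real \<Rightarrow> real"
  assumes der: "\<And>k t. (\<phi> k has_real_derivative \<phi> (Suc k) t) (at t)"
    and ps: "\<And>t0. \<exists>r>0. \<exists>a. \<forall>t. \<bar>t - t0\<bar> < r \<longrightarrow> (\<lambda>k. a k * (t - t0) ^ k) sums \<phi> 0 t"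
    and zero: "\<And>k. \<phi> k 0 = 0"
  shows "\<phi> 0 t = 0"
proof -
  have near: "\<exists>r>0. \<forall>t. \<bar>t - t0\<bar> < r \<longrightarrow> (\<forall>k. \<phi> k t = 0)" if z: "\<And>k. \<phi> k t0 = 0" for t0
  proof -
    obtain r a where r: "r > 0" and a: "\<And>t. \<bar>t - t0\<bar> < r \<Longrightarrow> (\<lambda>k. a k * (t - t0) ^ k) sums \<phi> 0 t"
      using ps by blast
    have S: "(\<lambda>n. (diffs ^^ k) a n * s ^ n) sums \<phi> k (t0 + s)" if "\<bar>s\<bar> < r" for s k
      using that
    proof (induction k arbitrary: s)
      case 0 then show ?case using a[of "t0 + s"] by simp
    next
      case (Suc k)
      have "((\<lambda>z. \<Sum>n. (diffs ^^ k) a n * z ^ n) has_real_derivative (\<Sum>n. diffs ((diffs ^^ k) a) n * s ^ n)) (at s)"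
        by (rule termdiffs_strong'[where K=r]) (use Suc in \<open>auto simp: sums_iff\<close>)
      moreover have "((\<lambda>z. \<Sum>n. (diffs ^^ k) a n * z ^ n) has_real_derivative \<phi> (Suc k) (t0 + s)) (at s)"
      proof (rule has_field_derivative_transform_within_open[of "\<lambda>s. \<phi> k (t0 + s)" _ _ "{-r<..<r}"])
        show "((\<lambda>s. \<phi> k (t0 + s)) has_real_derivative \<phi> (Suc k) (t0 + s)) (at s)"
          using der[of k "s + t0"] DERIV_shift[of "\<phi> k" _ s t0] by (simp add: add.commute)
      qed (use Suc in \<open>auto simp: sums_iff\<close>)
      ultimately have "(\<Sum>n. diffs ((diffs ^^ k) a) n * s ^ n) = \<phi> (Suc k) (t0 + s)"
        by (rule DERIV_unique)
      moreover have "summable (\<lambda>n. diffs ((diffs ^^ k) a) n * s ^ n)"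
        by (rule termdiff_converges[where K=r]) (use Suc in \<open>auto simp: sums_iff\<close>)
      ultimately show ?case by (simp add: sums_iff)
    qed
    \<comment> \<open>A coefficient of index n + 1 is, up to a nonzero factor, the coefficient of
      index n of the next formal derivative; descending to index 0 reaches a derivative at
      \<open>t0\<close>, hence \<open>k\<close> must stay arbitrary.\<close>
    have "(diffs ^^ k) a n = 0" for n k
    proof (induction n arbitrary: k)
      case 0
      have "(\<lambda>n. (diffs ^^ k) a n * 0 ^ n) sums (diffs ^^ k) a 0"
        using powser_sums_zero by blast
      moreover have "(\<lambda>n. (diffs ^^ k) a n * 0 ^ n) sums \<phi> k t0"
        using S[of 0 k] r by simp
      ultimately have "(diffs ^^ k) a 0 = \<phi> k t0" by (rule sums_unique2)
      then show ?case using z by simp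
    next
      case (Suc n)
      have "(diffs ^^ Suc k) a n = 0" by (rule Suc)
      then show ?case by (simp add: diffs_def[of "(diffs ^^ k) a"])
    qed
    then have "\<phi> k (t0 + s) = 0" if "\<bar>s\<bar> < r" for s k
      using S[OF that, of k] by (simp add: sums_iff)
    from this[of "_ - t0"] show ?thesis using r by (intro exI[of _ r]) auto
  qed
  let ?T = "{t. \<forall>k. \<phi> k t = 0}"
  have "open ?T"
    unfolding open_dist
  proof
    fix t0 assume "t0 \<in> ?T"
    then obtain r where "r > 0" "\<forall>t. \<bar>t - t0\<bar> < r \<longrightarrow> (\<forall>k. \<phi> k t = 0)" using near[of t0] by blast
    then show "\<exists>e>0. \<forall>y. dist y t0 < e \<longrightarrow> y \<in> ?T" by (intro exI[of _ r]) (simp add: dist_real_def)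
  qed
  moreover have "closed ?T"
    by (intro closed_Collect_all closed_Collect_eq continuous_on_const
      continuous_at_imp_continuous_on ballI DERIV_isCont[OF der])
  ultimately have "?T = UNIV"
    using zero clopen[of ?T] by auto
  then show ?thesis by blast
qed

text \<open>Along b every monomial containing another variable vanishes; only the multi-indices
  supported on b survive.\<close>

lemma real_analytic_on_line:
  fixes f :: "'a::euclidean_space \<Rightarrow> real"
  assumes f: "real_analytic_on f S" and b: "b \<in> Basis" and x: "x + t0 *\<^sub>R b \<in> S"
  shows "\<exists>r>0. \<exists>a. \<forall>t. \<bar>t - t0\<bar> < r \<longrightarrow> (\<lambda>k. a k * (t - t0) ^ k) sums f (x + t *\<^sub>R b)"
proof -
  let ?x = "x + t0 *\<^sub>R b"
  obtain r c where r: "r > 0" and f: "\<And>y. y \<in> ball ?x r \<Longrightarrow>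
      ((\<lambda>\<nu>. c \<nu> * (\<Prod>b\<in>Basis. ((y - ?x) \<bullet> b) ^ \<nu> b)) has_sum f y) (PiE Basis (\<lambda>_. UNIV))"
    using f x unfolding real_analytic_on_def by blast
  define \<nu> :: "nat \<Rightarrow> 'a \<Rightarrow> nat" where "\<nu> k = (\<lambda>b'\<in>Basis. if b' = b then k else 0)" for k
  have inj: "inj \<nu>"
    using b by (auto simp: inj_def \<nu>_def fun_eq_iff restrict_def split: if_splits)
  have "(\<lambda>k. c (\<nu> k) * (t - t0) ^ k) sums f (x + t *\<^sub>R b)" if t: "\<bar>t - t0\<bar> < r" for t
  proof (rule has_sum_imp_sums)
    let ?y = "x + t *\<^sub>R b"
    have y: "?y - ?x = (t - t0) *\<^sub>R b" by (simp add: algebra_simps)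
    have "dist ?x ?y = norm ((t - t0) *\<^sub>R b)"
      by (simp only: dist_norm norm_minus_commute[of ?x] y)
    then have "?y \<in> ball ?x r" using t norm_Basis[OF b] by (simp only: mem_ball norm_scaleR real_norm_def mult_1_right)
    from f[OF this] have "((\<lambda>\<nu>. c \<nu> * (\<Prod>b\<in>Basis. ((?y - ?x) \<bullet> b) ^ \<nu> b)) has_sum f ?y) (PiE Basis (\<lambda>_. UNIV))" .
    also have "?this \<longleftrightarrow> ((\<lambda>\<mu>. c \<mu> * (t - t0) ^ \<mu> b) has_sum f ?y) (range \<nu>)"
    proof (rule has_sum_cong_neutral)
      fix \<mu> assume "\<mu> \<in> PiE Basis (\<lambda>_. UNIV) - range \<nu>"
      then have "\<mu> \<noteq> \<nu> (\<mu> b)" and \<mu>: "\<mu> \<in> extensional Basis" by (auto simp: PiE_def)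
      then obtain b' where "b' \<in> Basis" "b' \<noteq> b" "\<mu> b' \<noteq> 0"
        by (auto simp: \<nu>_def fun_eq_iff restrict_def extensional_def split: if_splits)
      moreover then have "((?y - ?x) \<bullet> b') ^ \<mu> b' = 0"
        using b by (simp add: y inner_Basis inner_diff_left)
      ultimately show "c \<mu> * (\<Prod>b\<in>Basis. ((?y - ?x) \<bullet> b) ^ \<mu> b) = 0"
        by (simp add: prod_zero_iff) blast
    next
      fix \<mu> assume "\<mu> \<in> PiE Basis (\<lambda>_. UNIV) \<inter> range \<nu>"
      then obtain k where k: "\<mu> = \<nu> k" by auto
      have "(\<Prod>b\<in>Basis. ((?y - ?x) \<bullet> b) ^ \<mu> b) = (\<Prod>b'\<in>Basis. if b' = b then (t - t0) ^ \<mu> b else 1)"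
        using b by (intro prod.cong) (auto simp: y k \<nu>_def inner_Basis inner_diff_left)
      also have "\<dots> = (t - t0) ^ \<mu> b" using b by (simp add: prod.delta)
      finally show "c \<mu> * (\<Prod>b\<in>Basis. ((?y - ?x) \<bullet> b) ^ \<mu> b) = c \<mu> * (t - t0) ^ \<mu> b" by simp
    next
      fix \<mu> assume "\<mu> \<in> range \<nu> - PiE Basis (\<lambda>_. UNIV)"
      then show "c \<mu> * (t - t0) ^ \<mu> b = 0" by (auto simp: \<nu>_def)
    qed
    also have "\<dots> \<longleftrightarrow> ((\<lambda>k. c (\<nu> k) * (t - t0) ^ k) has_sum f ?y) UNIV"
      unfolding has_sum_reindex[OF inj] using b by (simp add: o_def \<nu>_def)
    finally show "((\<lambda>k. c (\<nu> k) * (t - t0) ^ k) has_sum f ?y) UNIV" .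
  qed
  with r show ?thesis
    by (intro exI[of _ r] conjI exI[of _ "\<lambda>k. c (\<nu> k)"] allI impI)
qed

text \<open>The head of the list is the outermost derivative. Lists keep the order of
  differentiation, so that \<open>b # bs\<close> is literally one more derivative, the form used in
  the inductions.\<close>

definition partial_derivs :: "'a::euclidean_space list \<Rightarrow> ('a \<Rightarrow> real) \<Rightarrow> 'a \<Rightarrow> real" where
  "partial_derivs bs f = foldr partial_deriv bs f"

lemma partial_derivs_simps [simp]: "partial_derivs [] f = f" "partial_derivs (b # bs) f = partial_deriv b (partial_derivs bs f)"
  by (simp_all add: partial_derivs_def)

lemma real_analytic_on_partial_derivs:
  "real_analytic_on f S \<Longrightarrow> set bs \<subseteq> Basis \<Longrightarrow> real_analytic_on (partial_derivs bs f) S"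
  by (induction bs) (auto intro: real_analytic_on_partial_deriv)

text \<open>The identity theorem is run along coordinate lines, where power series in one variable suffice.\<close>

lemma partial_derivs_eq_move:
  fixes f :: "'a::euclidean_space \<Rightarrow> real"
  assumes f: "real_analytic_on f S" and D: "D \<subseteq> Basis" "b \<in> D"
    and S: "\<And>t. x + t *\<^sub>R b \<in> S" "\<And>t. y + t *\<^sub>R b \<in> S"
    and eq: "\<And>bs. set bs \<subseteq> D \<Longrightarrow> partial_derivs bs f x = partial_derivs bs f y"
    and bs: "set bs \<subseteq> D"
  shows "partial_derivs bs f (x + t *\<^sub>R b) = partial_derivs bs f (y + t *\<^sub>R b)"
proof -
  \<comment> \<open>Prepending b differentiates once more along the line, so \<open>\<phi> k\<close>
    is the k-th derivative of \<open>\<phi> 0\<close>; all of them vanish at 0 since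
    \<open>eq\<close> covers every list over \<open>D\<close>.\<close>
  define \<phi> where "\<phi> k t = partial_derivs (replicate k b @ bs) f (x + t *\<^sub>R b) - partial_derivs (replicate k b @ bs) f (y + t *\<^sub>R b)" for k t
  have b: "b \<in> Basis" using D by auto
  have an: "real_analytic_on (partial_derivs (replicate k b @ bs) f) S" for k
    using f D bs by (intro real_analytic_on_partial_derivs) auto
  have "\<phi> 0 t = 0"
  proof (rule power_series_eq_zero[where \<phi>=\<phi>])
    fix k t
    show "(\<phi> k has_real_derivative \<phi> (Suc k) t) (at t)"
      using DERIV_diff[OF real_analytic_on_has_partial_deriv[OF an b S(1)] real_analytic_on_has_partial_deriv[OF an b S(2)]]
      unfolding \<phi>_def by simp
  next
    fix t0
    obtain r1 a1 where 1: "r1 > 0" "\<And>t. \<bar>t - t0\<bar> < r1 \<Longrightarrow> (\<lambda>k. a1 k * (t - t0) ^ k) sums partial_derivs bs f (x + t *\<^sub>R b)"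
      using real_analytic_on_line[OF an[of 0] b S(1), of t0] by auto
    obtain r2 a2 where 2: "r2 > 0" "\<And>t. \<bar>t - t0\<bar> < r2 \<Longrightarrow> (\<lambda>k. a2 k * (t - t0) ^ k) sums partial_derivs bs f (y + t *\<^sub>R b)"
      using real_analytic_on_line[OF an[of 0] b S(2), of t0] by auto
    show "\<exists>r>0. \<exists>a. \<forall>t. \<bar>t - t0\<bar> < r \<longrightarrow> (\<lambda>k. a k * (t - t0) ^ k) sums \<phi> 0 t"
      using 1 2
      by (intro exI[of _ "min r1 r2"] conjI exI[of _ "\<lambda>k. a1 k - a2 k"])
        (auto simp: \<phi>_def left_diff_distrib intro!: sums_diff)
  next
    fix k
    have "set (replicate k b @ bs) \<subseteq> D" using D bs by auto
    then show "\<phi> k 0 = 0" using eq by (simp add: \<phi>_def del: partial_derivs_simps)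
  qed
  then show ?thesis by (simp add: \<phi>_def)
qed

text \<open>If all \<omega>-derivatives agreed at \<omega>, they would still agree after each
  coordinate of \<omega> is moved to that of \<omega>', contradicting \<open>sep\<close>. Carrying
  all lists, and not only \<open>[]\<close>, makes this induction over coordinates work.\<close>

lemma partial_derivs_separate:
  fixes f :: "'z::euclidean_space \<times> 'e::euclidean_space \<Rightarrow> real"
  assumes f: "real_analytic_on f (U \<times> UNIV)" and z: "z1 \<in> U" "z2 \<in> U"
    and sep: "f (z1, \<omega>') \<noteq> f (z2, \<omega>')"
  obtains bs where "set bs \<subseteq> Pair 0 ` Basis" "partial_derivs bs f (z1, \<omega>) \<noteq> partial_derivs bs f (z2, \<omega>)"
proof (rule ccontr)
  assume "\<not> thesis"
  with that have eq: "\<And>bs. set bs \<subseteq> Pair 0 ` Basis \<Longrightarrow> partial_derivs bs f (z1, \<omega>) = partial_derivs bs f (z2, \<omega>)" by blast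
  let ?c = "\<lambda>F. \<omega> + (\<Sum>b\<in>F. ((\<omega>' - \<omega>) \<bullet> b) *\<^sub>R b)"
  have "\<forall>bs. set bs \<subseteq> Pair 0 ` Basis \<longrightarrow> partial_derivs bs f (z1, ?c F) = partial_derivs bs f (z2, ?c F)" if "F \<subseteq> Basis" for F
    using finite_subset[OF that finite_Basis] that
  proof (induction F)
    case empty then show ?case using eq by simp
  next
    case (insert b F)
    have *: "(z, ?c (insert b F)) = (z, ?c F) + ((\<omega>' - \<omega>) \<bullet> b) *\<^sub>R (0, b)" for z :: 'z
      using insert by (simp add: algebra_simps)
    show ?case unfolding *
    proof (intro allI impI)
      fix bs :: "('z \<times> 'e) list" assume bs: "set bs \<subseteq> Pair 0 ` Basis"
      show "partial_derivs bs f ((z1, ?c F) + ((\<omega>' - \<omega>) \<bullet> b) *\<^sub>R (0, b)) = partial_derivs bs f ((z2, ?c F) + ((\<omega>' - \<omega>) \<bullet> b) *\<^sub>R (0, b))"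
      proof (rule partial_derivs_eq_move[OF f, where D="Pair 0 ` Basis"])
        show "Pair 0 ` Basis \<subseteq> (Basis :: ('z \<times> 'e) set)" by (auto simp: Basis_prod_def)
        show "(0, b) \<in> Pair 0 ` Basis" using insert by auto
        show "partial_derivs bs f (z1, ?c F) = partial_derivs bs f (z2, ?c F)" if "set bs \<subseteq> Pair 0 ` Basis" for bs
          using insert that by blast
      qed (use z bs in auto)
    qed
  qed
  from this[OF order_refl, rule_format, of "[]"]
  have "partial_derivs [] f (z1, ?c Basis) = partial_derivs [] f (z2, ?c Basis)" by simp
  moreover have "?c Basis = \<omega>'" by (simp only: euclidean_representation) simp
  ultimately have "partial_derivs [] f (z1, \<omega>') = partial_derivs [] f (z2, \<omega>')" by (simp only:)
  with sep show False by simp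
qed

section \<open>Linear combinations of analytic functions\<close>

lemma real_analytic_on_add:
  assumes "real_analytic_on f S" "real_analytic_on g S"
  shows "real_analytic_on (\<lambda>x. f x + g x) S"
  unfolding real_analytic_on_def
proof
  fix x assume x: "x \<in> S"
  obtain r c where r: "r > 0" and f: "\<forall>y\<in>ball x r.
      ((\<lambda>\<nu>. c \<nu> * (\<Prod>b\<in>Basis. ((y - x) \<bullet> b) ^ \<nu> b)) has_sum f y) (PiE Basis (\<lambda>_. UNIV))"
    using assms(1) x unfolding real_analytic_on_def by blast
  obtain r' c' where r': "r' > 0" and g: "\<forall>y\<in>ball x r'.
      ((\<lambda>\<nu>. c' \<nu> * (\<Prod>b\<in>Basis. ((y - x) \<bullet> b) ^ \<nu> b)) has_sum g y) (PiE Basis (\<lambda>_. UNIV))"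
    using assms(2) x unfolding real_analytic_on_def by blast
  have "\<forall>y\<in>ball x (min r r'). ((\<lambda>\<nu>. (c \<nu> + c' \<nu>) * (\<Prod>b\<in>Basis. ((y - x) \<bullet> b) ^ \<nu> b)) has_sum f y + g y)
      (PiE Basis (\<lambda>_. UNIV))"
    unfolding distrib_right using f g by (intro ballI has_sum_add) auto
  then show "\<exists>r>0. \<exists>c. \<forall>y\<in>ball x r. ((\<lambda>\<nu>. c \<nu> * (\<Prod>b\<in>Basis. ((y - x) \<bullet> b) ^ \<nu> b)) has_sum f y + g y)
      (PiE Basis (\<lambda>_. UNIV))"
    using r r' by (intro exI[of _ "min r r'"] conjI exI[of _ "\<lambda>\<nu>. c \<nu> + c' \<nu>"]) auto
qed

lemma real_analytic_on_cmult:
  assumes "real_analytic_on f S"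
  shows "real_analytic_on (\<lambda>x. a * f x) S"
  unfolding real_analytic_on_def
proof
  fix x assume x: "x \<in> S"
  obtain r c where r: "r > 0" and f: "\<forall>y\<in>ball x r.
      ((\<lambda>\<nu>. c \<nu> * (\<Prod>b\<in>Basis. ((y - x) \<bullet> b) ^ \<nu> b)) has_sum f y) (PiE Basis (\<lambda>_. UNIV))"
    using assms(1) x unfolding real_analytic_on_def by blast
  have "\<forall>y\<in>ball x r. ((\<lambda>\<nu>. (a * c \<nu>) * (\<Prod>b\<in>Basis. ((y - x) \<bullet> b) ^ \<nu> b)) has_sum a * f y)
      (PiE Basis (\<lambda>_. UNIV))"
    unfolding mult.assoc using f by (intro ballI has_sum_cmult_right) auto
  then show "\<exists>r>0. \<exists>c. \<forall>y\<in>ball x r. ((\<lambda>\<nu>. c \<nu> * (\<Prod>b\<in>Basis. ((y - x) \<bullet> b) ^ \<nu> b)) has_sum a * f y)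
      (PiE Basis (\<lambda>_. UNIV))"
    using r by (intro exI[of _ r] conjI exI[of _ "\<lambda>\<nu>. a * c \<nu>"]) auto
qed

section \<open>Collisions of a finite family of analytic functions\<close>

lemma real_mvt_signed:
  fixes f :: "real \<Rightarrow> real"
  assumes der: "\<And>t. (f has_real_derivative f' t) (at t)"
  obtains t where "\<bar>t\<bar> \<le> \<bar>s\<bar>" "f s - f 0 = s * f' t"
proof -
  consider "s = 0" | "s > 0" | "s < 0" by linarith
  then show thesis
  proof cases
    case 1 then show ?thesis using that[of 0] by simp
  next
    case 2
    then obtain t where "0 < t" "t < s" "f s - f 0 = (s - 0) * f' t" using MVT2[of 0 s f f'] der by blast
    then show ?thesis using that[of t] by simp
  next
    case 3
    then obtain t where "s < t" "t < 0" "f 0 - f s = (0 - s) * f' t" using MVT2[of s 0 f f'] der by blast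
    then show ?thesis using that[of t] by simp
  qed
qed

lemma mem_ball_Pair:
  assumes "a \<in> ball x (r / 2)" "b \<in> ball y (r / 2)"
  shows "(a, b) \<in> ball (x, y) r"
proof -
  have "dist (x, y) (a, b) \<le> dist x a + dist y b"
    unfolding dist_Pair_Pair by (rule sqrt_sum_squares_le_sum) auto
  then show ?thesis using assms by simp
qed

text \<open>A quantitative implicit function theorem for the equation p(z1, \<omega>) = p(z2,
  \<omega>). Shifting \<eta> along b until its b-coordinate is that of \<xi> changes the difference
  of the two sides by at least c times the shift. The shifted point differs from the other solution
  only in x and orthogonally to b, so the difference there is also small.\<close>

lemma zero_set_coordinate_lipschitz:
  fixes p :: "'z::euclidean_space \<times> 'e::euclidean_space \<Rightarrow> real"
  assumes p: "real_analytic_on p (U \<times> UNIV)" and U: "open U" and z: "z1 \<in> U" "z2 \<in> U" and b: "b \<in> Basis"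
    and ne: "partial_deriv (0, b) p (z1, \<omega>) \<noteq> partial_deriv (0, b) p (z2, \<omega>)"
  obtains \<rho> L where "\<rho> > 0" "L \<ge> 0"
    "\<And>x1 x2 \<xi> y1 y2 \<eta>. {x1, y1} \<subseteq> ball z1 \<rho> \<Longrightarrow> {x2, y2} \<subseteq> ball z2 \<rho> \<Longrightarrow> {\<xi>, \<eta>} \<subseteq> ball \<omega> \<rho> \<Longrightarrow>
      p (x1, \<xi>) = p (x2, \<xi>) \<Longrightarrow> p (y1, \<eta>) = p (y2, \<eta>) \<Longrightarrow>
      \<bar>(\<xi> - \<eta>) \<bullet> b\<bar> \<le> L * (norm (x1 - y1) + norm (x2 - y2) + norm ((\<xi> - \<eta>) - ((\<xi> - \<eta>) \<bullet> b) *\<^sub>R b))"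
proof -
  let ?q = "partial_deriv (0, b) p"
  have S: "open (U \<times> (UNIV :: 'e set))" using U by (simp add: open_Times)
  have b0: "(0, b) \<in> (Basis :: ('z \<times> 'e) set)" using b by (auto simp: Basis_prod_def)
  have mem: "(z1, \<omega>) \<in> U \<times> UNIV" "(z2, \<omega>) \<in> U \<times> UNIV" using z by auto
  \<comment> \<open>Half of the gap between the two derivatives: if each moves by less than c/2, a
    gap of at least 2c - c = c remains.\<close>
  define c where "c = \<bar>?q (z1, \<omega>) - ?q (z2, \<omega>)\<bar> / 2"
  have c: "c > 0" using ne by (simp add: c_def)
  have "continuous_on (U \<times> UNIV) ?q"
    by (rule real_analytic_on_continuous[OF real_analytic_on_partial_deriv[OF p b0] S])
  then have cont: "\<exists>d>0. \<forall>y. dist y x < d \<longrightarrow> \<bar>?q y - ?q x\<bar> < c / 2" if "x \<in> U \<times> UNIV" for x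
  proof -
    have "isCont ?q x"
      using continuous_on_eq_continuous_at[OF S, THEN iffD1, OF \<open>continuous_on (U \<times> UNIV) ?q\<close>] that by blast
    moreover have "c / 2 > 0" using c by simp
    ultimately show ?thesis unfolding continuous_at_eps_delta dist_real_def by blast
  qed
  obtain d1 where d1: "d1 > 0" "\<And>y. dist y (z1, \<omega>) < d1 \<Longrightarrow> \<bar>?q y - ?q (z1, \<omega>)\<bar> < c / 2" using cont[OF mem(1)] by blast
  obtain d2 where d2: "d2 > 0" "\<And>y. dist y (z2, \<omega>) < d2 \<Longrightarrow> \<bar>?q y - ?q (z2, \<omega>)\<bar> < c / 2" using cont[OF mem(2)] by blast
  obtain r1 L1 where r1: "r1 > 0" "L1 \<ge> 0" "ball (z1, \<omega>) r1 \<subseteq> U \<times> UNIV"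
    and L1: "\<And>y z. y \<in> ball (z1, \<omega>) r1 \<Longrightarrow> z \<in> ball (z1, \<omega>) r1 \<Longrightarrow> \<bar>p y - p z\<bar> \<le> L1 * norm (y - z)"
    by (rule real_analytic_on_locally_lipschitz[OF p S mem(1)]) (blast intro: that)
  obtain r2 L2 where r2: "r2 > 0" "L2 \<ge> 0" "ball (z2, \<omega>) r2 \<subseteq> U \<times> UNIV"
    and L2: "\<And>y z. y \<in> ball (z2, \<omega>) r2 \<Longrightarrow> z \<in> ball (z2, \<omega>) r2 \<Longrightarrow> \<bar>p y - p z\<bar> \<le> L2 * norm (y - z)"
    by (rule real_analytic_on_locally_lipschitz[OF p S mem(2)]) (blast intro: that)
  define r where "r = min (min d1 d2) (min r1 r2)"
  have r: "r > 0" "r \<le> d1" "r \<le> d2" "r \<le> r1" "r \<le> r2" using d1 d2 r1 r2 by (auto simp: r_def)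
  \<comment> \<open>The shift is below 2\<rho>, so the shifted points stay within 3\<rho> = r/2 of
    \<omega>, the radius per factor that \<open>mem_ball_Pair\<close> asks for.\<close>
  define \<rho> where "\<rho> = r / 6"
  have \<rho>: "\<rho> > 0" using r by (simp add: \<rho>_def)
  show thesis
  proof (rule that[of \<rho> "(L1 + L2) / c"])
    show "\<rho> > 0" "(L1 + L2) / c \<ge> 0" using \<rho> c r1 r2 by auto
    fix x1 x2 \<xi> y1 y2 \<eta>
    assume x1: "{x1, y1} \<subseteq> ball z1 \<rho>" and x2: "{x2, y2} \<subseteq> ball z2 \<rho>" and \<xi>: "{\<xi>, \<eta>} \<subseteq> ball \<omega> \<rho>"
      and zx: "p (x1, \<xi>) = p (x2, \<xi>)" and zy: "p (y1, \<eta>) = p (y2, \<eta>)"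
    let ?s = "(\<xi> - \<eta>) \<bullet> b"
    let ?N = "norm (x1 - y1) + norm (x2 - y2) + norm ((\<xi> - \<eta>) - ?s *\<^sub>R b)"
    have "dist \<xi> \<eta> < 2 * \<rho>" using dist_triangle_half_r[of \<omega> \<xi> "2 * \<rho>" \<eta>] \<xi> by simp
    then have s: "\<bar>?s\<bar> < 2 * \<rho>" using Basis_le_norm[OF b, of "\<xi> - \<eta>"] by (simp add: dist_norm)
    have \<eta>t: "\<eta> + t *\<^sub>R b \<in> ball \<omega> (r / 2)" if "\<bar>t\<bar> \<le> \<bar>?s\<bar>" for t
    proof -
      have "dist \<omega> (\<eta> + t *\<^sub>R b) \<le> dist \<omega> \<eta> + dist \<eta> (\<eta> + t *\<^sub>R b)" by (rule dist_triangle)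
      also have "dist \<eta> (\<eta> + t *\<^sub>R b) = \<bar>t\<bar>" using norm_Basis[OF b] by (simp add: dist_norm)
      finally show ?thesis using that s \<xi> by (simp add: \<rho>_def)
    qed
    have in1: "(x, \<eta> + t *\<^sub>R b) \<in> ball (z1, \<omega>) r" if "\<bar>t\<bar> \<le> \<bar>?s\<bar>" "x \<in> {x1, y1}" for t x
      using \<eta>t[OF that(1)] x1 that(2) r by (intro mem_ball_Pair) (auto simp: \<rho>_def)
    have in2: "(x, \<eta> + t *\<^sub>R b) \<in> ball (z2, \<omega>) r" if "\<bar>t\<bar> \<le> \<bar>?s\<bar>" "x \<in> {x2, y2}" for t x
      using \<eta>t[OF that(1)] x2 that(2) r by (intro mem_ball_Pair) (auto simp: \<rho>_def)
    have in3: "(x1, \<xi>) \<in> ball (z1, \<omega>) r" "(x2, \<xi>) \<in> ball (z2, \<omega>) r"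
      by (rule mem_ball_Pair; use x1 x2 \<xi> r in \<open>simp add: \<rho>_def\<close>)+
    have yU: "y1 \<in> U" "y2 \<in> U"
      using in1[of 0 y1] in2[of 0 y2] subsetD[OF r1(3), of "(y1, \<eta>)"] subsetD[OF r2(3), of "(y2, \<eta>)"] r
      by (simp_all add: mem_Times_iff)
    have der: "((\<lambda>t. p (y1, \<eta> + t *\<^sub>R b) - p (y2, \<eta> + t *\<^sub>R b)) has_real_derivative
        ?q (y1, \<eta> + t *\<^sub>R b) - ?q (y2, \<eta> + t *\<^sub>R b)) (at t)" for t
      using DERIV_diff[OF real_analytic_on_has_partial_deriv[OF p b0, of "(y1, \<eta>)" t] real_analytic_on_has_partial_deriv[OF p b0, of "(y2, \<eta>)" t]] yU
      by simp
    obtain t where t: "\<bar>t\<bar> \<le> \<bar>?s\<bar>" and mvt: "p (y1, \<eta> + ?s *\<^sub>R b) - p (y2, \<eta> + ?s *\<^sub>R b) - (p (y1, \<eta> + 0 *\<^sub>R b) - p (y2, \<eta> + 0 *\<^sub>R b)) =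
        ?s * (?q (y1, \<eta> + t *\<^sub>R b) - ?q (y2, \<eta> + t *\<^sub>R b))"
      by (rule real_mvt_signed[OF der])
    have "\<bar>?q (y1, \<eta> + t *\<^sub>R b) - ?q (z1, \<omega>)\<bar> < c / 2"
      using in1[OF t, of y1] r by (intro d1) (simp add: dist_commute)
    moreover have "\<bar>?q (y2, \<eta> + t *\<^sub>R b) - ?q (z2, \<omega>)\<bar> < c / 2"
      using in2[OF t, of y2] r by (intro d2) (simp add: dist_commute)
    moreover have "\<bar>?q (z1, \<omega>) - ?q (z2, \<omega>)\<bar> = 2 * c" by (simp add: c_def)
    ultimately have q: "c \<le> \<bar>?q (y1, \<eta> + t *\<^sub>R b) - ?q (y2, \<eta> + t *\<^sub>R b)\<bar>" by linarith
    have n1: "norm ((y, \<eta> + ?s *\<^sub>R b) - (x, \<xi>)) \<le> norm (x - y) + norm ((\<xi> - \<eta>) - ?s *\<^sub>R b)" for x y :: 'z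
    proof -
      have "norm ((y, \<eta> + ?s *\<^sub>R b) - (x, \<xi>)) \<le> norm (y - x) + norm (\<eta> + ?s *\<^sub>R b - \<xi>)" 
        unfolding diff_Pair by (rule norm_Pair_le)
      also have "\<eta> + ?s *\<^sub>R b - \<xi> = - ((\<xi> - \<eta>) - ?s *\<^sub>R b)" by simp
      finally show ?thesis by (simp only: norm_minus_cancel norm_minus_commute[of y])
    qed
    have "\<bar>p (y1, \<eta> + ?s *\<^sub>R b) - p (x1, \<xi>)\<bar> \<le> L1 * norm ((y1, \<eta> + ?s *\<^sub>R b) - (x1, \<xi>))"
      by (rule L1) (use in1[of ?s y1] in3 r in auto)
    also have "\<dots> \<le> L1 * ?N"
      using n1[of y1 x1] r1 by (intro mult_left_mono) (auto intro: order_trans)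
    finally have a1: "\<bar>p (y1, \<eta> + ?s *\<^sub>R b) - p (x1, \<xi>)\<bar> \<le> L1 * ?N" .
    have "\<bar>p (y2, \<eta> + ?s *\<^sub>R b) - p (x2, \<xi>)\<bar> \<le> L2 * norm ((y2, \<eta> + ?s *\<^sub>R b) - (x2, \<xi>))"
      by (rule L2) (use in2[of ?s y2] in3 r in auto)
    also have "\<dots> \<le> L2 * ?N"
      using n1[of y2 x2] r2 by (intro mult_left_mono) (auto intro: order_trans)
    finally have a2: "\<bar>p (y2, \<eta> + ?s *\<^sub>R b) - p (x2, \<xi>)\<bar> \<le> L2 * ?N" .
    have "\<bar>?s\<bar> * c \<le> \<bar>?s\<bar> * \<bar>?q (y1, \<eta> + t *\<^sub>R b) - ?q (y2, \<eta> + t *\<^sub>R b)\<bar>"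
      using q by (intro mult_left_mono) auto
    also have "\<dots> = \<bar>p (y1, \<eta> + ?s *\<^sub>R b) - p (y2, \<eta> + ?s *\<^sub>R b)\<bar>"
      using mvt zy by (simp add: abs_mult)
    also have "\<dots> \<le> \<bar>p (y1, \<eta> + ?s *\<^sub>R b) - p (x1, \<xi>)\<bar> + \<bar>p (y2, \<eta> + ?s *\<^sub>R b) - p (x2, \<xi>)\<bar>"
      using zx by linarith
    also have "\<dots> \<le> (L1 + L2) * ?N" using a1 a2 by (simp only: distrib_right)
    finally show "\<bar>?s\<bar> \<le> (L1 + L2) / c * ?N" using c by (simp add: field_simps)
  qed
qed

section \<open>Negligible images and the dimension count\<close>

text \<open>The bound makes \<open>\<tau>\<close> a function of \<open>\<pi>\<close> on A, and a
  Lipschitz one; source and target have the same dimension, where Lipschitz maps preserve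
  negligibility.\<close>

lemma negligible_image_if_dominated:
  fixes \<pi> \<tau> :: "'w \<Rightarrow> 'n::euclidean_space"
  assumes neg: "negligible (\<pi> ` A)"
    and le: "\<And>w w'. w \<in> A \<Longrightarrow> w' \<in> A \<Longrightarrow> norm (\<tau> w - \<tau> w') \<le> K * norm (\<pi> w - \<pi> w')"
  shows "negligible (\<tau> ` A)"
proof -
  let ?f = "\<lambda>v. \<tau> (inv_into A \<pi> v)"
  have f: "?f (\<pi> w) = \<tau> w" if "w \<in> A" for w
    using le[of "inv_into A \<pi> (\<pi> w)" w] that by (simp add: inv_into_into f_inv_into_f)
  have "negligible (?f ` \<pi> ` A)"
  proof (rule negligible_locally_Lipschitz_image[OF order_refl neg])
    fix v assume v: "v \<in> \<pi> ` A"
    have "norm (?f v' - ?f v) \<le> K * norm (v' - v)" if "v' \<in> \<pi> ` A" for v'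
      using v that le f by auto
    then show "\<exists>T B. open T \<and> v \<in> T \<and> (\<forall>y\<in>\<pi> ` A \<inter> T. norm (?f y - ?f v) \<le> B * norm (y - v))"
      by (intro exI[of _ UNIV] exI[of _ K]) auto
  qed
  also have "?f ` \<pi> ` A = \<tau> ` A" using f by (force simp: image_iff)
  finally show ?thesis .
qed

lemma negligible_countable_cover:
  fixes S :: "'a::euclidean_space set"
  assumes "countable I" "\<And>i. i \<in> I \<Longrightarrow> negligible (N i)" "S \<subseteq> (\<Union>i\<in>I. N i)"
  shows "negligible S"
proof (rule negligible_subset[OF _ assms(3)])
  show "negligible (\<Union>i\<in>I. N i)"
    using assms(1,2) unfolding negligible_iff_null_sets by (intro null_sets_UN') auto
qed

text \<open>By Lindelof, countably many of the neighbourhoods already cover W.\<close>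

lemma negligible_image_if_locally:
  fixes \<tau> :: "'w::second_countable_topology \<Rightarrow> 'n::euclidean_space"
  assumes "\<And>w. w \<in> W \<Longrightarrow> \<exists>N. open N \<and> w \<in> N \<and> negligible (\<tau> ` (W \<inter> N))"
  shows "negligible (\<tau> ` W)"
proof -
  obtain N where N: "\<And>w. w \<in> W \<Longrightarrow> open (N w)" "\<And>w. w \<in> W \<Longrightarrow> w \<in> N w"
    "\<And>w. w \<in> W \<Longrightarrow> negligible (\<tau> ` (W \<inter> N w))" using assms by metis
  obtain F where F: "F \<subseteq> N ` W" "countable F" "\<Union>F = \<Union>(N ` W)"
    by (rule Lindelof[of "N ` W"]) (use N(1) in auto)
  show ?thesis
  proof (rule negligible_countable_cover[OF F(2), where N="\<lambda>V. \<tau> ` (W \<inter> V)"])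
    show "negligible (\<tau> ` (W \<inter> V))" if "V \<in> F" for V using that F(1) N(3) by auto
    show "\<tau> ` W \<subseteq> (\<Union>V\<in>F. \<tau> ` (W \<inter> V))"
    proof
      fix v assume "v \<in> \<tau> ` W"
      then obtain w where w: "w \<in> W" "v = \<tau> w" by auto
      then have "w \<in> \<Union>F" unfolding F(3) using N(2) by blast
      then show "v \<in> (\<Union>V\<in>F. \<tau> ` (W \<inter> V))" using w by auto
    qed
  qed
qed

text \<open>The map \<open>\<pi>\<close> of the proof overwrites the coordinate of \<open>\<Omega>\<^sub>i\<close> along \<open>b\<^sub>i\<close> by a coordinate of
  \<open>(x\<^sub>1, x\<^sub>2)\<close>, except for one index \<open>i0\<close>, where it writes \<open>0\<close>; its image lies in a hyperplane.\<close>

lemma negligible_zero_stratum: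
  fixes g :: "real ^ 'p \<Rightarrow> 'z::euclidean_space"
    and p :: "'k::finite \<Rightarrow> 'z \<times> 'e::euclidean_space \<Rightarrow> real"
  assumes card: "2 * CARD('p) < CARD('k)"
    and U: "open U" "g ` \<Theta> \<subseteq> U" and lip: "L-lipschitz_on \<Theta> g"
    and p: "\<And>i. real_analytic_on (p i) (U \<times> UNIV)" and b: "\<And>i. b i \<in> Basis"
  shows "negligible (snd ` {((x1, x2), \<Omega> :: 'e ^ 'k). x1 \<in> \<Theta> \<and> x2 \<in> \<Theta> \<and>
    (\<forall>i. p i (g x1, \<Omega> $ i) = p i (g x2, \<Omega> $ i) \<and>
         partial_deriv (0, b i) (p i) (g x1, \<Omega> $ i) \<noteq> partial_deriv (0, b i) (p i) (g x2, \<Omega> $ i))})" (is "negligible (snd ` ?W)")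
proof (rule negligible_image_if_locally)
  fix w0 assume "w0 \<in> ?W"
  then obtain x1 x2 \<Omega> where w0: "w0 = ((x1, x2), \<Omega>)" and x: "x1 \<in> \<Theta>" "x2 \<in> \<Theta>"
    and ne: "\<And>i. partial_deriv (0, b i) (p i) (g x1, \<Omega> $ i) \<noteq> partial_deriv (0, b i) (p i) (g x2, \<Omega> $ i)" by auto
  have "\<exists>\<rho> K. \<rho> > 0 \<and> K \<ge> 0 \<and> (\<forall>z1 z2 \<xi> y1 y2 \<eta>. {z1, y1} \<subseteq> ball (g x1) \<rho> \<longrightarrow> {z2, y2} \<subseteq> ball (g x2) \<rho> \<longrightarrow>
      {\<xi>, \<eta>} \<subseteq> ball (\<Omega> $ i) \<rho> \<longrightarrow> p i (z1, \<xi>) = p i (z2, \<xi>) \<longrightarrow> p i (y1, \<eta>) = p i (y2, \<eta>) \<longrightarrow>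
      \<bar>(\<xi> - \<eta>) \<bullet> b i\<bar> \<le> K * (norm (z1 - y1) + norm (z2 - y2) + norm ((\<xi> - \<eta>) - ((\<xi> - \<eta>) \<bullet> b i) *\<^sub>R b i)))" for i
    by (rule zero_set_coordinate_lipschitz[OF p U(1) _ _ b ne[of i]])
      (use x U(2) in \<open>auto intro!: exI\<close>)
  then obtain \<rho> K where \<rho>: "\<And>i. \<rho> i > 0" and K: "\<And>i. K i \<ge> 0" and
    loc: "\<And>i z1 z2 \<xi> y1 y2 \<eta>. {z1, y1} \<subseteq> ball (g x1) (\<rho> i) \<Longrightarrow> {z2, y2} \<subseteq> ball (g x2) (\<rho> i) \<Longrightarrow>
      {\<xi>, \<eta>} \<subseteq> ball (\<Omega> $ i) (\<rho> i) \<Longrightarrow> p i (z1, \<xi>) = p i (z2, \<xi>) \<Longrightarrow> p i (y1, \<eta>) = p i (y2, \<eta>) \<Longrightarrow>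
      \<bar>(\<xi> - \<eta>) \<bullet> b i\<bar> \<le> K i * (norm (z1 - y1) + norm (z2 - y2) + norm ((\<xi> - \<eta>) - ((\<xi> - \<eta>) \<bullet> b i) *\<^sub>R b i))"
    by metis
  define r where "r = Min (range \<rho>)"
  have r: "r > 0" "\<And>i. r \<le> \<rho> i" using \<rho> by (auto simp: r_def)
  have L0: "L \<ge> 0" using lip by (rule lipschitz_on_nonneg)
  \<comment> \<open>\<open>L + 1\<close> instead of \<open>L\<close> keeps the denominator positive
    when L = 0 and makes L * \<delta> strictly smaller than r.\<close>
  define \<delta> where "\<delta> = r / (L + 1)"
  have \<delta>: "\<delta> > 0" "(L + 1) * \<delta> = r" using r L0 by (auto simp: \<delta>_def)
  have gnear: "g y \<in> ball (g x) (\<rho> i)" if "x \<in> \<Theta>" "y \<in> \<Theta>" "y \<in> ball x \<delta>" for x y i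
  proof -
    have "dist (g x) (g y) \<le> L * dist x y" using lip that by (simp add: lipschitz_onD)
    also have "\<dots> \<le> L * \<delta>" using that L0 by (intro mult_left_mono) auto
    also have "\<dots> < r" using \<delta> by (simp add: algebra_simps)
    finally show ?thesis using r(2)[of i] by simp
  qed
  define N where "N = (ball x1 \<delta> \<times> ball x2 \<delta>) \<times> ball \<Omega> r"
  have \<Omega>near: "\<Omega>' $ i \<in> ball (\<Omega> $ i) (\<rho> i)" if "\<Omega>' \<in> ball \<Omega> r" for \<Omega>' i
    using that r(2)[of i] Finite_Cartesian_Product.norm_nth_le[of "\<Omega> - \<Omega>'" i] by (simp add: dist_norm)
  \<comment> \<open>The 2p coordinates of the pair are assigned to distinct blocks of the frequency
    vector; since 2p < k, one block is left over.\<close>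
  obtain \<sigma> :: "'p + 'p \<Rightarrow> 'k" where \<sigma>: "inj \<sigma>"
    using card card_le_inj[of "UNIV :: ('p + 'p) set" "UNIV :: 'k set"] by (auto simp: card_Plus UNIV_Plus_UNIV[symmetric] simp del: UNIV_Plus_UNIV)
  have "card (range \<sigma>) < CARD('k)"
    using card card_image[OF \<sigma>] by (simp add: card_Plus UNIV_Plus_UNIV[symmetric] del: UNIV_Plus_UNIV)
  then have "range \<sigma> \<noteq> UNIV" by auto
  then obtain i0 where i0: "i0 \<notin> range \<sigma>" by blast
  define y :: "(real ^ 'p) \<times> (real ^ 'p) \<Rightarrow> 'k \<Rightarrow> real" where
    "y q i = (if i \<in> range \<sigma> then case inv \<sigma> i of Inl j \<Rightarrow> fst q $ j | Inr j \<Rightarrow> snd q $ j else 0)" for q i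
  have y\<sigma>: "y q (\<sigma> (Inl j)) = fst q $ j" "y q (\<sigma> (Inr j)) = snd q $ j" for q j
    using \<sigma> by (simp_all add: y_def)
  define \<pi> :: "((real ^ 'p) \<times> (real ^ 'p)) \<times> ('e ^ 'k) \<Rightarrow> 'e ^ 'k" where
    "\<pi> w = (\<chi> i. snd w $ i - (snd w $ i \<bullet> b i) *\<^sub>R b i + y (fst w) i *\<^sub>R b i)" for w
  have bb: "b i \<bullet> b i = 1" "norm (b i) = 1" for i using b[of i] by (auto simp: norm_Basis)
  have \<pi>b: "\<pi> w $ i \<bullet> b i = y (fst w) i" for w i
    by (simp add: \<pi>_def inner_add_left inner_diff_left bb)
  define P where "P = real CARD('p)"
  \<comment> \<open>With \<open>D\<close> the distance of the \<open>\<pi>\<close>-images, 2 D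
    bounds the part of a block difference orthogonal to \<open>b i\<close>. The other summand bounds
    the part along \<open>b i\<close> by the local estimate, in which parameter differences of size
    P * D have passed through \<open>g\<close>.\<close>
  define K' where "K' i = 2 + K i * (L * P + L * P + 2)" for i
  have "negligible (snd ` (?W \<inter> N))"
  proof (rule negligible_image_if_dominated)
    have "\<pi> ` (?W \<inter> N) \<subseteq> {v. v \<bullet> axis i0 (b i0) = 0}"
      using i0 by (auto simp: inner_axis \<pi>b y_def)
    moreover have "negligible {v. v \<bullet> axis i0 (b i0) = 0}"
      by (rule negligible_standard_hyperplane) (simp add: b)
    ultimately show "negligible (\<pi> ` (?W \<inter> N))" by (rule negligible_subset[rotated])
  next
    fix w w' assume w: "w \<in> ?W \<inter> N" "w' \<in> ?W \<inter> N"
    obtain y1 y2 A where weq: "w = ((y1, y2), A)" by (metis surj_pair)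
    obtain y1' y2' A' where weq': "w' = ((y1', y2'), A')" by (metis surj_pair)
    define D where "D = norm (\<pi> w - \<pi> w')"
    have Dy: "\<bar>y (fst w) i - y (fst w') i\<bar> \<le> D" for i
    proof -
      have "\<bar>y (fst w) i - y (fst w') i\<bar> = \<bar>((\<pi> w - \<pi> w') $ i) \<bullet> b i\<bar>"
        by (simp add: inner_diff_left \<pi>b)
      also have "\<dots> \<le> norm ((\<pi> w - \<pi> w') $ i)" by (rule Basis_le_norm[OF b])
      also have "\<dots> \<le> D" unfolding D_def by (rule Finite_Cartesian_Product.norm_nth_le)
      finally show ?thesis .
    qed
    have Dx: "norm (y1 - y1') \<le> P * D" "norm (y2 - y2') \<le> P * D"
    proof -
      have "norm (y1 - y1') \<le> (\<Sum>j\<in>UNIV. \<bar>(y1 - y1') $ j\<bar>)" by (rule norm_le_l1_cart)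
      also have "\<dots> \<le> (\<Sum>j\<in>(UNIV::'p set). D)"
        using Dy[of "\<sigma> (Inl _)"] by (intro sum_mono) (simp add: y\<sigma> weq weq')
      finally show "norm (y1 - y1') \<le> P * D" by (simp add: P_def)
      have "norm (y2 - y2') \<le> (\<Sum>j\<in>UNIV. \<bar>(y2 - y2') $ j\<bar>)" by (rule norm_le_l1_cart)
      also have "\<dots> \<le> (\<Sum>j\<in>(UNIV::'p set). D)"
        using Dy[of "\<sigma> (Inr _)"] by (intro sum_mono) (simp add: y\<sigma> weq weq')
      finally show "norm (y2 - y2') \<le> P * D" by (simp add: P_def)
    qed
    have Dg: "norm (g y1 - g y1') \<le> L * (P * D)" "norm (g y2 - g y2') \<le> L * (P * D)"
      using w lipschitz_onD[OF lip, of y1 y1'] lipschitz_onD[OF lip, of y2 y2']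
        mult_left_mono[OF Dx(1) L0] mult_left_mono[OF Dx(2) L0]
      by (auto simp: weq weq' dist_norm)
    have DA: "norm (A $ i - A' $ i) \<le> K' i * D" for i
    proof -
      let ?a = "A $ i - A' $ i"
      have "?a - (?a \<bullet> b i) *\<^sub>R b i = (\<pi> w - \<pi> w') $ i - (y (fst w) i - y (fst w') i) *\<^sub>R b i"
        by (simp add: \<pi>_def weq weq' algebra_simps)
      also have "norm \<dots> \<le> norm ((\<pi> w - \<pi> w') $ i) + norm ((y (fst w) i - y (fst w') i) *\<^sub>R b i)"
        by (rule norm_triangle_ineq4)
      also have "\<dots> \<le> D + D"
        using Dy[of i] Finite_Cartesian_Product.norm_nth_le[of "\<pi> w - \<pi> w'" i] by (intro add_mono) (auto simp: D_def bb)
      finally have perp: "norm (?a - (?a \<bullet> b i) *\<^sub>R b i) \<le> 2 * D" by simp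
      have "\<bar>?a \<bullet> b i\<bar> \<le> K i * (norm (g y1 - g y1') + norm (g y2 - g y2') + norm (?a - (?a \<bullet> b i) *\<^sub>R b i))"
        by (rule loc) (use w x gnear \<Omega>near in \<open>auto simp: weq weq' N_def\<close>)
      also have "\<dots> \<le> K i * (L * (P * D) + L * (P * D) + 2 * D)"
        using Dg perp by (intro mult_left_mono[OF _ K] add_mono)
      finally have par: "\<bar>?a \<bullet> b i\<bar> \<le> K i * (L * (P * D) + L * (P * D) + 2 * D)" .
      have "norm ?a \<le> norm (?a - (?a \<bullet> b i) *\<^sub>R b i) + norm ((?a \<bullet> b i) *\<^sub>R b i)"
        using norm_triangle_ineq[of "?a - (?a \<bullet> b i) *\<^sub>R b i" "(?a \<bullet> b i) *\<^sub>R b i"] by simp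
      also have "\<dots> \<le> 2 * D + K i * (L * (P * D) + L * (P * D) + 2 * D)"
        using perp par by (simp add: bb)
      also have "\<dots> = K' i * D" by (simp add: K'_def algebra_simps)
      finally show ?thesis .
    qed
    have "norm (A - A') \<le> (\<Sum>i\<in>UNIV. norm ((A - A') $ i))"
      unfolding norm_vec_def[of "A - A'"] by (rule L2_set_le_sum) simp
    also have "\<dots> \<le> (\<Sum>i\<in>UNIV. K' i * D)" using DA by (intro sum_mono) simp
    finally show "norm (snd w - snd w') \<le> (\<Sum>i\<in>UNIV. K' i) * norm (\<pi> w - \<pi> w')"
      by (simp add: weq weq' D_def sum_distrib_right)
  qed
  moreover have "open N" unfolding N_def by (intro open_Times open_ball)
  moreover have "w0 \<in> N" using \<delta> r by (simp add: N_def w0)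
  ultimately show "\<exists>N. open N \<and> w0 \<in> N \<and> negligible (snd ` (?W \<inter> N))" by blast
qed

text \<open>Strata are indexed by \<open>\<beta>\<close>, which gives every index i its own list of
  directions and one further direction, while the pair (x1, x2) is common to all i. Lists over the
  finite \<open>Basis\<close> are countable and there are finitely many i, so countably many strata
  suffice.\<close>

lemma negligible_nonseparating:
  fixes g :: "real ^ 'p \<Rightarrow> 'z::euclidean_space"
    and f :: "'k::finite \<Rightarrow> 'z \<times> 'e::euclidean_space \<Rightarrow> real"
  assumes card: "2 * CARD('p) < CARD('k)"
    and U: "open U" "g ` \<Theta> \<subseteq> U" and lip: "L-lipschitz_on \<Theta> g"
    and f: "\<And>i. real_analytic_on (f i) (U \<times> UNIV)"
    and sep: "\<And>i z1 z2. z1 \<in> g ` \<Theta> \<Longrightarrow> z2 \<in> g ` \<Theta> \<Longrightarrow> z1 \<noteq> z2 \<Longrightarrow> \<exists>\<omega>. f i (z1, \<omega>) \<noteq> f i (z2, \<omega>)"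
  shows "negligible {\<Omega> :: 'e ^ 'k. \<exists>z1\<in>g ` \<Theta>. \<exists>z2\<in>g ` \<Theta>. z1 \<noteq> z2 \<and> (\<forall>i. f i (z1, \<Omega> $ i) = f i (z2, \<Omega> $ i))}"
proof -
  define W where "W \<beta> = {((x1, x2), \<Omega> :: 'e ^ 'k). x1 \<in> \<Theta> \<and> x2 \<in> \<Theta> \<and>
    (\<forall>i. partial_derivs (map (Pair 0) (fst (\<beta> i))) (f i) (g x1, \<Omega> $ i) = partial_derivs (map (Pair 0) (fst (\<beta> i))) (f i) (g x2, \<Omega> $ i) \<and>
         partial_deriv (0, snd (\<beta> i)) (partial_derivs (map (Pair 0) (fst (\<beta> i))) (f i)) (g x1, \<Omega> $ i) \<noteq>
         partial_deriv (0, snd (\<beta> i)) (partial_derivs (map (Pair 0) (fst (\<beta> i))) (f i)) (g x2, \<Omega> $ i))}"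
    for \<beta> :: "'k \<Rightarrow> 'e list \<times> 'e"
  let ?I = "PiE UNIV (\<lambda>_. lists Basis \<times> Basis) :: ('k \<Rightarrow> 'e list \<times> 'e) set"
  show ?thesis
  proof (rule negligible_countable_cover[of ?I "\<lambda>\<beta>. snd ` W \<beta>"])
    show "countable ?I"
      by (intro countable_PiE countable_SIGMA countable_lists countable_finite) auto
    show "negligible (snd ` W \<beta>)" if "\<beta> \<in> ?I" for \<beta>
      unfolding W_def
    proof (rule negligible_zero_stratum[OF card U lip, of "\<lambda>i. partial_derivs (map (Pair 0) (fst (\<beta> i))) (f i)" "\<lambda>i. snd (\<beta> i)"])
      fix i
      have \<beta>: "fst (\<beta> i) \<in> lists Basis" "snd (\<beta> i) \<in> Basis" using that by (auto simp: PiE_iff mem_Times_iff)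
      show "real_analytic_on (partial_derivs (map (Pair 0) (fst (\<beta> i))) (f i)) (U \<times> UNIV)"
        using \<beta> by (intro real_analytic_on_partial_derivs f) (auto simp: Basis_prod_def)
      show "snd (\<beta> i) \<in> Basis" by (rule \<beta>)
    qed
    show "{\<Omega>. \<exists>z1\<in>g ` \<Theta>. \<exists>z2\<in>g ` \<Theta>. z1 \<noteq> z2 \<and> (\<forall>i. f i (z1, \<Omega> $ i) = f i (z2, \<Omega> $ i))} \<subseteq> (\<Union>\<beta>\<in>?I. snd ` W \<beta>)"
    proof clarify
      fix \<Omega> :: "'e ^ 'k" and x1 x2
      assume x: "x1 \<in> \<Theta>" "x2 \<in> \<Theta>" "g x1 \<noteq> g x2" and eq: "\<forall>i. f i (g x1, \<Omega> $ i) = f i (g x2, \<Omega> $ i)"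
      have "\<exists>bs b. set bs \<subseteq> Basis \<and> b \<in> Basis \<and>
        partial_derivs (map (Pair 0) bs) (f i) (g x1, \<Omega> $ i) = partial_derivs (map (Pair 0) bs) (f i) (g x2, \<Omega> $ i) \<and>
        partial_deriv (0, b) (partial_derivs (map (Pair 0) bs) (f i)) (g x1, \<Omega> $ i) \<noteq> partial_deriv (0, b) (partial_derivs (map (Pair 0) bs) (f i)) (g x2, \<Omega> $ i)" for i
      proof (rule ccontr)
        \<comment> \<open>Without such a pattern, agreement at \<open>bs\<close> would pass on to
          every \<open>b # bs\<close>; starting from the collision itself, all derivatives would
          agree.\<close>
        assume no: "\<not> ?thesis"
        have all: "partial_derivs (map (Pair 0) bs) (f i) (g x1, \<Omega> $ i) = partial_derivs (map (Pair 0) bs) (f i) (g x2, \<Omega> $ i)"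
          if "set bs \<subseteq> Basis" for bs
          using that by (induction bs) (use eq no in auto)
        obtain \<omega>' where \<omega>': "f i (g x1, \<omega>') \<noteq> f i (g x2, \<omega>')" using sep x by blast
        obtain cs where cs: "set cs \<subseteq> Pair 0 ` Basis" "partial_derivs cs (f i) (g x1, \<Omega> $ i) \<noteq> partial_derivs cs (f i) (g x2, \<Omega> $ i)"
          by (rule partial_derivs_separate[OF f _ _ \<omega>']) (use x U in auto)
        have "cs = map (Pair 0) (map snd cs)" using cs(1) by (induction cs) auto
        moreover have "set (map snd cs) \<subseteq> Basis" using cs(1) by auto
        ultimately show False using all[of "map snd cs"] cs(2) by metis
      qed
      then obtain bs b where bs: "\<And>i. set (bs i) \<subseteq> Basis" "\<And>i. b i \<in> Basis"
        "\<And>i. partial_derivs (map (Pair 0) (bs i)) (f i) (g x1, \<Omega> $ i) = partial_derivs (map (Pair 0) (bs i)) (f i) (g x2, \<Omega> $ i)"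
        "\<And>i. partial_deriv (0, b i) (partial_derivs (map (Pair 0) (bs i)) (f i)) (g x1, \<Omega> $ i) \<noteq> partial_deriv (0, b i) (partial_derivs (map (Pair 0) (bs i)) (f i)) (g x2, \<Omega> $ i)"
        by metis
      have "((x1, x2), \<Omega>) \<in> W (\<lambda>i. (bs i, b i))" using x bs by (simp add: W_def)
      moreover have "(\<lambda>i. (bs i, b i)) \<in> ?I" using bs(1,2) by (auto simp: PiE_iff)
      moreover have "\<Omega> = snd ((x1, x2), \<Omega>)" by simp
      ultimately show "\<Omega> \<in> (\<Union>\<beta>\<in>?I. snd ` W \<beta>)" by (intro UN_I image_eqI)
    qed
  qed
qed

section \<open>Characteristic functions determine laws\<close>

lemma integrable_bounded_continuous:
  fixes f :: "'a::euclidean_space \<Rightarrow> 'b::{banach, second_countable_topology}"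
  assumes "finite_measure P" "sets P = sets borel" "continuous_on UNIV f" "\<And>x. norm (f x) \<le> B"
  shows "integrable P f"
proof -
  interpret finite_measure P by fact
  have "f \<in> borel_measurable P"
    using borel_measurable_continuous_onI[OF assms(3)] by (simp cong: measurable_cong_sets add: assms(2))
  then show ?thesis using assms(4) by (intro integrable_const_bound[where B=B]) auto
qed

lemma integral_cos_eq_char_fun:
  fixes P :: "'a::euclidean_space measure"
  assumes P: "finite_measure P" "sets P = sets borel"
  shows "(LINT x|P. cos (\<omega> \<bullet> x + a)) = cos a * Re (char_fun P \<omega>) - sin a * Im (char_fun P \<omega>)"
proof -
  have i: "integrable P (\<lambda>x. iexp (\<omega> \<bullet> x))"
    by (rule integrable_bounded_continuous[OF P, of _ 1]) (auto intro!: continuous_intros)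
  have "(LINT x|P. cos (\<omega> \<bullet> x + a)) = (LINT x|P. Re (iexp a * iexp (\<omega> \<bullet> x)))"
    by (intro Bochner_Integration.integral_cong refl) (simp add: exp_add[symmetric] algebra_simps cos_add Re_exp Im_exp)
  also have "\<dots> = Re (iexp a * char_fun P \<omega>)"
    using i by (simp add: char_fun_def integral_Re)
  also have "\<dots> = cos a * Re (char_fun P \<omega>) - sin a * Im (char_fun P \<omega>)"
    by (simp add: Re_exp Im_exp)
  finally show ?thesis .
qed

section \<open>Trigonometric polynomials as test functions\<close>

text \<open>The arbitrary phase brings in sines and constants, and lets the product-to-sum formula
  for cosines alone close the class under multiplication.\<close>

inductive_set trig_poly :: "('a::euclidean_space \<Rightarrow> real) set" where
  cos: "(\<lambda>x. cos (\<omega> \<bullet> x + a)) \<in> trig_poly"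
| add: "f \<in> trig_poly \<Longrightarrow> g \<in> trig_poly \<Longrightarrow> (\<lambda>x. f x + g x) \<in> trig_poly"
| scale: "f \<in> trig_poly \<Longrightarrow> (\<lambda>x. c * f x) \<in> trig_poly"

lemma trig_poly_const: "(\<lambda>x. c) \<in> trig_poly"
  using trig_poly.scale[OF trig_poly.cos[of 0 0], of c] by simp

lemma trig_poly_cos_mult:
  fixes f :: "'a::euclidean_space \<Rightarrow> real"
  assumes "f \<in> trig_poly"
  shows "(\<lambda>x. cos (\<omega> \<bullet> x + a) * f x) \<in> trig_poly"
  using assms
proof induction
  case (cos \<omega>' a')
  have "(\<lambda>x. 1 / 2 * cos ((\<omega> + \<omega>') \<bullet> x + (a + a')) + 1 / 2 * cos ((\<omega> - \<omega>') \<bullet> x + (a - a'))) \<in> trig_poly"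
    by (intro trig_poly.intros)
  moreover have "1 / 2 * cos ((\<omega> + \<omega>') \<bullet> x + (a + a')) + 1 / 2 * cos ((\<omega> - \<omega>') \<bullet> x + (a - a')) =
      cos (\<omega> \<bullet> x + a) * cos (\<omega>' \<bullet> x + a')" for x
  proof -
    have *: "(\<omega> + \<omega>') \<bullet> x + (a + a') = (\<omega> \<bullet> x + a) + (\<omega>' \<bullet> x + a')"
      "(\<omega> - \<omega>') \<bullet> x + (a - a') = (\<omega> \<bullet> x + a) - (\<omega>' \<bullet> x + a')"
      by (simp_all add: algebra_simps)
    show ?thesis unfolding * cos_add cos_diff by (simp add: algebra_simps)
  qed
  ultimately show ?case by simp
next
  case (add f g)
  then show ?case by (simp only: distrib_left) (rule trig_poly.add)
next
  case (scale f c)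
  then show ?case by (simp only: mult.left_commute[of _ c]) (rule trig_poly.scale)
qed

lemma trig_poly_mult:
  assumes "f \<in> trig_poly" "g \<in> trig_poly"
  shows "(\<lambda>x. f x * g x) \<in> trig_poly"
  using assms(1)
proof induction
  case (cos \<omega> a)
  show ?case by (rule trig_poly_cos_mult[OF assms(2)])
next
  case (add f g)
  then show ?case by (simp only: distrib_right) (rule trig_poly.add)
next
  case (scale f c)
  then show ?case by (simp only: mult.assoc) (rule trig_poly.scale)
qed

lemma trig_poly_continuous: "f \<in> trig_poly \<Longrightarrow> continuous_on S f"
  by (induction rule: trig_poly.induct) (auto intro!: continuous_intros)

lemma trig_poly_bounded: "f \<in> trig_poly \<Longrightarrow> \<exists>B. \<forall>x. \<bar>f x\<bar> \<le> B"
proof (induction rule: trig_poly.induct)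
  case (cos \<omega> a)
  show ?case by (intro exI[of _ 1]) simp
next
  case (add f g)
  then obtain B C where "\<And>x. \<bar>f x\<bar> \<le> B" "\<And>x. \<bar>g x\<bar> \<le> C" by blast
  then have "\<bar>f x + g x\<bar> \<le> B + C" for x by (metis abs_triangle_ineq add_mono order_trans)
  then show ?case by blast
next
  case (scale f c)
  then obtain B where "\<And>x. \<bar>f x\<bar> \<le> B" by blast
  then have "\<bar>c * f x\<bar> \<le> \<bar>c\<bar> * B" for x by (simp add: abs_mult mult_left_mono)
  then show ?case by blast
qed

lemma trig_poly_integrable:
  assumes "finite_measure P" "sets P = sets borel" "f \<in> trig_poly"
  shows "integrable P f"
  using trig_poly_bounded[OF assms(3)] integrable_bounded_continuous[OF assms(1,2) trig_poly_continuous[OF assms(3)]]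
  by auto

lemma trig_poly_integral_eq:
  fixes P Q :: "'a::euclidean_space measure"
  assumes P: "finite_measure P" "sets P = sets borel" and Q: "finite_measure Q" "sets Q = sets borel"
    and eq: "\<And>\<omega>. char_fun P \<omega> = char_fun Q \<omega>" and f: "f \<in> trig_poly"
  shows "(LINT x|P. f x) = (LINT x|Q. f x)"
  using f
proof induction
  case (cos \<omega> a)
  show ?case by (simp add: integral_cos_eq_char_fun P Q eq)
next
  case (add f g)
  then show ?case using trig_poly_integrable[OF P] trig_poly_integrable[OF Q] by simp
next
  case (scale f c)
  then show ?case by simp
qed

lemma trig_poly_real_polynomial:
  assumes "real_polynomial_function p" "f \<in> trig_poly"
  shows "(\<lambda>x. p (f x)) \<in> trig_poly"
  using assms(1)
proof induction
  case (linear h)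
  then have "h = (\<lambda>t. h 1 * t)"
    using bounded_linear.linear linear_cmul[of h] by (metis mult.commute mult.right_neutral real_scaleR_def)
  then show ?case using trig_poly.scale[OF assms(2), of "h 1"] by metis
next
  case (const c)
  show ?case by (rule trig_poly_const)
qed (auto intro: trig_poly.add trig_poly_mult)

lemma function_ring_on_trig_poly:
  fixes S :: "'a::euclidean_space set"
  assumes "compact S"
  shows "function_ring_on trig_poly S"
proof (rule function_ring_on.intro)
  fix x y :: 'a assume "x \<noteq> y"
  \<comment> \<open>Scaled so that the arguments at x and y differ by pi; with the shift below, the
    cosine is 1 at x and -1 at y.\<close>
  define \<omega> where "\<omega> = (pi / ((x - y) \<bullet> (x - y))) *\<^sub>R (x - y)"
  have "\<omega> \<bullet> (x - y) = pi" using \<open>x \<noteq> y\<close> by (simp add: \<omega>_def)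
  then have "\<omega> \<bullet> y - \<omega> \<bullet> x = - pi" by (simp add: inner_diff_right)
  then have "cos (\<omega> \<bullet> x + - (\<omega> \<bullet> x)) \<noteq> cos (\<omega> \<bullet> y + - (\<omega> \<bullet> x))" by simp
  then show "\<exists>f\<in>trig_poly. f x \<noteq> f y" using trig_poly.cos[of \<omega> "- (\<omega> \<bullet> x)"] by (intro bexI)
qed (use assms in \<open>auto intro: trig_poly_continuous trig_poly.add trig_poly_mult trig_poly_const\<close>)

lemma measure_Compl_cball_small:
  fixes P :: "'a::euclidean_space measure"
  assumes P: "finite_measure P" "sets P = sets borel" and e: "e > 0"
  shows "\<exists>n0. \<forall>n\<ge>n0. measure P (- cball 0 (real n)) < e"
proof -
  interpret finite_measure P by fact
  have "(\<lambda>n. measure P (- cball 0 (real n))) \<longlonglongrightarrow> measure P (\<Inter>n. - cball 0 (real n))"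
  proof (rule finite_Lim_measure_decseq)
    show "decseq (\<lambda>n. - cball (0::'a) (real n))" by (rule decseq_SucI) auto
  qed (auto simp: P(2) intro!: borel_open)
  moreover have "(\<Inter>n. - cball (0::'a) (real n)) = {}"
    using real_arch_simple by (simp add: set_eq_iff) blast
  ultimately have "(\<lambda>n. measure P (- cball 0 (real n))) \<longlonglongrightarrow> 0" by simp
  from order_tendstoD(2)[OF this e] show ?thesis by (simp add: eventually_sequentially)
qed

text \<open>Trigonometric polynomials approximate \<open>f\<close> only on compact sets and may be large elsewhere.
  Composing with a polynomial that approximates the clipping of the real line to \<open>[-1, 1]\<close> bounds
  them globally and stays within trigonometric polynomials.\<close>

lemma char_fun_integral_eq:
  fixes P Q :: "'a::euclidean_space measure"
  assumes P: "finite_measure P" "sets P = sets borel" and Q: "finite_measure Q" "sets Q = sets borel"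
    and eq: "\<And>\<omega>. char_fun P \<omega> = char_fun Q \<omega>"
    and f: "continuous_on UNIV f" "\<And>x. \<bar>f x\<bar> \<le> (1::real)"
  shows "(LINT x|P. f x) = (LINT x|Q. f x)"
proof -
  define m where "m = measure P UNIV + measure Q UNIV"
  \<comment> \<open>Each of P and Q contributes 2 e times its mass plus 3 e: an error 2 e
    everywhere, and 3 more on a set of measure below e.\<close>
  have "\<bar>(LINT x|P. f x) - (LINT x|Q. f x)\<bar> \<le> (2 * m + 6) * e" if e: "0 < e" "e \<le> 1" for e
  proof -
    obtain n1 where n1: "\<forall>n\<ge>n1. measure P (- cball 0 (real n)) < e" using measure_Compl_cball_small[OF P e(1)] by blast
    obtain n2 where n2: "\<forall>n\<ge>n2. measure Q (- cball 0 (real n)) < e" using measure_Compl_cball_small[OF Q e(1)] by blast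
    define S :: "'a set" where "S = cball 0 (real (max n1 n2))"
    have S: "compact S" "measure P (-S) < e" "measure Q (-S) < e" using n1 n2 by (auto simp: S_def)
    interpret function_ring_on trig_poly S by (rule function_ring_on_trig_poly[OF S(1)])
    obtain h where h: "h \<in> trig_poly" "\<And>x. x \<in> S \<Longrightarrow> \<bar>f x - h x\<bar> < e"
      using Stone_Weierstrass_basic[OF continuous_on_subset[OF f(1)] e(1)] by auto
    obtain B where B: "\<And>x. \<bar>h x\<bar> \<le> B" using trig_poly_bounded[OF h(1)] by blast
    let ?c = "\<lambda>t::real. max (- 1) (min 1 t)"
    have "continuous_on {-B..B} ?c" by (intro continuous_intros)
    \<comment> \<open>Approximating on [-B, B] is enough, since h takes all its values there, also
      outside S.\<close>
    then obtain p where p: "real_polynomial_function p" "\<And>t. t \<in> {-B..B} \<Longrightarrow> \<bar>?c t - p t\<bar> < e"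
      using Stone_Weierstrass_real_polynomial_function[OF compact_Icc _ e(1)] by metis
    let ?h = "\<lambda>x. p (h x)"
    have ph: "\<bar>?c (h x) - ?h x\<bar> < e" for x using B[of x] by (intro p(2)) (auto simp: abs_le_iff)
    have hp: "?h \<in> trig_poly" by (rule trig_poly_real_polynomial[OF p(1) h(1)])
    have close: "\<bar>(LINT x|R. f x) - (LINT x|R. ?h x)\<bar> \<le> 2 * e * measure R UNIV + 3 * e"
      if R: "finite_measure R" "sets R = sets borel" "measure R (-S) < e" for R
    proof -
      interpret R: finite_measure R by fact
      have spR: "space R = UNIV" using R(2) by (metis sets_eq_imp_space_eq space_borel)
      have Sm: "- S \<in> sets R" using S(1) by (simp add: R(2) borel_closed compact_imp_closed)
      have i: "integrable R f" "integrable R ?h"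
        using integrable_bounded_continuous[OF R(1,2) f(1), of 1] f(2) trig_poly_integrable[OF R(1,2) hp] by auto
      have "\<bar>(LINT x|R. f x) - (LINT x|R. ?h x)\<bar> = \<bar>LINT x|R. f x - ?h x\<bar>" using i by simp
      also have "\<dots> \<le> (LINT x|R. \<bar>f x - ?h x\<bar>)" by (rule integral_abs_bound)
      also have "\<dots> \<le> (LINT x|R. 2 * e + 3 * indicator (- S) x)"
      proof (rule integral_mono)
        show "integrable R (\<lambda>x. 2 * e + 3 * indicator (- S) x)"
          using Sm by (auto simp: R.emeasure_eq_measure)
        fix x
        show "\<bar>f x - ?h x\<bar> \<le> 2 * e + 3 * indicator (- S) x"
        proof (cases "x \<in> S")
          case True
          \<comment> \<open>Clipping is 1-Lipschitz and fixes the values of f, so it cannot increase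
            the distance to f.\<close>
          have "\<bar>f x - ?c (h x)\<bar> \<le> \<bar>f x - h x\<bar>" using f(2)[of x] by (auto simp: abs_if min_def max_def split: if_splits)
          then have "\<bar>f x - ?h x\<bar> \<le> 2 * e" using h(2)[OF True] ph[of x] by linarith
          then show ?thesis using True by simp
        next
          case False
          have "\<bar>?c (h x)\<bar> \<le> 1" by auto
          then have "\<bar>f x - ?h x\<bar> \<le> 2 * e + 3" using f(2)[of x] ph[of x] e by linarith
          then show ?thesis using False by simp
        qed
      qed (use i in auto)
      also have "\<dots> = 2 * e * measure R UNIV + 3 * measure R (- S)"
        using Sm spR by (simp add: R.emeasure_eq_measure)
      finally show ?thesis using R(3) by simp
    qed
    have "(LINT x|P. ?h x) = (LINT x|Q. ?h x)" by (rule trig_poly_integral_eq[OF P Q eq hp])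
    with close[OF P S(2)] close[OF Q S(3)] show ?thesis by (simp add: m_def algebra_simps)
  qed
  note le = this
  have "m \<ge> 0" by (simp add: m_def)
  have "\<bar>(LINT x|P. f x) - (LINT x|Q. f x)\<bar> \<le> 0 + d" if "d > 0" for d
  proof -
    define e where "e = min 1 (d / (2 * m + 6))"
    have "0 < e" "e \<le> 1" using that \<open>m \<ge> 0\<close> by (auto simp: e_def)
    note le[OF this]
    also have "(2 * m + 6) * e \<le> (2 * m + 6) * (d / (2 * m + 6))"
      using \<open>m \<ge> 0\<close> by (intro mult_left_mono) (auto simp: e_def)
    also have "\<dots> = d" using \<open>m \<ge> 0\<close> by simp
    finally show ?thesis by simp
  qed
  then have "\<bar>(LINT x|P. f x) - (LINT x|Q. f x)\<bar> \<le> 0" by (rule field_le_epsilon)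
  then show ?thesis by simp
qed

text \<open>Closed sets form an intersection-stable generator of the Borel sets, and the indicator
  of a nonempty closed set is a pointwise limit of continuous functions with values in [0, 1], whose
  integrals are already known to agree.\<close>

theorem char_fun_inject:
  fixes P Q :: "'a::euclidean_space measure"
  assumes P: "finite_measure P" "sets P = sets borel" and Q: "finite_measure Q" "sets Q = sets borel"
    and eq: "\<And>\<omega>. char_fun P \<omega> = char_fun Q \<omega>"
  shows "P = Q"
proof -
  interpret P: finite_measure P by fact
  interpret Q: finite_measure Q by fact
  have closed_eq: "measure P C = measure Q C" if C: "closed C" for C
  \<comment> \<open>The empty set is split off because \<open>infdist x {}\<close> is 0, which would
    turn the approximating functions into the constant 1.\<close>
  proof (cases "C = {}")
    case False
    let ?f = "\<lambda>n x. max 0 (1 - real n * infdist x C)"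
    have lim: "(\<lambda>n. LINT x|R. ?f n x) \<longlonglongrightarrow> measure R C" if R: "finite_measure R" "sets R = sets borel" for R
    proof -
      interpret R: finite_measure R by fact
      have "(\<lambda>n. LINT x|R. ?f n x) \<longlonglongrightarrow> (LINT x|R. indicator C x)"
      proof (rule integral_dominated_convergence[where w="\<lambda>_. 1"])
        show "?f n \<in> borel_measurable R" for n
          using R(2) by (intro borel_measurable_continuous_onI[THEN measurable_cong_sets[OF R(2) refl, THEN equalityD2, THEN subsetD]])
            (auto intro!: continuous_intros)
        show "indicator C \<in> borel_measurable R" by (intro borel_measurable_indicator) (simp add: R(2) borel_closed C)
        show "AE x in R. (\<lambda>n. ?f n x) \<longlonglongrightarrow> indicator C x"
        proof (rule AE_I2)
          fix x
          show "(\<lambda>n. ?f n x) \<longlonglongrightarrow> indicator C x"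
          proof (cases "x \<in> C")
            case True then show ?thesis by simp
          next
            case nx: False
            then have d: "infdist x C > 0"
              using C False by (metis in_closed_iff_infdist_zero infdist_nonneg less_eq_real_def)
            obtain n0 :: nat where "1 / infdist x C \<le> real n0" using real_arch_simple by blast
            then have n0: "1 \<le> real n0 * infdist x C" using d by (simp add: field_simps)
            have "?f n x = 0" if "n \<ge> n0" for n
            proof -
              have "real n0 * infdist x C \<le> real n * infdist x C" using that d by (intro mult_right_mono) auto
              then show ?thesis using n0 by linarith
            qed
            then have "eventually (\<lambda>n. ?f n x = 0) sequentially" by (auto simp: eventually_sequentially)
            then show ?thesis using nx by (simp add: tendsto_eventually)
          qed
        qed
        show "AE x in R. norm (?f n x) \<le> 1" for n by (auto simp: infdist_nonneg)
      qed simp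
      then show ?thesis using C by (simp add: R(2) borel_closed)
    qed
    have "(LINT x|P. ?f n x) = (LINT x|Q. ?f n x)" for n
      by (rule char_fun_integral_eq[OF P Q eq]) (auto intro!: continuous_intros simp: infdist_nonneg)
    then show ?thesis using lim[OF P] lim[OF Q] LIMSEQ_unique by simp
  qed simp
  show ?thesis
  proof (rule measure_eqI_generator_eq[where E="Collect closed" and \<Omega>=UNIV and A="\<lambda>_. UNIV"])
    show "Int_stable (Collect closed :: 'a set set)" by (auto simp: Int_stable_def)
    show "emeasure P X = emeasure Q X" if "X \<in> Collect closed" for X
      using closed_eq that by (simp add: P.emeasure_eq_measure Q.emeasure_eq_measure)
    show "sets P = sigma_sets UNIV (Collect closed)" "sets Q = sigma_sets UNIV (Collect closed)"
      using P(2) Q(2) by (simp_all add: borel_eq_closed)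
  qed (auto simp: P.emeasure_eq_measure)
qed

section \<open>Laws of the random frequencies and phases\<close>

lemma borel_measurable_vec_lambda:
  fixes f :: "'i::finite \<Rightarrow> 'w \<Rightarrow> 'a::euclidean_space"
  assumes "\<And>i. f i \<in> borel_measurable M"
  shows "(\<lambda>x. \<chi> i. f i x) \<in> borel_measurable M"
  by (subst borel_measurable_euclidean_space)
    (use assms in \<open>auto simp: Basis_vec_def inner_axis\<close>)

lemma box_vec_eq:
  fixes l u :: "'a::euclidean_space ^ 'i"
  shows "x \<in> box l u \<longleftrightarrow> (\<forall>i. x $ i \<in> box (l $ i) (u $ i))"
  by (auto simp: mem_box Basis_vec_def inner_axis)

lemma prod_Basis_vec:
  fixes f :: "'a::euclidean_space ^ 'i \<Rightarrow> 'b::comm_monoid_mult"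
  shows "prod f Basis = (\<Prod>i\<in>UNIV. \<Prod>b\<in>Basis. f (axis i b))"
proof -
  have B: "(Basis :: ('a ^ 'i) set) = (\<lambda>(i, b). axis i b) ` (UNIV \<times> Basis)"
    by (auto simp: Basis_vec_def)
  have inj: "inj_on (\<lambda>(i, b). axis i b :: 'a ^ 'i) (UNIV \<times> Basis)"
    by (auto simp: inj_on_def axis_eq_axis)
  have "prod f Basis = prod (f \<circ> (\<lambda>(i, b). axis i b)) (UNIV \<times> Basis)"
    unfolding B by (rule prod.reindex[OF inj])
  then show ?thesis by (simp add: prod.cartesian_product case_prod_unfold o_def)
qed

text \<open>The labels are abstract so that the frequency constructors of \<open>source\<close> can
  serve as indices. Boxes determine Lebesgue measure, and a box of matrices pulls back to a product
  of boxes.\<close>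

lemma distr_PiM_lborel_vec_vec:
  fixes c :: "'k::finite \<Rightarrow> 'l::finite \<Rightarrow> 's"
  assumes c: "inj (\<lambda>(i, j). c i j)"
  shows "distr (PiM (range (\<lambda>(i, j). c i j)) (\<lambda>_. lborel)) borel (\<lambda>f. \<chi> i j. f (c i j)) =
    (lborel :: ('a::euclidean_space ^ 'l ^ 'k) measure)"
    (is "distr ?P borel ?v = _")
proof (rule lborel_eqI[symmetric])
  let ?A = "range (\<lambda>(i, j). c i j)"
  interpret product_sigma_finite "\<lambda>_::'s. lborel :: 'a measure" ..
  have mv: "?v \<in> borel_measurable ?P"
    by (intro borel_measurable_vec_lambda) (auto intro!: measurable_component_singleton[THEN measurable_compose])
  fix l u :: "'a ^ 'l ^ 'k" assume le: "\<And>b. b \<in> Basis \<Longrightarrow> l \<bullet> b \<le> u \<bullet> b"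
  have le': "l $ i $ j \<bullet> b \<le> u $ i $ j \<bullet> b" if "b \<in> Basis" for i j b
    using le[of "axis i (axis j b)"] that by (simp add: inner_axis)
  define B where "B s = (case inv (\<lambda>(i, j). c i j) s of (i, j) \<Rightarrow> box (l $ i $ j) (u $ i $ j))" for s
  have B: "B (c i j) = box (l $ i $ j) (u $ i $ j)" for i j
    using inv_f_f[OF c, of "(i, j)"] by (simp add: B_def)
  have "?v -` box l u \<inter> space ?P = PiE ?A B"
    by (auto simp: box_vec_eq B space_PiM PiE_iff) 
  then have "emeasure (distr ?P borel ?v) (box l u) = emeasure ?P (PiE ?A B)"
    using mv by (simp add: emeasure_distr)
  also have "\<dots> = (\<Prod>s\<in>?A. emeasure lborel (B s))"
    by (rule emeasure_PiM) (auto simp: B)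
  also have "\<dots> = (\<Prod>(i, j)\<in>UNIV. emeasure lborel (box (l $ i $ j) (u $ i $ j)))"
    by (subst prod.reindex[OF c]) (auto intro!: prod.cong simp: B)
  also have "\<dots> = (\<Prod>(i, j)\<in>UNIV. ennreal (\<Prod>b\<in>Basis. (u $ i $ j - l $ i $ j) \<bullet> b))"
    using le' by (intro prod.cong) (auto simp: emeasure_lborel_box_eq)
  also have "\<dots> = ennreal (\<Prod>(i, j)\<in>UNIV. \<Prod>b\<in>Basis. (u $ i $ j - l $ i $ j) \<bullet> b)"
    using le' by (subst prod_ennreal[symmetric]) (auto intro!: prod_nonneg simp: inner_diff_left case_prod_unfold)
  also have "(\<Prod>(i, j)\<in>UNIV. \<Prod>b\<in>Basis. (u $ i $ j - l $ i $ j) \<bullet> b) = prod ((\<bullet>) (u - l)) Basis"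
  proof -
    have "(\<Prod>(i, j)\<in>UNIV. h i j) = (\<Prod>i\<in>UNIV. \<Prod>j\<in>UNIV. h i j)" for h :: "'k \<Rightarrow> 'l \<Rightarrow> real"
      by (simp add: prod.cartesian_product)
    then show ?thesis by (simp add: prod_Basis_vec inner_axis)
  qed
  finally show "emeasure (distr ?P borel ?v) (box l u) = ennreal (prod ((\<bullet>) (u - l)) Basis)" .
qed simp

text \<open>Turns the product of the Gaussian laws into a density over a product of Lebesgue
  measures; it is enough to compare rectangles.\<close>

lemma PiM_density:
  assumes M: "product_sigma_finite M" and D: "product_sigma_finite (\<lambda>i. density (M i) (f i))"
    and I: "finite I" and f: "\<And>i. f i \<in> borel_measurable (M i)"
  shows "PiM I (\<lambda>i. density (M i) (f i)) = density (PiM I M) (\<lambda>x. \<Prod>i\<in>I. f i (x i))"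
proof (rule product_sigma_finite.PiM_eqI[OF D I, symmetric])
  interpret M: product_sigma_finite M by fact
  show "sets (density (PiM I M) (\<lambda>x. \<Prod>i\<in>I. f i (x i))) = sets (PiM I (\<lambda>i. density (M i) (f i)))"
    by (simp only: sets_density) (rule sets_PiM_cong[OF refl], simp)
  fix A assume "\<And>i. i \<in> I \<Longrightarrow> A i \<in> sets (density (M i) (f i))"
  then have A: "\<And>i. i \<in> I \<Longrightarrow> A i \<in> sets (M i)" by simp
  have mp: "(\<lambda>x. \<Prod>i\<in>I. f i (x i)) \<in> borel_measurable (PiM I M)"
    using f by (auto intro!: borel_measurable_prod_ennreal measurable_compose[OF measurable_component_singleton])
  have "emeasure (density (PiM I M) (\<lambda>x. \<Prod>i\<in>I. f i (x i))) (PiE I A) =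
      (\<integral>\<^sup>+x. (\<Prod>i\<in>I. f i (x i)) * indicator (PiE I A) x \<partial>PiM I M)"
    using A I mp by (intro emeasure_density) auto
  also have "\<dots> = (\<integral>\<^sup>+x. (\<Prod>i\<in>I. f i (x i) * indicator (A i) (x i)) \<partial>PiM I M)"
  proof (rule nn_integral_cong)
    fix x assume x: "x \<in> space (PiM I M)"
    have "indicator (PiE I A) x = (\<Prod>i\<in>I. indicator (A i) (x i) :: ennreal)"
    proof (cases "\<forall>i\<in>I. x i \<in> A i")
      case True
      then have "x \<in> PiE I A" using x by (auto simp: space_PiM PiE_iff)
      then show ?thesis using True by simp
    next
      case False
      then have "x \<notin> PiE I A" by auto
      moreover have "(\<Prod>i\<in>I. indicator (A i) (x i) :: ennreal) = 0"
        using False I by (auto simp: prod_zero_iff indicator_def)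
      ultimately show ?thesis by simp
    qed
    then show "(\<Prod>i\<in>I. f i (x i)) * indicator (PiE I A) x = (\<Prod>i\<in>I. f i (x i) * indicator (A i) (x i))"
      by (simp add: prod.distrib)
  qed
  also have "\<dots> = (\<Prod>i\<in>I. \<integral>\<^sup>+y. f i y * indicator (A i) y \<partial>M i)"
    using A f by (intro M.product_nn_integral_prod[OF I]) auto
  also have "\<dots> = (\<Prod>i\<in>I. emeasure (density (M i) (f i)) (A i))"
    using A f by (intro prod.cong refl) (simp add: emeasure_density)
  finally show "emeasure (density (PiM I M) (\<lambda>x. \<Prod>i\<in>I. f i (x i))) (PiE I A) =
    (\<Prod>i\<in>I. emeasure (density (M i) (f i)) (A i))" .
qed

text \<open>Phases enter as constant vectors because \<^const>\<open>prob_space.indep_vars\<close> requires a common type.\<close>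

definition source_var ::
  "('k \<Rightarrow> 'lag \<Rightarrow> 'w \<Rightarrow> real ^ 'd) \<Rightarrow> ('k \<Rightarrow> 'w \<Rightarrow> real) \<Rightarrow> ('k, 'lag) source \<Rightarrow> 'w \<Rightarrow> real ^ 'd" where
  "source_var Om al src w = (case src of Noise \<Rightarrow> 0 | Frequency i j \<Rightarrow> Om i j w | Phase i \<Rightarrow> (\<chi> _. al i w))"

lemma source_var_simps:
  "source_var Om al Noise = (\<lambda>w. 0)"
  "source_var Om al (Frequency i j) = Om i j"
  "source_var Om al (Phase i) = (\<lambda>w. \<chi> _. al i w)"
  by (simp_all add: source_var_def fun_eq_iff)

text \<open>Independence passes to smaller \<sigma>-algebras: the constant vector of a phase
  generates nothing beyond the phase, and the constant that replaces the noise generates only the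
  trivial events.\<close>

lemma indep_vars_source_var:
  fixes Om :: "'k \<Rightarrow> 'lag \<Rightarrow> 'w \<Rightarrow> real ^ 'd"
  assumes M: "prob_space M" and features: "rff_parameters M e e' s Om al"
  shows "prob_space.indep_vars M (\<lambda>_. borel) (source_var Om al) UNIV"
proof -
  interpret prob_space M by fact
  have Om: "\<And>i j. Om i j \<in> borel_measurable M" and al: "\<And>i. al i \<in> borel_measurable M"
    using features by (auto simp: rff_parameters_def)
  have mvec: "(\<lambda>t. \<chi> _ :: 'd. t) \<in> borel_measurable (borel :: real measure)"
    by (rule borel_measurable_vec_lambda) simp
  have "source_var Om al src \<in> borel_measurable M" for src
    by (cases src; simp add: source_var_simps Om al borel_measurable_vec_lambda)
  moreover have "indep_sets (\<lambda>src. {source_var Om al src -` A \<inter> space M |A. A \<in> sets borel}) UNIV"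
  proof (rule indep_sets_mono_sets)
    show "indep_sets (\<lambda>src. case src of
          Noise \<Rightarrow> sets (vimage_algebra (space M)
              (\<lambda>w. (\<lambda>i. e i w, \<lambda>r\<in>{0..s}. \<lambda>i. e' r i w))
              (biseq_space \<Otimes>\<^sub>M PiM {0..s} (\<lambda>_. biseq_space)))
        | Frequency i j \<Rightarrow> sets (vimage_algebra (space M) (Om i j) borel)
        | Phase i \<Rightarrow> sets (vimage_algebra (space M) (al i) borel)) UNIV"
      using features by (simp add: rff_parameters_def)
    fix src :: "('k, 'lag) source"
    show "{source_var Om al src -` A \<inter> space M |A. A \<in> sets borel} \<subseteq> (case src of
          Noise \<Rightarrow> sets (vimage_algebra (space M)
              (\<lambda>w. (\<lambda>i. e i w, \<lambda>r\<in>{0..s}. \<lambda>i. e' r i w))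
              (biseq_space \<Otimes>\<^sub>M PiM {0..s} (\<lambda>_. biseq_space)))
        | Frequency i j \<Rightarrow> sets (vimage_algebra (space M) (Om i j) borel)
        | Phase i \<Rightarrow> sets (vimage_algebra (space M) (al i) borel))"
    proof (cases src)
      case Noise
      have "source_var Om al src -` A \<inter> space M \<in> sets (vimage_algebra (space M) h N)"
        for A and h :: "'w \<Rightarrow> 'v" and N
        using sets.top[of "vimage_algebra (space M) h N"]
        by (cases "0 \<in> A") (simp_all add: source_var_simps Noise)
      then show ?thesis unfolding Noise by auto
    next
      case (Frequency i j)
      then show ?thesis by (auto simp: source_var_simps in_vimage_algebra)
    next
      case (Phase i)
      have "source_var Om al src -` A \<inter> space M \<in> sets (vimage_algebra (space M) (al i) borel)"
        if "A \<in> sets borel" for A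
      proof -
        have "(\<lambda>t. \<chi> _. t) -` A \<in> sets (borel :: real measure)"
          using measurable_sets[OF mvec that] by simp
        then have "al i -` ((\<lambda>t. \<chi> _. t) -` A) \<inter> space M \<in> sets (vimage_algebra (space M) (al i) borel)"
          by (rule in_vimage_algebra)
        then show ?thesis by (simp add: source_var_def Phase vimage_def)
      qed
      then show ?thesis unfolding Phase by auto
    qed
  qed
  ultimately show ?thesis unfolding indep_vars_def2 by auto
qed

text \<open>By independence the joint law of all frequencies is a product of Gaussians and so has a
  Lebesgue density.\<close>

lemma frequencies_absolutely_continuous:
  fixes Om :: "'k::finite \<Rightarrow> 'lag::finite \<Rightarrow> 'w \<Rightarrow> real ^ 'd"
  assumes M: "prob_space M" and features: "rff_parameters M e e' s Om al"
    and N: "N \<in> null_sets lborel"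
  shows "AE w in M. (\<chi> i j. Om i j w) \<notin> N"
proof -
  interpret prob_space M by fact
  let ?c = "Frequency :: 'k \<Rightarrow> 'lag \<Rightarrow> ('k, 'lag) source"
  let ?A = "range (\<lambda>(i, j). ?c i j)"
  let ?Z = "source_var Om al"
  let ?v = "\<lambda>f :: ('k, 'lag) source \<Rightarrow> real ^ 'd. \<chi> i j. f (?c i j)"
  let ?g = "\<lambda>x :: real ^ 'd. ennreal (\<Prod>b\<in>Basis. std_normal_density (x \<bullet> b))"
  have Om: "\<And>i j. Om i j \<in> borel_measurable M" "\<And>i j. distr M borel (Om i j) = density lborel ?g"
    using features by (auto simp: rff_parameters_def std_gaussian_def)
  have inj: "inj (\<lambda>(i, j). ?c i j)" by (auto simp: inj_def)
  have mem: "?c i j \<in> ?A" for i j by (rule image_eqI[of _ _ "(i, j)"]) auto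
  have Zm: "?Z src \<in> borel_measurable M" for src
    using indep_vars_source_var[OF M features] by (auto simp: indep_vars_def2)
  have Zc: "?Z (?c i j) = Om i j" for i j by (simp add: source_var_def fun_eq_iff)
  \<comment> \<open>That the Gaussian density has mass one is read off from its being the law of a
    frequency; the indices are arbitrary.\<close>
  have "prob_space (density lborel ?g)"
    using prob_space_distr[OF Om(1), of undefined undefined] Om(2) by simp
  then have ps: "product_sigma_finite (\<lambda>_::('k, 'lag) source. density lborel ?g)"
    by (simp add: product_sigma_finite_def prob_space_imp_sigma_finite)
  have mg: "?g \<in> borel_measurable lborel" by measurable
  have "distr M (PiM ?A (\<lambda>_. borel)) (\<lambda>w. \<lambda>src\<in>?A. ?Z src w) = PiM ?A (\<lambda>src. distr M borel (?Z src))"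
    by (rule indep_vars_iff_distr_eq_PiM[THEN iffD1, OF _ Zm
        indep_vars_subset[OF indep_vars_source_var[OF M features] subset_UNIV]]) auto
  also have "\<dots> = PiM ?A (\<lambda>_. density lborel ?g)"
    by (rule PiM_cong) (auto simp: Zc Om)
  also have "\<dots> = density (PiM ?A (\<lambda>_. lborel)) (\<lambda>x. \<Prod>src\<in>?A. ?g (x src))"
    by (rule PiM_density[OF _ ps]) (auto simp: product_sigma_finite_def sigma_finite_lborel)
  finally have law: "distr M (PiM ?A (\<lambda>_. borel)) (\<lambda>w. \<lambda>src\<in>?A. ?Z src w) =
    density (PiM ?A (\<lambda>_. lborel)) (\<lambda>x. \<Prod>src\<in>?A. ?g (x src))" .
  have mv: "?v \<in> borel_measurable (PiM ?A (\<lambda>_. lborel))"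
    by (intro borel_measurable_vec_lambda) (auto intro!: measurable_component_singleton[THEN measurable_compose])
  have "AE x in (lborel :: (real ^ 'd ^ 'lag ^ 'k) measure). x \<notin> N" using N by (rule AE_not_in)
  then have "AE x in distr (PiM ?A (\<lambda>_. lborel)) borel ?v. x \<notin> N"
    by (simp only: distr_PiM_lborel_vec_vec[OF inj])
  then have "AE f in PiM ?A (\<lambda>_. lborel). ?v f \<notin> N" using mv by (rule AE_distrD[rotated])
  then have "AE f in density (PiM ?A (\<lambda>_. lborel)) (\<lambda>x. \<Prod>src\<in>?A. ?g (x src)). ?v f \<notin> N"
    by (subst AE_density) (auto intro!: borel_measurable_prod_ennreal measurable_compose[OF _ mg] measurable_component_singleton)
  then have "AE w in M. ?v (\<lambda>src\<in>?A. ?Z src w) \<notin> N"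
    unfolding law[symmetric] by (rule AE_distrD[rotated]) (use Zm in \<open>auto intro!: measurable_restrict\<close>)
  moreover have "?v (\<lambda>src\<in>?A. ?Z src w) = (\<chi> i j. Om i j w)" for w
    by (simp add: vec_eq_iff Zc mem)
  ultimately show ?thesis by simp
qed

text \<open>On (-pi, pi) the sine and the cosine together have only three zeros.\<close>

lemma AE_phase_generic:
  assumes al: "al \<in> borel_measurable M" "distr M borel al = uniform_measure lborel {-pi<..<pi}"
  shows "AE w in M. sin (al w) \<noteq> 0 \<and> cos (al w) \<noteq> (0::real)"
proof -
  have nz: "sin t \<noteq> 0 \<and> cos t \<noteq> 0" if "- pi < t" "t < pi" "t \<notin> {0, pi / 2, - (pi / 2)}" for t :: real
  proof
    show "sin t \<noteq> 0" using sin_eq_0_pi[of t] that by auto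
    have "t \<noteq> pi / 2" "t \<noteq> - (pi / 2)" using that by auto
    then consider "t < - (pi / 2)" | "- (pi / 2) < t" "t < pi / 2" | "pi / 2 < t" by (meson linorder_neqE)
    then show "cos t \<noteq> 0"
    proof cases
      case 1 then show ?thesis using cos_gt_zero_pi[of "t + pi"] that by simp
    next
      case 2 then show ?thesis using cos_gt_zero_pi[of t] by simp
    next
      case 3 then show ?thesis using cos_gt_zero_pi[of "t - pi"] that by (simp add: cos_diff)
    qed
  qed
  have "AE t in lborel. t \<notin> {0, pi / 2, - (pi / 2)}"
    by (intro AE_not_in) (simp add: finite_imp_null_set_lborel)
  then have "AE t in uniform_measure lborel {-pi<..<pi}. sin t \<noteq> 0 \<and> cos t \<noteq> 0"
  proof (intro AE_uniform_measureI)
    assume "AE t in lborel. t \<notin> {0, pi / 2, - (pi / 2)}"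
    then show "AE t in lborel. t \<in> {-pi<..<pi} \<longrightarrow> sin t \<noteq> 0 \<and> cos t \<noteq> 0"
      by (rule eventually_mono) (intro impI nz, auto)
  qed simp
  then have "AE t in distr M borel al. sin t \<noteq> 0 \<and> cos t \<noteq> 0" unfolding al(2) .
  then show ?thesis using al(1) by (rule AE_distrD[rotated])
qed


text \<open>Phases and frequencies form two independent blocks, so Fubini for the product of their
  laws reduces the claim to sections at fixed phases. Almost surely the phases are generic; the
  section is then negligible, and absolute continuity makes it a null event for the
  frequencies.\<close>

lemma AE_phases_frequencies:
  fixes Om :: "'k::finite \<Rightarrow> 'lag::finite \<Rightarrow> 'w \<Rightarrow> real ^ 'd" and al :: "'k \<Rightarrow> 'w \<Rightarrow> real"
  assumes M: "prob_space M" and features: "rff_parameters M e e' s Om al"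
    and B: "B \<in> sets (borel \<Otimes>\<^sub>M borel)"
    and neg: "\<And>\<alpha>. (\<And>i. sin (\<alpha> $ i) \<noteq> 0 \<and> cos (\<alpha> $ i) \<noteq> 0) \<Longrightarrow> negligible {\<Omega>. (\<alpha>, \<Omega>) \<in> B}"
  shows "AE w in M. ((\<chi> i. al i w), (\<chi> i j. Om i j w)) \<notin> B"
proof -
  interpret prob_space M by fact
  let ?c = "Frequency :: 'k \<Rightarrow> 'lag \<Rightarrow> ('k, 'lag) source"
  let ?A = "range (\<lambda>(i, j). ?c i j)" and ?B = "range Phase :: ('k, 'lag) source set"
  let ?Z = "source_var Om al"
  let ?v = "\<lambda>f :: ('k, 'lag) source \<Rightarrow> real ^ 'd. \<chi> i j. f (?c i j)"
  \<comment> \<open>Phases are stored as constant vectors, so any coordinate returns them, here the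
    one at \<open>undefined\<close>.\<close>
  let ?u = "\<lambda>f :: ('k, 'lag) source \<Rightarrow> real ^ 'd. \<chi> i. f (Phase i) $ undefined"
  let ?ZA = "\<lambda>w. \<lambda>src\<in>?A. ?Z src w" and ?ZB = "\<lambda>w. \<lambda>src\<in>?B. ?Z src w"
  let ?MA = "PiM ?A (\<lambda>_. borel) :: (('k, 'lag) source \<Rightarrow> real ^ 'd) measure"
  let ?MB = "PiM ?B (\<lambda>_. borel) :: (('k, 'lag) source \<Rightarrow> real ^ 'd) measure"
  have mem: "?c i j \<in> ?A" for i j by (rule image_eqI[of _ _ "(i, j)"]) auto
  have v: "?v (?ZA w) = (\<chi> i j. Om i j w)" and u: "?u (?ZB w) = (\<chi> i. al i w)" for w
    by (simp_all add: vec_eq_iff source_var_simps mem)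
  have indep: "indep_var ?MB ?ZB ?MA ?ZA"
    by (rule indep_var_restrict[OF indep_vars_source_var[OF M features]]) auto
  then have mZ: "?ZB \<in> measurable M ?MB" "?ZA \<in> measurable M ?MA"
    by (rule indep_var_rv1, rule indep_var_rv2)
  have mv: "?v \<in> borel_measurable ?MA"
    by (intro borel_measurable_vec_lambda) (auto intro!: measurable_component_singleton[THEN measurable_compose])
  have mu: "?u \<in> borel_measurable ?MB"
    by (intro borel_measurable_vec_lambda measurable_compose[OF measurable_component_singleton]) auto
  have muv: "(\<lambda>p. (?u (fst p), ?v (snd p))) \<in> measurable (?MB \<Otimes>\<^sub>M ?MA) (borel \<Otimes>\<^sub>M borel)"
    by (intro measurable_Pair measurable_compose[OF measurable_fst mu] measurable_compose[OF measurable_snd mv])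
  have joint: "distr M ?MB ?ZB \<Otimes>\<^sub>M distr M ?MA ?ZA = distr M (?MB \<Otimes>\<^sub>M ?MA) (\<lambda>w. (?ZB w, ?ZA w))"
    using indep by (simp only: indep_var_distribution_eq)
  interpret pair_prob_space "distr M ?MB ?ZB" "distr M ?MA ?ZA"
    using mZ by (intro pair_prob_space.intro pair_sigma_finite.intro prob_space_imp_sigma_finite prob_space_distr)
  have sets: "sets (distr M ?MB ?ZB \<Otimes>\<^sub>M distr M ?MA ?ZA) = sets (?MB \<Otimes>\<^sub>M ?MA)"
    by (intro sets_pair_measure_cong) simp_all
  have "AE p in distr M ?MB ?ZB \<Otimes>\<^sub>M distr M ?MA ?ZA. (?u (fst p), ?v (snd p)) \<notin> B"
  proof (rule AE_pair_measure)
    have "(\<lambda>p. (?u (fst p), ?v (snd p))) -` B \<inter> space (?MB \<Otimes>\<^sub>M ?MA) \<in> sets (?MB \<Otimes>\<^sub>M ?MA)"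
      by (rule measurable_sets[OF muv B])
    then have "space (?MB \<Otimes>\<^sub>M ?MA) - ((\<lambda>p. (?u (fst p), ?v (snd p))) -` B \<inter> space (?MB \<Otimes>\<^sub>M ?MA)) \<in> sets (?MB \<Otimes>\<^sub>M ?MA)"
      by (rule sets.compl_sets)
    also have "space (?MB \<Otimes>\<^sub>M ?MA) - ((\<lambda>p. (?u (fst p), ?v (snd p))) -` B \<inter> space (?MB \<Otimes>\<^sub>M ?MA)) =
      {p \<in> space (distr M ?MB ?ZB \<Otimes>\<^sub>M distr M ?MA ?ZA). (?u (fst p), ?v (snd p)) \<notin> B}"
      unfolding sets_eq_imp_space_eq[OF sets] by auto
    finally show "{p \<in> space (distr M ?MB ?ZB \<Otimes>\<^sub>M distr M ?MA ?ZA). (?u (fst p), ?v (snd p)) \<notin> B}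
      \<in> sets (distr M ?MB ?ZB \<Otimes>\<^sub>M distr M ?MA ?ZA)" unfolding sets .
    have "AE w in M. sin (al i w) \<noteq> 0 \<and> cos (al i w) \<noteq> 0" for i
      using features by (intro AE_phase_generic) (auto simp: rff_parameters_def)
    then have "AE w in M. \<forall>i. sin (al i w) \<noteq> 0 \<and> cos (al i w) \<noteq> 0"
      by (subst AE_all_countable) blast
    then have m1: "AE w in M. \<forall>i. sin (?u (?ZB w) $ i) \<noteq> 0 \<and> cos (?u (?ZB w) $ i) \<noteq> 0" by (simp only: u vec_lambda_beta)
    have m2: "{f \<in> space ?MB. \<forall>i. sin (?u f $ i) \<noteq> 0 \<and> cos (?u f $ i) \<noteq> 0} \<in> sets ?MB"
      using mu by measurable
    have "AE f in distr M ?MB ?ZB. \<forall>i. sin (?u f $ i) \<noteq> 0 \<and> cos (?u f $ i) \<noteq> 0"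
      by (rule AE_distr_iff[OF mZ(1) m2, THEN iffD2, OF m1])
    then show "AE f in distr M ?MB ?ZB. AE h in distr M ?MA ?ZA. (?u (fst (f, h)), ?v (snd (f, h))) \<notin> B"
    proof (rule eventually_mono)
      fix f assume "\<forall>i. sin (?u f $ i) \<noteq> 0 \<and> cos (?u f $ i) \<noteq> 0"
      then have n: "negligible {\<Omega>. (?u f, \<Omega>) \<in> B}" by (intro neg) auto
      have s: "{\<Omega>. (?u f, \<Omega>) \<in> B} \<in> sets borel"
        using sets_Pair1[OF B, of "?u f"] by (simp add: vimage_def)
      then have "{\<Omega>. (?u f, \<Omega>) \<in> B} \<in> null_sets lborel"
        using n by (simp add: negligible_iff_null_sets null_sets_completion_iff)
      from frequencies_absolutely_continuous[OF M features this]
      have n1: "AE w in M. (?u f, ?v (?ZA w)) \<notin> B" unfolding v by simp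
      have n2: "{h \<in> space ?MA. (?u f, ?v h) \<notin> B} \<in> sets ?MA"
      proof -
        have "?v -` (- {\<Omega>. (?u f, \<Omega>) \<in> B}) \<inter> space ?MA \<in> sets ?MA"
          by (rule measurable_sets[OF mv]) (use s in auto)
        also have "?v -` (- {\<Omega>. (?u f, \<Omega>) \<in> B}) \<inter> space ?MA = {h \<in> space ?MA. (?u f, ?v h) \<notin> B}" by auto
        finally show ?thesis .
      qed
      have "AE h in distr M ?MA ?ZA. (?u f, ?v h) \<notin> B"
        by (rule AE_distr_iff[OF mZ(2) n2, THEN iffD2, OF n1])
      then show "AE h in distr M ?MA ?ZA. (?u (fst (f, h)), ?v (snd (f, h))) \<notin> B" by simp
    qed
  qed
  then have "AE p in distr M (?MB \<Otimes>\<^sub>M ?MA) (\<lambda>w. (?ZB w, ?ZA w)). (?u (fst p), ?v (snd p)) \<notin> B"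
    unfolding joint .
  then have "AE w in M. (?u (fst (?ZB w, ?ZA w)), ?v (snd (?ZB w, ?ZA w))) \<notin> B"
    by (rule AE_distrD[rotated]) (intro measurable_Pair mZ)
  then show ?thesis unfolding fst_conv snd_conv u v .
qed

section \<open>Measurability of the collision set\<close>

text \<open>Describes the collision set through countably many points, which avoids measurable selections
  from the random compact set \<open>K\<close>.\<close>

lemma zero_off_diagonal_iff:
  fixes K D :: "'q::metric_space set" and h :: "'q \<times> 'q \<Rightarrow> real"
  assumes K: "compact K" and h: "continuous_on UNIV h"
    and D: "\<And>x e. e > 0 \<Longrightarrow> \<exists>q\<in>D. dist x q < e"
  shows "(\<exists>z1\<in>K. \<exists>z2\<in>K. z1 \<noteq> z2 \<and> h (z1, z2) = 0) \<longleftrightarrow>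
    (\<exists>n. \<forall>m. \<exists>q1\<in>D. \<exists>q2\<in>D. dist q1 q2 > inverse (real (Suc n)) - 2 * inverse (real (Suc m)) \<and>
       K \<inter> ball q1 (inverse (real (Suc m))) \<noteq> {} \<and> K \<inter> ball q2 (inverse (real (Suc m))) \<noteq> {} \<and>
       \<bar>h (q1, q2)\<bar> < inverse (real (Suc m)))" (is "?L \<longleftrightarrow> ?R")
proof
  assume ?L
  then obtain z1 z2 where z: "z1 \<in> K" "z2 \<in> K" "z1 \<noteq> z2" "h (z1, z2) = 0" by blast
  \<comment> \<open>Since n is chosen before m, the gap 1/(n+1) survives the limit in m and keeps
    the limit points distinct. Moving both points by less than 1/(m+1) costs 2/(m+1).\<close>
  then obtain n where n: "inverse (real (Suc n)) < dist z1 z2"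
    using reals_Archimedean[of "dist z1 z2"] by auto
  show ?R
  proof (intro exI[of _ n] allI)
    fix m
    let ?e = "inverse (real (Suc m))"
    have e: "?e > 0" by simp
    have "isCont h (z1, z2)" using h by (simp add: continuous_on_eq_continuous_at)
    then obtain d where d: "d > 0" "\<And>y. dist y (z1, z2) < d \<Longrightarrow> \<bar>h y - h (z1, z2)\<bar> < ?e"
      using e unfolding continuous_at_eps_delta dist_real_def by blast
    define r where "r = min ?e (d / 2)"
    have r: "r > 0" "r \<le> ?e" "r \<le> d / 2" using d(1) e by (auto simp: r_def)
    obtain q1 where q1: "q1 \<in> D" "dist z1 q1 < r" using D[OF r(1)] by blast
    obtain q2 where q2: "q2 \<in> D" "dist z2 q2 < r" using D[OF r(1)] by blast
    have "dist (q1, q2) (z1, z2) \<le> dist q1 z1 + dist q2 z2"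
      unfolding dist_Pair_Pair by (rule sqrt_sum_squares_le_sum) auto
    also have "\<dots> < d" using q1 q2 r by (simp add: dist_commute)
    finally have "\<bar>h (q1, q2)\<bar> < ?e" using d(2)[of "(q1, q2)"] z(4) by simp
    moreover have "dist z1 z2 \<le> dist z1 q1 + dist q1 q2 + dist z2 q2"
      by (metis add.commute add.left_commute dist_commute dist_triangle order_trans add_left_mono)
    then have "dist q1 q2 > inverse (real (Suc n)) - 2 * ?e" using n q1 q2 r by linarith
    moreover have "z1 \<in> K \<inter> ball q1 ?e" "z2 \<in> K \<inter> ball q2 ?e" using z q1 q2 r by (auto simp: dist_commute)
    ultimately show "\<exists>q1\<in>D. \<exists>q2\<in>D. dist q1 q2 > inverse (real (Suc n)) - 2 * ?e \<and>
       K \<inter> ball q1 ?e \<noteq> {} \<and> K \<inter> ball q2 ?e \<noteq> {} \<and> \<bar>h (q1, q2)\<bar> < ?e"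
      using q1(1) q2(1) by blast
  qed
next
  assume ?R
  then obtain n where "\<forall>m. \<exists>q1 q2. dist q1 q2 > inverse (real (Suc n)) - 2 * inverse (real (Suc m)) \<and>
       K \<inter> ball q1 (inverse (real (Suc m))) \<noteq> {} \<and> K \<inter> ball q2 (inverse (real (Suc m))) \<noteq> {} \<and>
       \<bar>h (q1, q2)\<bar> < inverse (real (Suc m))" by blast
  then obtain q1 q2 where q: "\<And>m. dist (q1 m) (q2 m) > inverse (real (Suc n)) - 2 * inverse (real (Suc m))"
      "\<And>m. K \<inter> ball (q1 m) (inverse (real (Suc m))) \<noteq> {}" "\<And>m. K \<inter> ball (q2 m) (inverse (real (Suc m))) \<noteq> {}"
      "\<And>m. \<bar>h (q1 m, q2 m)\<bar> < inverse (real (Suc m))" by metis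
  have "\<exists>x. x \<in> K \<and> dist (q1 m) x < inverse (real (Suc m))" for m using q(2)[of m] by auto
  then obtain x1 where x1: "\<And>m. x1 m \<in> K" "\<And>m. dist (q1 m) (x1 m) < inverse (real (Suc m))" by metis
  have "\<exists>x. x \<in> K \<and> dist (q2 m) x < inverse (real (Suc m))" for m using q(3)[of m] by auto
  then obtain x2 where x2: "\<And>m. x2 m \<in> K" "\<And>m. dist (q2 m) (x2 m) < inverse (real (Suc m))" by metis
  \<comment> \<open>The points of D may lie outside K; their neighbours \<open>x1 m\<close>,
    \<open>x2 m\<close> in K have a convergent subsequence, and the points of D follow along
    it.\<close>
  have "compact (K \<times> K)" using K by (intro compact_Times)
  then obtain l r where l: "l \<in> K \<times> K" "strict_mono (r :: nat \<Rightarrow> nat)" "((\<lambda>m. (x1 m, x2 m)) \<circ> r) \<longlonglongrightarrow> l"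
    using x1(1) x2(1) unfolding compact_def by (metis (no_types, lifting) mem_Sigma_iff)
  obtain z1 z2 where lz: "l = (z1, z2)" by force
  have x1l: "(\<lambda>m. x1 (r m)) \<longlonglongrightarrow> z1" and x2l: "(\<lambda>m. x2 (r m)) \<longlonglongrightarrow> z2"
    using tendsto_fst[OF l(3)] tendsto_snd[OF l(3)] by (simp_all add: lz o_def)
  have inv: "(\<lambda>m. inverse (real (Suc (r m)))) \<longlonglongrightarrow> 0"
    using LIMSEQ_subseq_LIMSEQ[OF LIMSEQ_inverse_real_of_nat l(2)] by (simp add: o_def)
  have close: "(\<lambda>m. y (r m)) \<longlonglongrightarrow> z"
    if x: "(\<lambda>m. x (r m)) \<longlonglongrightarrow> z" and yx: "\<And>m. dist (y m) (x m) < inverse (real (Suc m))" for x y :: "nat \<Rightarrow> 'q" and z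
  proof (rule metric_tendsto_imp_tendsto)
    have "(\<lambda>m. dist (x (r m)) z + inverse (real (Suc (r m)))) \<longlonglongrightarrow> dist z z + 0"
      by (intro tendsto_add tendsto_dist x inv tendsto_const)
    then show "(\<lambda>m. dist (x (r m)) z + inverse (real (Suc (r m)))) \<longlonglongrightarrow> 0" by simp
    show "\<forall>\<^sub>F m in sequentially. dist (y (r m)) z \<le> dist (dist (x (r m)) z + inverse (real (Suc (r m)))) 0"
    proof (intro always_eventually allI)
      fix m
      have "dist (y (r m)) z \<le> dist (y (r m)) (x (r m)) + dist (x (r m)) z" by (rule dist_triangle)
      then show "dist (y (r m)) z \<le> dist (dist (x (r m)) z + inverse (real (Suc (r m)))) 0"
        using yx[of "r m"] by (simp add: dist_real_def)
    qed
  qed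
  have q1l: "(\<lambda>m. q1 (r m)) \<longlonglongrightarrow> z1" by (rule close[OF x1l x1(2)])
  have q2l: "(\<lambda>m. q2 (r m)) \<longlonglongrightarrow> z2" by (rule close[OF x2l x2(2)])
  have "inverse (real (Suc n)) - 2 * 0 \<le> dist z1 z2"
    by (rule LIMSEQ_le[OF tendsto_diff[OF tendsto_const tendsto_mult[OF tendsto_const inv]] tendsto_dist[OF q1l q2l]])
      (use q(1) less_imp_le in blast)
  then have "dist z1 z2 > 0" by (smt (verit) inverse_positive_iff_positive of_nat_0_less_iff zero_less_Suc)
  moreover have "h (z1, z2) = 0"
  proof -
    have "isCont h (z1, z2)" using h by (simp add: continuous_on_eq_continuous_at)
    then have "(\<lambda>m. h (q1 (r m), q2 (r m))) \<longlonglongrightarrow> h (z1, z2)"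
      by (rule isCont_tendsto_compose) (intro tendsto_Pair q1l q2l)
    moreover have "(\<lambda>m. h (q1 (r m), q2 (r m))) \<longlonglongrightarrow> 0"
      by (rule Lim_null_comparison[OF always_eventually inv]) (use q(4) less_imp_le in auto)
    ultimately show ?thesis by (rule LIMSEQ_unique)
  qed
  ultimately show ?L using l(1) lz by auto
qed

text \<open>The quantifiers over the uncountable \<open>K u\<close> become countable unions and
  intersections over a dense set, whose points may lie outside \<open>K u\<close>; hence the
  continuity of h on the whole space. Weak measurability takes care of the conditions that
  \<open>K u\<close> meets a ball.\<close>

lemma measurable_zero_off_diagonal:
  fixes K :: "real \<Rightarrow> 'q::euclidean_space set" and h :: "real \<Rightarrow> 'q \<Rightarrow> 'q \<Rightarrow> 'b::euclidean_space \<Rightarrow> real"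
  assumes K: "\<And>u. u \<in> {0..1} \<Longrightarrow> compact (K u)"
    and meas: "\<And>U. open U \<Longrightarrow> {u \<in> {0..1}. K u \<inter> U \<noteq> {}} \<in> sets borel"
    and cont: "\<And>u v. u \<in> {0..1} \<Longrightarrow> continuous_on UNIV (\<lambda>(z1, z2). h u z1 z2 v)"
    and hm: "\<And>z1 z2. (\<lambda>(u, v). h u z1 z2 v) \<in> borel_measurable (restrict_space borel ({0..1} \<times> UNIV))"
  shows "{(u, v). u \<in> {0..1} \<and> (\<exists>z1\<in>K u. \<exists>z2\<in>K u. z1 \<noteq> z2 \<and> h u z1 z2 v = 0)} \<in> sets borel"
proof -
  obtain D :: "'q set" where D: "countable D" "\<And>X. open X \<Longrightarrow> X \<noteq> {} \<Longrightarrow> \<exists>d\<in>D. d \<in> X"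
    by (rule countable_dense_setE) blast
  have D': "\<exists>q\<in>D. dist x q < e" if "e > 0" for x e
    using D(2)[of "ball x e"] that by auto
  let ?P = "\<lambda>n m q1 q2 u v. dist q1 q2 > inverse (real (Suc n)) - 2 * inverse (real (Suc m)) \<and>
       K u \<inter> ball q1 (inverse (real (Suc m))) \<noteq> {} \<and> K u \<inter> ball q2 (inverse (real (Suc m))) \<noteq> {} \<and>
       \<bar>h u q1 q2 v\<bar> < inverse (real (Suc m))"
  have eq: "{(u, v). u \<in> {0..1} \<and> (\<exists>z1\<in>K u. \<exists>z2\<in>K u. z1 \<noteq> z2 \<and> h u z1 z2 v = 0)} =
    (\<Union>n. \<Inter>m. \<Union>q1\<in>D. \<Union>q2\<in>D. {(u, v). u \<in> {0..1} \<and> ?P n m q1 q2 u v})" (is "?S = ?T")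
  proof (rule set_eqI, clarify)
    fix u v
    show "(u, v) \<in> ?S \<longleftrightarrow> (u, v) \<in> ?T"
    proof (cases "u \<in> {0..1}")
      case True
      have "(u, v) \<in> ?S \<longleftrightarrow> (\<exists>n. \<forall>m. \<exists>q1\<in>D. \<exists>q2\<in>D. ?P n m q1 q2 u v)"
        using zero_off_diagonal_iff[OF K[OF True] cont[OF True, of v] D'] True by simp
      also have "\<dots> \<longleftrightarrow> (u, v) \<in> ?T" using True by simp
      finally show ?thesis .
    next
      case False
      then show ?thesis by auto
    qed
  qed
  have cyl: "A \<times> UNIV \<in> sets (borel :: (real \<times> 'b) measure)" if "A \<in> sets borel" for A :: "real set"
    unfolding borel_prod[symmetric] using that by (intro pair_measureI) auto
  have P: "{(u, v). u \<in> {0..1} \<and> ?P n m q1 q2 u v} \<in> sets borel" for n m q1 q2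
  proof -
    let ?e = "inverse (real (Suc m))"
    let ?H = "{p \<in> {0..1} \<times> UNIV. \<bar>(\<lambda>(u, v). h u q1 q2 v) p\<bar> < ?e}"
    have "{p \<in> space (restrict_space borel ({0..1} \<times> UNIV)). \<bar>(\<lambda>(u, v). h u q1 q2 v) p\<bar> < ?e}
        \<in> sets (restrict_space borel ({0..1} \<times> UNIV))"
      using hm[of q1 q2] by (intro borel_measurable_less borel_measurable_abs borel_measurable_const)
    then have "?H \<in> sets (restrict_space borel ({0..1} \<times> UNIV))"
      by (simp add: space_restrict_space)
    then have H: "?H \<in> sets borel"
      using cyl[of "{0..1}"] by (subst (asm) sets_restrict_space_iff) auto
    have "(if dist q1 q2 > inverse (real (Suc n)) - 2 * ?e then
        {u \<in> {0..1}. K u \<inter> ball q1 ?e \<noteq> {}} \<times> UNIV \<inter> {u \<in> {0..1}. K u \<inter> ball q2 ?e \<noteq> {}} \<times> UNIV \<inter> ?H else {}) \<in> sets borel"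
      using H cyl[OF meas[OF open_ball]] by (auto intro: sets.Int)
    also have "(if dist q1 q2 > inverse (real (Suc n)) - 2 * ?e then
        {u \<in> {0..1}. K u \<inter> ball q1 ?e \<noteq> {}} \<times> UNIV \<inter> {u \<in> {0..1}. K u \<inter> ball q2 ?e \<noteq> {}} \<times> UNIV \<inter> ?H else {}) =
      {(u, v). u \<in> {0..1} \<and> ?P n m q1 q2 u v}"
      by auto
    finally show ?thesis .
  qed
  show ?thesis unfolding eq
    by (rule sets.countable_UN'' sets.countable_INT'' P D(1) countableI_type | simp)+
qed

section \<open>Injectivity of the feature moments\<close>

lemma char_fun_uminus:
  assumes "finite_measure P" "sets P = sets borel"
  shows "char_fun P (- \<omega>) = cnj (char_fun P \<omega>)"
proof -
  show ?thesis
    unfolding char_fun_def Bochner_Integration.integral_cnj[symmetric]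
    by (intro Bochner_Integration.integral_cong refl) (simp add: exp_cnj)
qed

text \<open>Replacing \<omega> by its negative conjugates a characteristic function. Agreement at
  both points gives agreement of cos \<alpha> Re and of sin \<alpha> Im separately, and the nonzero
  factors cancel.\<close>

lemma random_phase_separates:
  fixes P Q :: "'a::euclidean_space measure"
  assumes P: "finite_measure P" "sets P = sets borel" and Q: "finite_measure Q" "sets Q = sets borel"
    and ne: "P \<noteq> Q" and \<alpha>: "sin \<alpha> \<noteq> 0" "cos \<alpha> \<noteq> 0"
  shows "\<exists>\<omega>. cos \<alpha> * Re (char_fun P \<omega>) - sin \<alpha> * Im (char_fun P \<omega>) \<noteq>
    cos \<alpha> * Re (char_fun Q \<omega>) - sin \<alpha> * Im (char_fun Q \<omega>)"
proof (rule ccontr)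
  assume "\<not> ?thesis"
  then have eq: "cos \<alpha> * Re (char_fun P \<omega>) - sin \<alpha> * Im (char_fun P \<omega>) =
    cos \<alpha> * Re (char_fun Q \<omega>) - sin \<alpha> * Im (char_fun Q \<omega>)" for \<omega> by blast
  have "char_fun P \<omega> = char_fun Q \<omega>" for \<omega>
  proof (rule complex_eqI)
    have "cos \<alpha> * Re (char_fun P \<omega>) + sin \<alpha> * Im (char_fun P \<omega>) =
      cos \<alpha> * Re (char_fun Q \<omega>) + sin \<alpha> * Im (char_fun Q \<omega>)"
      using eq[of "- \<omega>"] by (simp add: char_fun_uminus P Q)
    with eq[of \<omega>] have "cos \<alpha> * Re (char_fun P \<omega>) = cos \<alpha> * Re (char_fun Q \<omega>)"
      "sin \<alpha> * Im (char_fun P \<omega>) = sin \<alpha> * Im (char_fun Q \<omega>)" by linarith+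
    then show "Re (char_fun P \<omega>) = Re (char_fun Q \<omega>)" "Im (char_fun P \<omega>) = Im (char_fun Q \<omega>)"
      using \<alpha> by simp_all
  qed
  then have "P = Q" by (rule char_fun_inject[OF P Q])
  with ne show False by simp
qed

lemma integral_rff_nth:
  fixes P :: "(real ^ 'd ^ 'lag::finite) measure" and al :: "'k::finite \<Rightarrow> real"
  assumes P: "finite_measure P" "sets P = sets borel"
  shows "(LINT x|P. rff Om al x) $ i =
    cos (al i) * Re (char_fun P (\<chi> j. Om i j)) - sin (al i) * Im (char_fun P (\<chi> j. Om i j))"
proof -
  have rff: "rff Om al x $ i = cos ((\<chi> j. Om i j) \<bullet> x + al i)" for i x
    by (simp add: rff_def inner_vec_def)
  have cont: "continuous_on UNIV (rff Om al)"
    unfolding rff_def by (intro continuous_intros)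
  have "integrable P (rff Om al)"
  proof (rule integrable_bounded_continuous[OF P cont])
    fix x
    have "norm (rff Om al x) \<le> (\<Sum>i\<in>UNIV. \<bar>rff Om al x $ i\<bar>)" by (rule norm_le_l1_cart)
    also have "\<dots> \<le> (\<Sum>i\<in>(UNIV :: 'k set). 1)" by (intro sum_mono) (simp add: rff)
    finally show "norm (rff Om al x) \<le> (\<Sum>i\<in>(UNIV :: 'k set). 1)" .
  qed
  then have "(LINT x|P. rff Om al x) $ i = (LINT x|P. rff Om al x $ i)"
    by (rule integral_bounded_linear[OF bounded_linear_vec_nth, symmetric])
  then show ?thesis by (simp add: rff integral_cos_eq_char_fun[OF P])
qed

theorem theorem3:
  fixes M :: "'w measure"
    and s m :: nat
    and pos :: "'lag::finite \<Rightarrow> nat"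
    and \<Theta> :: "(real ^ 'p) set"
    and \<theta>0 :: "real ^ 'p"
    and \<epsilon> :: "int \<Rightarrow> 'w \<Rightarrow> real"
    and \<epsilon>' :: "nat \<Rightarrow> int \<Rightarrow> 'w \<Rightarrow> real"
    and Gn :: "real \<Rightarrow> nat \<Rightarrow> nat \<Rightarrow> (nat \<Rightarrow> real) \<Rightarrow> real ^ 'p \<Rightarrow> real ^ 'd"
    and Om :: "'k::finite \<Rightarrow> 'lag \<Rightarrow> 'w \<Rightarrow> real ^ 'd"
    and al :: "'k \<Rightarrow> 'w \<Rightarrow> real"
    and Xobs :: "nat \<Rightarrow> nat \<Rightarrow> 'w \<Rightarrow> real ^ 'd"
    and Xsim :: "nat \<Rightarrow> nat \<Rightarrow> nat \<Rightarrow> real ^ 'p \<Rightarrow> 'w \<Rightarrow> real ^ 'd"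
    and G :: "real \<Rightarrow> (nat \<Rightarrow> real) \<Rightarrow> real ^ 'p \<Rightarrow> real ^ 'd"
    and g :: "real \<Rightarrow> real ^ 'p \<Rightarrow> real ^ 'q"
    and Gt :: "real \<Rightarrow> (nat \<Rightarrow> real) \<Rightarrow> real ^ 'q \<Rightarrow> real ^ 'd"
  assumes prob: "prob_space M"
    and s: "s \<ge> 1"
    and lags: "bij_betw pos UNIV {1..m + 1}"
    and k: "CARD('k) = 2 * CARD('p) + 1"
    and \<theta>0: "\<theta>0 \<in> \<Theta>"
    and noise: "iid_sequence M \<epsilon>" "iid_copies M \<epsilon> \<epsilon>' s"
    and Gn_measurable: "\<And>u i r. u \<in> {0..1} \<Longrightarrow> i \<ge> 1 \<Longrightarrow> r \<le> s \<Longrightarrow>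
          (\<lambda>(x, \<theta>). Gn u i r x \<theta>) \<in> borel_measurable (seq_space \<Otimes>\<^sub>M restrict_space borel \<Theta>)"
    and Gn_ergodic: "\<And>u i r \<theta>. u \<in> {0..1} \<Longrightarrow> i \<ge> 1 \<Longrightarrow> r \<le> s \<Longrightarrow> \<theta> \<in> \<Theta> \<Longrightarrow>
          stationary_ergodic M (\<lambda>j w. Gn u i r (past \<epsilon> j w) \<theta>)"
    and features: "rff_parameters M \<epsilon> \<epsilon>' s Om al"
    and B1_obs: "\<And>n t w. n \<ge> 1 \<Longrightarrow> t \<in> {1..n} \<Longrightarrow> w \<in> space M \<Longrightarrow>
          Xobs n t w = Gn (real t / real n) n 0 (past (\<epsilon>' 0) (int t) w) \<theta>0"
    and B1_sim: "\<And>n t r \<theta> w. n \<ge> 1 \<Longrightarrow> t \<in> {1..n} \<Longrightarrow> r \<in> {1..s} \<Longrightarrow> \<theta> \<in> \<Theta> \<Longrightarrow> w \<in> space M \<Longrightarrow>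
          Xsim n t r \<theta> w = Gn (real t / real n) n r (past (\<epsilon>' r) (int t) w) \<theta>"
    and B2_measurable: "\<And>u. u \<in> {0..1} \<Longrightarrow>
          (\<lambda>(x, \<theta>). G u x \<theta>) \<in> borel_measurable (seq_space \<Otimes>\<^sub>M restrict_space borel \<Theta>)"
    and B2_ergodic: "\<And>u \<theta>. u \<in> {0..1} \<Longrightarrow> \<theta> \<in> \<Theta> \<Longrightarrow>
          stationary_ergodic M (\<lambda>j w. G u (past \<epsilon> j w) \<theta>)"
    and B2_approx: "\<exists>q>2.
          (\<lambda>i. SUP \<theta>\<in>\<Theta>. SUP u\<in>{0..1}. MAX r\<in>{0..s}.
             Lq_norm M q (\<lambda>w. Gn u i r (past \<epsilon> 0 w) \<theta> - G u (past \<epsilon> 0 w) \<theta>))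
          \<longlonglongrightarrow> 0"
    and B3_map: "\<And>u. u \<in> {0..1} \<Longrightarrow> (\<exists>L. L-lipschitz_on \<Theta> (g u)) \<and> semialgebraic_map \<Theta> UNIV (g u)"
    and B3_measurable: "\<And>u. u \<in> {0..1} \<Longrightarrow>
          (\<lambda>(x, \<theta>t). Gt u x \<theta>t) \<in> borel_measurable (seq_space \<Otimes>\<^sub>M restrict_space borel (g u ` \<Theta>))"
    and B3_eq: "\<And>u \<theta>. u \<in> {0..1} \<Longrightarrow> \<theta> \<in> \<Theta> \<Longrightarrow>
          AE w in M. Gt u (past \<epsilon> 0 w) (g u \<theta>) = G u (past \<epsilon> 0 w) \<theta>"
    and B3_ergodic: "\<And>u \<theta>t. u \<in> {0..1} \<Longrightarrow> \<theta>t \<in> g u ` \<Theta> \<Longrightarrow>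
          stationary_ergodic M (\<lambda>j w. Gt u (past \<epsilon> j w) \<theta>t)"
    and B3_joint: "(\<lambda>(u, \<theta>). g u \<theta>) \<in> borel_measurable (restrict_space borel ({0..1} \<times> \<Theta>))"
    and B4_compact: "\<And>u. u \<in> {0..1} \<Longrightarrow> compact (g u ` \<Theta>)"
    and B4_Theta: "compact \<Theta>" "semialgebraic \<Theta>" "interior \<Theta> \<noteq> {}"
    and B4_inj: "\<And>u. u \<in> {0..1} \<Longrightarrow> inj_on (\<lambda>\<theta>t. local_law M \<epsilon> pos m Gt u \<theta>t) (g u ` \<Theta>)"
    and B4_analytic: "\<And>u. u \<in> {0..1} \<Longrightarrow>
          \<exists>U \<Psi>. open U \<and> g u ` \<Theta> \<subseteq> U \<and> real_analytic_complex_on \<Psi> (U \<times> UNIV) \<and>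
            (\<forall>\<theta>t\<in>g u ` \<Theta>. \<forall>\<omega>. \<Psi> (\<theta>t, \<omega>) = char_fun (local_law M \<epsilon> pos m Gt u \<theta>t) \<omega>)"
    and B5_weak: "\<And>U. open U \<Longrightarrow> {u \<in> {0..1}. g u ` \<Theta> \<inter> U \<noteq> {}} \<in> sets borel"
    and B5_ext: "\<exists>\<psi>. (\<lambda>(u, \<theta>t, \<omega>). \<psi> u \<theta>t \<omega>) \<in>
              borel_measurable (restrict_space borel ({0..1} \<times> UNIV \<times> UNIV)) \<and>
            (\<forall>u\<in>{0..1}. \<forall>\<theta>t\<in>g u ` \<Theta>. \<forall>\<omega>.
               \<psi> u \<theta>t \<omega> = char_fun (local_law M \<epsilon> pos m Gt u \<theta>t) \<omega>) \<and>
            (\<forall>u\<in>{0..1}. \<forall>\<omega>. continuous_on UNIV (\<lambda>\<theta>t. \<psi> u \<theta>t \<omega>))"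
  shows "AE w in M. AE u in lebesgue_on {0..1}.
           inj_on (local_moment M \<epsilon> pos m Gt (rff (\<lambda>i j. Om i j w) (\<lambda>i. al i w)) u) (g u ` \<Theta>)"
proof -
  interpret prob_space M by (rule prob)
  let ?law = "local_law M \<epsilon> pos m Gt"
  have law: "finite_measure (?law u z)" "sets (?law u z) = sets borel" if "u \<in> {0..1}" "z \<in> g u ` \<Theta>" for u z
  proof -
    have "(\<lambda>w. Gt u (past \<epsilon> j w) z) \<in> borel_measurable M" for j
      using B3_ergodic[OF that] by (simp add: stationary_ergodic_def)
    then have "(\<lambda>w. \<chi> j. Gt u (past \<epsilon> (int (pos j) - 1 - int m) w) z) \<in> borel_measurable M"
      by (intro borel_measurable_vec_lambda)
    from prob_space_distr[OF this] show "finite_measure (?law u z)"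
      by (simp add: local_law_def prob_space.finite_measure)
    show "sets (?law u z) = sets borel" by (simp add: local_law_def)
  qed
  obtain \<psi> where \<psi>m: "(\<lambda>(u, z, \<omega>). \<psi> u z \<omega>) \<in> borel_measurable (restrict_space borel ({0..1} \<times> UNIV \<times> UNIV))"
    and \<psi>eq: "\<And>u z \<omega>. u \<in> {0..1} \<Longrightarrow> z \<in> g u ` \<Theta> \<Longrightarrow> \<psi> u z \<omega> = char_fun (?law u z) \<omega>"
    and \<psi>cont: "\<And>u \<omega>. u \<in> {0..1} \<Longrightarrow> continuous_on UNIV (\<lambda>z. \<psi> u z \<omega>)"
    using B5_ext by blast
  \<comment> \<open>The moments written through the measurable extension \<psi>, which is defined
    for all z; they are identified with the true moments only on the image of \<Theta>.\<close>
  define \<Phi> :: "'k \<Rightarrow> real \<Rightarrow> real ^ 'q \<Rightarrow> (real ^ 'k) \<times> (real ^ 'd ^ 'lag ^ 'k) \<Rightarrow> real" where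
    "\<Phi> i u z v = cos (fst v $ i) * Re (\<psi> u z (snd v $ i)) - sin (fst v $ i) * Im (\<psi> u z (snd v $ i))" for i u z v
  \<comment> \<open>Condenses the k equations into a single real one, the form in which
    measurability of the collision set was proved.\<close>
  define h where "h u z1 z2 v = (\<Sum>i\<in>UNIV. \<bar>\<Phi> i u z1 v - \<Phi> i u z2 v\<bar>)" for u z1 z2 v
  have h0: "h u z1 z2 v = 0 \<longleftrightarrow> (\<forall>i. \<Phi> i u z1 v = \<Phi> i u z2 v)" for u z1 z2 v
    by (simp add: h_def sum_nonneg_eq_0_iff)
  define B where "B = {(u, v). u \<in> {0..1} \<and> (\<exists>z1\<in>g u ` \<Theta>. \<exists>z2\<in>g u ` \<Theta>. z1 \<noteq> z2 \<and> h u z1 z2 v = 0)}"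
  have B: "B \<in> sets borel"
    unfolding B_def
  proof (rule measurable_zero_off_diagonal[OF B4_compact B5_weak])
    fix u :: real and v assume u: "u \<in> {0..1}"
    have c: "continuous_on UNIV (\<lambda>p. \<psi> u (f p) \<omega>)" if "continuous_on UNIV f"
      for f :: "(real ^ 'q) \<times> (real ^ 'q) \<Rightarrow> real ^ 'q" and \<omega>
      by (rule continuous_on_compose2[OF \<psi>cont[OF u] that]) simp
    show "continuous_on UNIV (\<lambda>(z1, z2). h u z1 z2 v)"
      unfolding h_def \<Phi>_def case_prod_unfold by (intro continuous_intros c)
  next
    fix z1 z2
    let ?R = "restrict_space borel ({0..1} \<times> UNIV) :: (real \<times> (real ^ 'k) \<times> (real ^ 'd ^ 'lag ^ 'k)) measure"
    have "(\<lambda>(u, v). \<psi> u z (snd v $ i)) \<in> borel_measurable ?R" for z i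
    proof -
      have "(\<lambda>p. (fst p, z, snd (snd p) $ i)) \<in> measurable ?R (restrict_space borel ({0..1} \<times> UNIV \<times> UNIV))"
      proof (rule measurable_restrict_space2)
        show "(\<lambda>p. (fst p, z, snd (snd p) $ i)) \<in> space ?R \<rightarrow> {0..1} \<times> UNIV \<times> UNIV"
          by (auto simp: space_restrict_space)
        show "(\<lambda>p. (fst p, z, snd (snd p) $ i)) \<in> borel_measurable ?R"
          by (intro measurable_restrict_space1 borel_measurable_continuous_onI continuous_intros)
      qed
      from measurable_compose[OF this \<psi>m] show ?thesis by (simp add: case_prod_unfold)
    qed
    moreover have "(\<lambda>(u, v). fst v $ i) \<in> borel_measurable ?R" for i
      unfolding case_prod_unfold
      by (intro measurable_restrict_space1 borel_measurable_continuous_onI continuous_intros)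
    ultimately show "(\<lambda>(u, v). h u z1 z2 v) \<in> borel_measurable ?R"
      unfolding h_def \<Phi>_def case_prod_unfold by measurable
  qed
  let ?\<alpha> = "\<lambda>w. \<chi> i. al i w" and ?\<Omega> = "\<lambda>w. \<chi> i j. Om i j w"
  have inj: "inj_on (local_moment M \<epsilon> pos m Gt (rff (\<lambda>i j. Om i j w) (\<lambda>i. al i w)) u) (g u ` \<Theta>)"
    if u: "u \<in> {0..1}" and nB: "(u, ?\<alpha> w, ?\<Omega> w) \<notin> B" for u w
  proof (rule inj_onI, rule ccontr)
    fix z1 z2
    assume z: "z1 \<in> g u ` \<Theta>" "z2 \<in> g u ` \<Theta>" "z1 \<noteq> z2"
      and eq: "local_moment M \<epsilon> pos m Gt (rff (\<lambda>i j. Om i j w) (\<lambda>i. al i w)) u z1 =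
        local_moment M \<epsilon> pos m Gt (rff (\<lambda>i j. Om i j w) (\<lambda>i. al i w)) u z2"
    have "local_moment M \<epsilon> pos m Gt (rff (\<lambda>i j. Om i j w) (\<lambda>i. al i w)) u z $ i = \<Phi> i u z (?\<alpha> w, ?\<Omega> w)"
      if "z \<in> g u ` \<Theta>" for z i
      using \<psi>eq[OF u that] by (simp add: local_moment_def integral_rff_nth[OF law[OF u that]] \<Phi>_def)
    with eq z have "h u z1 z2 (?\<alpha> w, ?\<Omega> w) = 0" unfolding h0 by metis
    with z u nB show False unfolding B_def by blast
  qed
  \<comment> \<open>For u in [0, 1] this is the dimension count. Outside, the section of
    \<open>B\<close> is empty, so Fubini can run over the whole line.\<close>
  have each: "AE w in M. (u, ?\<alpha> w, ?\<Omega> w) \<notin> B" for u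
  proof (cases "u \<in> {0..1}")
    case u: True
    obtain U \<Psi> where U: "open U" "g u ` \<Theta> \<subseteq> U" and an: "real_analytic_complex_on \<Psi> (U \<times> UNIV)"
      and \<Psi>: "\<And>z \<omega>. z \<in> g u ` \<Theta> \<Longrightarrow> \<Psi> (z, \<omega>) = char_fun (?law u z) \<omega>"
      using B4_analytic[OF u] by blast
    obtain L where lip: "L-lipschitz_on \<Theta> (g u)" using B3_map[OF u] by blast
    have "AE w in M. (?\<alpha> w, ?\<Omega> w) \<notin> {v. (u, v) \<in> B}"
    proof (rule AE_phases_frequencies[OF prob features])
      have "B \<in> sets (borel \<Otimes>\<^sub>M borel)" using B by (simp only: borel_prod)
      from sets_Pair1[OF this, of u] show "{v. (u, v) \<in> B} \<in> sets (borel \<Otimes>\<^sub>M borel)"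
        by (simp only: vimage_def borel_prod)
    next
      fix \<alpha> :: "real ^ 'k" assume \<alpha>: "\<And>i. sin (\<alpha> $ i) \<noteq> 0 \<and> cos (\<alpha> $ i) \<noteq> 0"
      \<comment> \<open>The same moments through the analytic extension \<Psi>; the sign sits in the
        coefficient so that sums and scalar multiples cover the expression.\<close>
      define f where "f i p = cos (\<alpha> $ i) * Re (\<Psi> p) + (- sin (\<alpha> $ i)) * Im (\<Psi> p)" for i p
      have f: "f i (z, \<omega>) = cos (\<alpha> $ i) * Re (char_fun (?law u z) \<omega>) - sin (\<alpha> $ i) * Im (char_fun (?law u z) \<omega>)"
        if "z \<in> g u ` \<Theta>" for i z \<omega>
        by (simp add: f_def \<Psi>[OF that])
      have "negligible {\<Omega>. \<exists>z1\<in>g u ` \<Theta>. \<exists>z2\<in>g u ` \<Theta>. z1 \<noteq> z2 \<and> (\<forall>i. f i (z1, \<Omega> $ i) = f i (z2, \<Omega> $ i))}"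
      proof (rule negligible_nonseparating[OF _ U lip])
        show "2 * CARD('p) < CARD('k)" using k by simp
        show "real_analytic_on (f i) (U \<times> UNIV)" for i
          unfolding f_def using an
          by (intro real_analytic_on_add real_analytic_on_cmult) (simp_all add: real_analytic_complex_on_def)
        show "\<exists>\<omega>. f i (z1, \<omega>) \<noteq> f i (z2, \<omega>)" if z: "z1 \<in> g u ` \<Theta>" "z2 \<in> g u ` \<Theta>" "z1 \<noteq> z2" for i z1 z2
        proof -
          have "?law u z1 \<noteq> ?law u z2" using inj_onD[OF B4_inj[OF u]] z by blast
          from random_phase_separates[OF law[OF u z(1)] law[OF u z(2)] this] \<alpha>[of i]
          show ?thesis unfolding f[OF z(1)] f[OF z(2)] by blast
        qed
      qed
      \<comment> \<open>\<open>\<Phi>\<close> and \<open>f\<close> may differ off the image of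
        \<Theta>, but a collision involves only two points of that image.\<close>
      moreover have "{\<Omega>. (\<alpha>, \<Omega>) \<in> {v. (u, v) \<in> B}} =
        {\<Omega>. \<exists>z1\<in>g u ` \<Theta>. \<exists>z2\<in>g u ` \<Theta>. z1 \<noteq> z2 \<and> (\<forall>i. f i (z1, \<Omega> $ i) = f i (z2, \<Omega> $ i))}"
      proof -
        have "\<Phi> i u z (\<alpha>, \<Omega>) = f i (z, \<Omega> $ i)" if "z \<in> g u ` \<Theta>" for i z \<Omega>
          by (simp add: \<Phi>_def f[OF that] \<psi>eq[OF u that])
        then have "h u z1 z2 (\<alpha>, \<Omega>) = 0 \<longleftrightarrow> (\<forall>i. f i (z1, \<Omega> $ i) = f i (z2, \<Omega> $ i))"
          if "z1 \<in> g u ` \<Theta>" "z2 \<in> g u ` \<Theta>" for z1 z2 \<Omega>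
          unfolding h0 using that by metis
        then show ?thesis using u unfolding B_def by blast
      qed
      ultimately show "negligible {\<Omega>. (\<alpha>, \<Omega>) \<in> {v. (u, v) \<in> B}}" by simp
    qed
    then show ?thesis by simp
  next
    case False
    then have "(u, v) \<notin> B" for v by (auto simp: B_def)
    then show ?thesis by simp
  qed
  have Om: "\<And>i j. Om i j \<in> borel_measurable M" and al: "\<And>i. al i \<in> borel_measurable M"
    using features by (auto simp: rff_parameters_def)
  interpret product: pair_sigma_finite M lborel
    by (intro pair_sigma_finite.intro sigma_finite_lborel) unfold_locales
  \<comment> \<open>The exchange of the two almost-everywhere quantifiers, for which
    \<open>B\<close> had to be Borel.\<close>
  have "(AE w in M. AE u in lborel. (u, ?\<alpha> w, ?\<Omega> w) \<notin> B) \<longleftrightarrow> (AE u in lborel. AE w in M. (u, ?\<alpha> w, ?\<Omega> w) \<notin> B)"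
  proof (rule product.AE_commute)
    have "(\<lambda>p. (snd p, ?\<alpha> (fst p), ?\<Omega> (fst p))) \<in> measurable (M \<Otimes>\<^sub>M lborel) (borel \<Otimes>\<^sub>M borel \<Otimes>\<^sub>M borel)"
      by (intro measurable_Pair measurable_compose[OF measurable_fst borel_measurable_vec_lambda] borel_measurable_vec_lambda Om al)
        simp
    moreover have "- B \<in> sets (borel \<Otimes>\<^sub>M borel \<Otimes>\<^sub>M borel)"
      unfolding borel_prod using B by (rule borel_comp)
    ultimately have "(\<lambda>p. (snd p, ?\<alpha> (fst p), ?\<Omega> (fst p))) -` (- B) \<inter> space (M \<Otimes>\<^sub>M lborel) \<in> sets (M \<Otimes>\<^sub>M lborel)"
      by (rule measurable_sets)
    also have "(\<lambda>p. (snd p, ?\<alpha> (fst p), ?\<Omega> (fst p))) -` (- B) \<inter> space (M \<Otimes>\<^sub>M lborel) =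
      {p \<in> space (M \<Otimes>\<^sub>M lborel). (snd p, ?\<alpha> (fst p), ?\<Omega> (fst p)) \<notin> B}" by auto
    finally show "{p \<in> space (M \<Otimes>\<^sub>M lborel). (snd p, ?\<alpha> (fst p), ?\<Omega> (fst p)) \<notin> B} \<in> sets (M \<Otimes>\<^sub>M lborel)" .
  qed
  then have "AE w in M. AE u in lborel. (u, ?\<alpha> w, ?\<Omega> w) \<notin> B" using each by simp
  then show ?thesis
  proof (rule eventually_mono)
    fix w assume "AE u in lborel. (u, ?\<alpha> w, ?\<Omega> w) \<notin> B"
    then have "AE u in lebesgue. (u, ?\<alpha> w, ?\<Omega> w) \<notin> B" by (rule AE_completion)
    then have "AE u in lebesgue. u \<in> {0..1} \<longrightarrow>
        inj_on (local_moment M \<epsilon> pos m Gt (rff (\<lambda>i j. Om i j w) (\<lambda>i. al i w)) u) (g u ` \<Theta>)"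
      by (rule eventually_mono) (use inj in blast)
    then show "AE u in lebesgue_on {0..1}.
        inj_on (local_moment M \<epsilon> pos m Gt (rff (\<lambda>i j. Om i j w) (\<lambda>i. al i w)) u) (g u ` \<Theta>)"
      by (subst AE_restrict_space_iff) auto
  qed
qed

end
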